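(* Let $G$ be a finite simple graph that is triangle-free and has maximum degree at most $3$. Then $\chi_f(G) \leq 3 - \frac{3}{43}$.
   Context: For a finite simple graph $G$, let $\mathcal{I}(G)$ be the family of independent sets of $G$. A map $f\colon \mathcal{I}(G)\to[0,1]$ is an $r$-fractional coloring if $\sum_{S\in\mathcal{I}(G)} f(S)\le r$ and $\sum_{S\in\mathcal{I}(G),\, v\in S} f(S)\ge 1$ for every vertex $v$. The fractional chromatic number $\chi_f(G)$ is the least $r$ for which $G$ has an $r$-fractional coloring. Equivalently, $\chi_f(G)=\min a/b$ over all $a$:$b$-colorings, i.e. assignments of $b$-element subsets of an $a$-element palette to the vertices such that adjacent vertices receive disjoint sets. *)

theory Defs
  imports "HOL-Analysis.Analysis" "Graph_Theory.Pair_Digraph"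
begin

text \<open>
  Finite simple graphs are rendered by the locale \<^locale>\<open>pair_graph\<close>: a finite vertex set with
  a symmetric, irreflexive set of arcs on it. Each edge uv is the pair of arcs (u,v) and (v,u), so
  the degree of a vertex is its out-degree (equally, its in-degree).
\<close>

definition triangle_free :: "'a pair_pre_digraph \<Rightarrow> bool" where
  "triangle_free G \<longleftrightarrow>
     \<not> (\<exists>u v w. (u, v) \<in> parcs G \<and> (v, w) \<in> parcs G \<and> (w, u) \<in> parcs G)"

definition independent_sets :: "'a pair_pre_digraph \<Rightarrow> 'a set set" where
  "independent_sets G = {S. S \<subseteq> pverts G \<and> (\<forall>u\<in>S. \<forall>v\<in>S. (u, v) \<notin> parcs G)}"

text \<open>
  Only the values of f on the independent sets of G matter; f is unconstrained elsewhere.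
\<close>

definition fractional_coloring :: "'a pair_pre_digraph \<Rightarrow> real \<Rightarrow> ('a set \<Rightarrow> real) \<Rightarrow> bool" where
  "fractional_coloring G r f \<longleftrightarrow>
     f \<in> independent_sets G \<rightarrow> {0..1} \<and>
     (\<Sum>S\<in>independent_sets G. f S) \<le> r \<and>
     (\<forall>v\<in>pverts G. (\<Sum>S\<in>{S \<in> independent_sets G. v \<in> S}. f S) \<ge> 1)"

definition fractional_chromatic_number :: "'a pair_pre_digraph \<Rightarrow> real" where
  "fractional_chromatic_number G = (LEAST r. \<exists>f. fractional_coloring G r f)"

lemma finite_independent_sets:
  assumes "finite (pverts G)"
  shows "finite (independent_sets G)"
  by (rule finite_subset[of _ "Pow (pverts G)"]) (auto simp: independent_sets_def assms)

text \<open>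
  The reals are not well-ordered, so that the least value exists needs a proof: the fractional
  colorings form a nonempty compact set, on which the total weight attains its minimum.
\<close>

lemma least_fractional_coloring_exists:
  fixes G :: "'a pair_pre_digraph"
  assumes "pair_graph G"
  shows "\<exists>r. (\<exists>f. fractional_coloring G r f) \<and>
             (\<forall>r'. (\<exists>f. fractional_coloring G r' f) \<longrightarrow> r \<le> r')"
proof -
  interpret pair_graph G by fact
  define I where "I = independent_sets G"
  have finI: "finite I"
    unfolding I_def using pair_finite_verts by (rule finite_independent_sets)
  define B where "B = Pi\<^sub>E UNIV (\<lambda>S. if S \<in> I then {0..1} else {0::real})"
  define C where "C v = {f :: 'a set \<Rightarrow> real. (\<Sum>S\<in>{S \<in> I. v \<in> S}. f S) \<ge> 1}" for v
  define K where "K = B \<inter> (\<Inter>v\<in>pverts G. C v)"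
  have "compactin (product_topology (\<lambda>_. euclidean) UNIV) B"
    unfolding B_def compactin_PiE by auto
  then have compB: "compact B"
    by (simp add: euclidean_product_topology)
  have cont: "continuous_on UNIV (\<lambda>f :: 'a set \<Rightarrow> real. \<Sum>S\<in>J. f S)" for J
    by (intro continuous_on_sum continuous_on_product_coordinates)
  have "closed (C v)" for v
    unfolding C_def by (intro closed_Collect_le continuous_on_const cont)
  then have compK: "compact K"
    unfolding K_def using compB by (intro compact_Int_closed closed_INT) auto
  have "(\<lambda>S. if S \<in> I then 1 else 0) \<in> K"
  proof -
    have "1 \<le> (\<Sum>S\<in>{S \<in> I. v \<in> S}. if S \<in> I then 1 else (0::real))"
      if v: "v \<in> pverts G" for v
    proof -
      have "{v} \<in> I"
        using v pair_no_loops by (fastforce simp: I_def independent_sets_def)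
      then have "1 \<le> card {S \<in> I. v \<in> S}"
        using finI by (auto simp: Suc_le_eq card_gt_0_iff)
      then show ?thesis by simp
    qed
    then show ?thesis by (auto simp: K_def B_def C_def)
  qed
  then have "K \<noteq> {}" by auto
  then obtain f where f: "f \<in> K" and min: "\<And>g. g \<in> K \<Longrightarrow> (\<Sum>S\<in>I. f S) \<le> (\<Sum>S\<in>I. g S)"
    using continuous_attains_inf[OF compK _ continuous_on_subset[OF cont]] by blast
  show ?thesis
  proof (intro exI[of _ "\<Sum>S\<in>I. f S"] conjI allI impI)
    have "f S \<in> {0..1}" if "S \<in> I" for S
      using f that by (auto simp: K_def B_def PiE_iff split: if_splits)
    then have "fractional_coloring G (\<Sum>S\<in>I. f S) f"
      using f unfolding fractional_coloring_def I_def[symmetric] K_def C_def by auto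
    then show "\<exists>f'. fractional_coloring G (\<Sum>S\<in>I. f S) f'" by (rule exI[of _ f])
  next
    fix r assume "\<exists>g. fractional_coloring G r g"
    then obtain g where g: "fractional_coloring G r g" ..
    define h where "h S = (if S \<in> I then g S else 0)" for S
    have "(\<Sum>S\<in>{S \<in> I. v \<in> S}. h S) = (\<Sum>S\<in>{S \<in> I. v \<in> S}. g S)" for v
      by (intro sum.cong) (auto simp: h_def)
    moreover have "h \<in> B"
      using g unfolding fractional_coloring_def I_def[symmetric] B_def h_def by auto
    ultimately have "h \<in> K"
      using g unfolding fractional_coloring_def I_def[symmetric] K_def C_def by auto
    then have "(\<Sum>S\<in>I. f S) \<le> (\<Sum>S\<in>I. h S)" by (rule min)
    also have "\<dots> = (\<Sum>S\<in>I. g S)" by (intro sum.cong) (auto simp: h_def)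
    also have "\<dots> \<le> r" using g by (simp add: fractional_coloring_def I_def)
    finally show "(\<Sum>S\<in>I. f S) \<le> r" .
  qed
qed

lemma fractional_chromatic_number_least:
  assumes "pair_graph G"
  shows "\<exists>f. fractional_coloring G (fractional_chromatic_number G) f"
    and "fractional_coloring G r f \<Longrightarrow> fractional_chromatic_number G \<le> r"
proof -
  obtain m where m: "\<exists>f. fractional_coloring G m f"
    "\<And>r. \<exists>f. fractional_coloring G r f \<Longrightarrow> m \<le> r"
    using least_fractional_coloring_exists[OF assms] by blast
  then have eq: "fractional_chromatic_number G = m"
    unfolding fractional_chromatic_number_def by (intro Least_equality)
  show "\<exists>f. fractional_coloring G (fractional_chromatic_number G) f"
    using m(1) eq by simp
  show "fractional_coloring G r f \<Longrightarrow> fractional_chromatic_number G \<le> r"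
    using m(2) eq by blast
qed

end

theory Submission
  imports Defs
begin

text \<open>
  The colours are split into 42 palettes of three. By induction on the number of vertices the graph
  may be taken to be connected and no odd cycle avoiding a closed neighbourhood \<open>N[x]\<close> to lie in
  the second neighbourhood of \<open>x\<close>: such a cycle has five vertices and together with \<open>N[x]\<close> sends out
  at most one edge, so that colourings of the two sides can be glued after a permutation of the
  colours, unless the graph has only nine vertices. The vertices are partitioned greedily into 42
  classes such that for each class \<open>X\<close> there is a proper 3-colouring in which the neighbours of
  every \<open>x \<in> X\<close> share one colour. Then \<open>x\<close> can carry two colours, and every vertex receives
  \<open>41 + 2 = 43\<close> of the \<open>126\<close> colours.

  For the 3-colouring, the stars of the vertices of \<open>X\<close> are contracted. The contracted vertices form
  an independent set of vertices of degree at most six, and all others have degree at most three.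
  After the contracted vertices are coloured, a component of the rest can be coloured from its
  lists unless its end blocks are odd cycles with almost all vertices next to contracted ones whose
  colours agree. By Hall's theorem each such component can be assigned a contracted vertex next to
  one of its cycles, at most two components to each vertex, and each contracted vertex is coloured
  differently from the at most two others that it has to avoid.
\<close>

section \<open>List colourings\<close>

text \<open>With m palettes of three, one of which gives a vertex two colours, the ratio is 3m / (m
  + 1) = 3 - 3 / (m + 1). So 42 classes are wanted: a vertex may meet at most 41 conflicts when it
  is placed. Members of a class at distance at least five would be ideal, as no vertex is then next
  to two contracted stars; but a ball of radius four can have 46 vertices. Placing vertices in the
  direction of the star of one vertex of degree three spares the vertex itself and four later ones.
  In that star this fails; instead, one vertex \<open>w0\<close> per class may be next to two
  contracted stars, which the Hall count just tolerates, as 3a \<le> 6b + 1 still gives a \<le> 2b.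
  The second obstacle is an odd cycle almost wholly at distance two from a class member x, since x
  alone then dictates its lists. If at most one cycle vertex lies elsewhere, x is
  \<open>pure\<close>: the cycle joins the contraction, and the resulting vertex has degree at most
  three. If two do, x is \<open>heavy\<close> and is ranked above the other owners of slots on the
  cycle, so that it is not the lowest ranked one, whose slots do not count.\<close>

definition nbs :: "('a \<Rightarrow> 'a \<Rightarrow> bool) \<Rightarrow> 'a set \<Rightarrow> 'a \<Rightarrow> 'a set" where
  "nbs E S v = {u \<in> S. E v u}"

text \<open>Connectivity by cuts rather than paths: the greedy arguments need precisely an edge that
  leaves a given part. The empty set counts as connected.\<close>

definition conn :: "('a \<Rightarrow> 'a \<Rightarrow> bool) \<Rightarrow> 'a set \<Rightarrow> bool" where
  "conn E S \<longleftrightarrow> (\<forall>T \<subseteq> S. T \<noteq> {} \<longrightarrow> T \<noteq> S \<longrightarrow> (\<exists>v\<in>T. \<exists>u\<in>S - T. E v u))"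

definition proper_on :: "('a \<Rightarrow> 'a \<Rightarrow> bool) \<Rightarrow> 'a set \<Rightarrow> ('a \<Rightarrow> 'c) \<Rightarrow> bool" where
  "proper_on E S c \<longleftrightarrow> (\<forall>u\<in>S. \<forall>v\<in>S. E u v \<longrightarrow> c u \<noteq> c v)"

definition list_col :: "('a \<Rightarrow> 'a \<Rightarrow> bool) \<Rightarrow> 'a set \<Rightarrow> ('a \<Rightarrow> 'c set) \<Rightarrow> ('a \<Rightarrow> 'c) \<Rightarrow> bool" where
  "list_col E S L c \<longleftrightarrow> proper_on E S c \<and> (\<forall>v\<in>S. c v \<in> L v)"

definition is_comp :: "('a \<Rightarrow> 'a \<Rightarrow> bool) \<Rightarrow> 'a set \<Rightarrow> 'a set \<Rightarrow> bool" where
  "is_comp E S Q \<longleftrightarrow> Q \<subseteq> S \<and> Q \<noteq> {} \<and> conn E Q \<and> (\<forall>u\<in>Q. \<forall>w\<in>S. E u w \<longrightarrow> w \<in> Q)"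

text \<open>A chordless cycle, as a connected 2-regular induced subgraph. No cyclic order is fixed,
  since the colouring arguments only count degrees.\<close>

definition ind_cyc :: "('a \<Rightarrow> 'a \<Rightarrow> bool) \<Rightarrow> 'a set \<Rightarrow> bool" where
  "ind_cyc E C \<longleftrightarrow> finite C \<and> C \<noteq> {} \<and> conn E C \<and> (\<forall>v\<in>C. card (nbs E C v) = 2)"

lemma finite_nbs [simp]: "finite S \<Longrightarrow> finite (nbs E S v)"
  by (simp add: nbs_def)

lemma nbs_subset: "nbs E S v \<subseteq> S"
  by (auto simp: nbs_def)

lemma nbs_mono: "S \<subseteq> T \<Longrightarrow> nbs E S v \<subseteq> nbs E T v"
  by (auto simp: nbs_def)

lemma card_nbs_mono: "finite T \<Longrightarrow> S \<subseteq> T \<Longrightarrow> card (nbs E S v) \<le> card (nbs E T v)"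
  by (intro card_mono nbs_mono) auto

lemma card_nbs_less:
  assumes "finite T" "S \<subseteq> T" "u \<in> T - S" "E v u"
  shows "card (nbs E S v) < card (nbs E T v)"
  using assms by (intro psubset_card_mono) (auto simp: nbs_def)

lemma card_nbs_split:
  assumes "finite A" "B \<subseteq> A"
  shows "card (nbs E A v) = card (nbs E B v) + card (nbs E (A - B) v)"
proof -
  have "nbs E A v = nbs E B v \<union> nbs E (A - B) v" using assms by (auto simp: nbs_def)
  moreover have "nbs E B v \<inter> nbs E (A - B) v = {}" by (auto simp: nbs_def)
  ultimately show ?thesis
    using assms finite_subset[OF assms(2,1)] by (simp add: card_Un_disjoint)
qed

text \<open>The vertex whose list is longer than its degree in the whole set is coloured last; the
  hypothesis passes to subsets, so that induction applies.\<close>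

lemma degenerate_list_col:
  fixes L :: "'a \<Rightarrow> 'c set"
  assumes "finite S" and sym: "\<And>u v. E u v \<Longrightarrow> E v u" and irr: "\<And>v. \<not> E v v"
    and "\<And>T. T \<subseteq> S \<Longrightarrow> T \<noteq> {} \<Longrightarrow> \<exists>v\<in>T. card (nbs E T v) < card (L v)"
  shows "\<exists>c. list_col E S L c"
  using assms(1,4)
proof (induction "card S" arbitrary: S rule: less_induct)
  case less
  show ?case
  proof (cases "S = {}")
    case True
    then show ?thesis by (auto simp: list_col_def proper_on_def)
  next
    case False
    then obtain v where v: "v \<in> S" "card (nbs E S v) < card (L v)" using less.prems by blast
    have "card (S - {v}) < card S" using v less.prems by (meson card_Diff1_less)
    then obtain c where c: "list_col E (S - {v}) L c"
      using less.hyps[of "S - {v}"] less.prems by blast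
    have "card (c ` nbs E S v) < card (L v)"
      using v card_image_le[of "nbs E S v" c] less.prems(1) by (meson finite_nbs le_less_trans)
    then have "\<not> L v \<subseteq> c ` nbs E S v"
      using less.prems(1) by (metis card_mono finite_imageI finite_nbs not_less)
    then obtain a where a: "a \<in> L v" "a \<notin> c ` nbs E S v" by blast
    have "proper_on E S (c(v := a))"
      using c a sym irr unfolding list_col_def proper_on_def nbs_def by (auto 0 3)
    then have "list_col E S L (c(v := a))"
      using c a unfolding list_col_def by auto
    then show ?thesis by blast
  qed
qed

lemma conn_boundary:
  assumes "conn E S" "T \<subseteq> S" "T \<noteq> {}" "T \<noteq> S"
  obtains v u where "v \<in> T" "u \<in> S - T" "E v u"
  using assms unfolding conn_def by blast

lemma conn_insert:
  assumes "conn E R" "r \<in> R" "E r w" "E w r"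
  shows "conn E (insert w R)"
  unfolding conn_def
proof (intro allI impI)
  fix T assume T: "T \<subseteq> insert w R" "T \<noteq> {}" "T \<noteq> insert w R"
  show "\<exists>v\<in>T. \<exists>u\<in>insert w R - T. E v u"
  proof (cases "T \<inter> R = {} \<or> T \<inter> R = R")
    case True
    then show ?thesis
    proof
      assume "T \<inter> R = {}"
      then have "T = {w}" "w \<notin> R" using T by auto
      then show ?thesis using assms by auto
    next
      assume "T \<inter> R = R"
      then have "R \<subseteq> T" "w \<notin> T" using T by auto
      then show ?thesis using assms by auto
    qed
  next
    case False
    then obtain v u where "v \<in> T \<inter> R" "u \<in> R - T \<inter> R" "E v u"
      using conn_boundary[OF assms(1), of "T \<inter> R"] by blast
    then show ?thesis by blast
  qed
qed

lemma conn_Un: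
  assumes "conn E A" "conn E B" "a \<in> A" "b \<in> B" "E a b" "E b a"
  shows "conn E (A \<union> B)"
  unfolding conn_def
proof (intro allI impI)
  fix T assume T: "T \<subseteq> A \<union> B" "T \<noteq> {}" "T \<noteq> A \<union> B"
  have sub: "\<exists>v\<in>T. \<exists>u\<in>A \<union> B - T. E v u"
    if D: "conn E D" "D \<subseteq> A \<union> B" "T \<inter> D \<noteq> {}" "T \<inter> D \<noteq> D" for D
  proof -
    obtain v u where "v \<in> T \<inter> D" "u \<in> D - T \<inter> D" "E v u"
      using conn_boundary[OF D(1), of "T \<inter> D"] D by blast
    then show ?thesis using D by blast
  qed
  show "\<exists>v\<in>T. \<exists>u\<in>A \<union> B - T. E v u"
  proof (cases "(T \<inter> A \<noteq> {} \<and> T \<inter> A \<noteq> A) \<or> (T \<inter> B \<noteq> {} \<and> T \<inter> B \<noteq> B)")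
    case True
    then show ?thesis using sub[of A] sub[of B] assms by blast
  next
    case False
    then consider "A \<subseteq> T" "T \<inter> B = {}" | "B \<subseteq> T" "T \<inter> A = {}" using T by blast
    then show ?thesis
    proof cases
      case 1 then show ?thesis using assms by (intro bexI[of _ a] bexI[of _ b]) auto
    next
      case 2 then show ?thesis using assms by (intro bexI[of _ b] bexI[of _ a]) auto
    qed
  qed
qed

lemma conn_singleton: "conn E {v}"
  unfolding conn_def by blast

lemma conn_rel_mono: "conn E S \<Longrightarrow> (\<And>u v. E u v \<Longrightarrow> F u v) \<Longrightarrow> conn F S"
  unfolding conn_def by meson

lemma list_col_insert:
  assumes "list_col E (C - {x}) M c" "\<And>u v. E u v \<Longrightarrow> E v u" "\<And>v. \<not> E v v"
    and "\<And>v. v \<in> C - {x} \<Longrightarrow> M v \<subseteq> L v" "a \<in> L x" "\<And>w. w \<in> C - {x} \<Longrightarrow> E x w \<Longrightarrow> c w \<noteq> a"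
  shows "list_col E C L (c(x := a))"
  unfolding list_col_def proper_on_def
proof (intro conjI ballI impI)
  fix u v assume uv: "u \<in> C" "v \<in> C" "E u v"
  then have "u \<noteq> v" "E v u" using assms by blast+
  then show "(c(x := a)) u \<noteq> (c(x := a)) v"
    using uv assms(1) assms(6)[of u] assms(6)[of v] unfolding list_col_def proper_on_def by auto
next
  fix v assume v: "v \<in> C"
  have "c v \<in> L v" if "v \<noteq> x" using that v assms(1) assms(4)[of v] unfolding list_col_def by blast
  then show "(c(x := a)) v \<in> L v" using assms(5) by auto
qed

locale sgraph =
  fixes E :: "'a \<Rightarrow> 'a \<Rightarrow> bool"
  assumes sym: "E u v \<Longrightarrow> E v u" and irr: "\<not> E v v"
begin

lemma comp_extend:
  assumes "finite S" "R \<subseteq> S" "R \<noteq> {}" "conn E R"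
  obtains Q where "is_comp E S Q" "R \<subseteq> Q"
proof -
  let ?A = "{Q. R \<subseteq> Q \<and> Q \<subseteq> S \<and> conn E Q}"
  have "finite ?A" "R \<in> ?A" using assms by (auto intro: finite_subset[of _ "Pow S"])
  then obtain Q where Q: "Q \<in> ?A" and max: "\<And>Q'. Q' \<in> ?A \<Longrightarrow> Q \<subseteq> Q' \<Longrightarrow> Q = Q'"
    using finite_has_maximal[of ?A] by (metis (no_types, lifting) empty_iff)
  have "w \<in> Q" if "u \<in> Q" "w \<in> S" "E u w" for u w
  proof -
    have "conn E (insert w Q)" using that Q sym by (intro conn_insert[of E Q u w]) auto
    then have "insert w Q \<in> ?A" using Q that by auto
    then have "Q = insert w Q" using max by blast
    then show ?thesis by blast
  qed
  then have "is_comp E S Q" using Q assms unfolding is_comp_def by auto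
  then show thesis using that Q by blast
qed

lemma comp_of:
  assumes "finite S" "v \<in> S"
  obtains Q where "is_comp E S Q" "v \<in> Q"
proof -
  obtain Q where "is_comp E S Q" "{v} \<subseteq> Q"
    using comp_extend[OF assms(1), of "{v}"] assms(2) conn_singleton[of E v] by blast
  then show thesis using that by blast
qed

lemma conn_subset_comp:
  assumes "is_comp E S Q" "conn E R" "R \<subseteq> S" "R \<inter> Q \<noteq> {}"
  shows "R \<subseteq> Q"
proof (rule ccontr)
  assume "\<not> R \<subseteq> Q"
  then obtain v u where "v \<in> R \<inter> Q" "u \<in> R - R \<inter> Q" "E v u"
    using conn_boundary[OF assms(2), of "R \<inter> Q"] assms by blast
  then show False using assms unfolding is_comp_def by blast
qed

lemma comp_disjoint:
  assumes "is_comp E S Q" "is_comp E S R" "Q \<noteq> R"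
  shows "Q \<inter> R = {}"
  using conn_subset_comp[OF assms(1), of R] conn_subset_comp[OF assms(2), of Q] assms
  unfolding is_comp_def by blast

text \<open>By connectedness every nonempty part of \<open>T\<close> has an edge to the rest of
  \<open>K\<close>; its end inside the part has lost a neighbour there and so has a spare
  colour.\<close>

lemma list_col_proper_subset:
  assumes "finite K" "conn E K" "T \<subset> K" "\<And>v. v \<in> K \<Longrightarrow> card (nbs E K v) \<le> card (L v)"
  shows "\<exists>c. list_col E T L c"
proof (rule degenerate_list_col[OF _ sym irr])
  show "finite T" using assms finite_subset by blast
next
  fix S assume S: "S \<subseteq> T" "S \<noteq> {}"
  then obtain v u where vu: "v \<in> S" "u \<in> K - S" "E v u"
    using conn_boundary[OF assms(2), of S] assms by blast
  then have "card (nbs E S v) < card (nbs E K v)"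
    using assms S by (intro card_nbs_less) auto
  also have "\<dots> \<le> card (L v)" using vu S assms by blast
  finally show "\<exists>v\<in>S. card (nbs E S v) < card (L v)" using vu by blast
qed

text \<open>The argument for proper subsets, except that the part may also be all of
  \<open>K\<close>, where the spare colour at \<open>r\<close> helps.\<close>

lemma list_col_slack:
  assumes "finite K" "conn E K" "\<And>v. v \<in> K \<Longrightarrow> card (nbs E K v) \<le> card (L v)"
    and "r \<in> K" "card (nbs E K r) < card (L r)"
  shows "\<exists>c. list_col E K L c"
proof (rule degenerate_list_col[OF _ sym irr])
  show "finite K" by fact
next
  fix S assume S: "S \<subseteq> K" "S \<noteq> {}"
  show "\<exists>v\<in>S. card (nbs E S v) < card (L v)"
  proof (cases "S = K")
    case True then show ?thesis using assms by auto
  next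
    case False
    then obtain v u where vu: "v \<in> S" "u \<in> K - S" "E v u"
      using conn_boundary[OF assms(2), of S] S by blast
    then have "card (nbs E S v) < card (nbs E K v)"
      using assms S by (intro card_nbs_less) auto
    also have "\<dots> \<le> card (L v)" using vu S assms by blast
    finally show ?thesis using vu by blast
  qed
qed

section \<open>Cycles with lists of two colours\<close>

lemma even_sum_degrees: "finite T \<Longrightarrow> even (\<Sum>v\<in>T. card (nbs E T v))"
proof (induction T rule: finite_induct)
  case empty then show ?case by simp
next
  case (insert x T)
  have 1: "nbs E (insert x T) x = nbs E T x" using irr by (auto simp: nbs_def)
  have 2: "card (nbs E (insert x T) v) = card (nbs E T v) + (if E x v then 1 else 0)" if "v \<in> T" for v
  proof -
    have "nbs E (insert x T) v = (if E x v then insert x (nbs E T v) else nbs E T v)"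
      using sym by (auto simp: nbs_def)
    moreover have "x \<notin> nbs E T v" using insert by (auto simp: nbs_def)
    ultimately show ?thesis using insert by auto
  qed
  have "(\<Sum>v\<in>insert x T. card (nbs E (insert x T) v))
      = card (nbs E T x) + ((\<Sum>v\<in>T. card (nbs E T v)) + (\<Sum>v\<in>T. if E x v then 1 else 0))"
    using insert by (simp add: 1 2 sum.distrib)
  also have "(\<Sum>v\<in>T. if E x v then 1 else 0) = card (nbs E T x)"
    using insert by (simp add: nbs_def sum.If_cases Int_def)
  finally show ?case using insert by simp
qed

text \<open>Parity excludes that a part of a cycle hangs on the rest by a single edge.\<close>

lemma list_col_cycle:
  fixes L :: "'a \<Rightarrow> 'c set"
  assumes C: "ind_cyc E C" and L: "\<And>v. v \<in> C \<Longrightarrow> 2 \<le> card (L v)"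
    and "x \<in> C" "y \<in> C" "L x \<noteq> L y"
  shows "\<exists>c. list_col E C L c"
proof -
  have fin: "finite C" and con: "conn E C" and deg: "\<And>v. v \<in> C \<Longrightarrow> card (nbs E C v) = 2"
    using C by (auto simp: ind_cyc_def)
  let ?T = "{v \<in> C. L v = L x}"
  obtain p q where pq: "p \<in> ?T" "q \<in> C - ?T" "E p q"
    using conn_boundary[OF con, of ?T] assms by blast
  then have "L p \<noteq> L q" by auto
  then consider a where "a \<in> L p" "a \<notin> L q" | a where "a \<in> L q" "a \<notin> L p" by blast
  then obtain v u a where vu: "v \<in> C" "u \<in> C" "E v u" "a \<in> L v" "a \<notin> L u"
    using pq sym[OF pq(3)] by cases blast+
  \<comment> \<open>Colouring v with a costs its neighbour u nothing: u keeps two colours after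
    losing a neighbour, and from this slack the rest is coloured.\<close>
  define M where "M w = (if E v w then L w - {a} else L w)" for w
  have "v \<noteq> u" using vu irr by blast
  have finL: "finite (L w)" if "w \<in> C" for w using L[OF that] card.infinite by fastforce
  have M: "2 \<le> card (M w) + (if E v w then 1 else 0)" if "w \<in> C" for w
    using L[OF that] finL[OF that] unfolding M_def by (auto simp: card_Diff_singleton_if)
  have "\<exists>c. list_col E (C - {v}) M c"
  proof (rule degenerate_list_col[OF _ sym irr])
    show "finite (C - {v})" using fin by simp
  next
    fix T assume T: "T \<subseteq> C - {v}" "T \<noteq> {}"
    have finT: "finite T" using T fin finite_subset by blast
    show "\<exists>w\<in>T. card (nbs E T w) < card (M w)"
    proof (rule ccontr)
      assume "\<not> ?thesis"
      then have neg: "card (M w) \<le> card (nbs E T w)" if "w \<in> T" for w using that by force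
      have eq: "card (nbs E T w) + (if E v w then 1 else 0) \<le> 2" if w: "w \<in> T" for w
      proof (cases "E v w")
        case True
        then have "card (nbs E T w) < card (nbs E C w)"
          using T fin vu sym by (intro card_nbs_less[of _ _ v]) auto
        then show ?thesis using deg w T True by auto
      next
        case False
        have "card (nbs E T w) \<le> card (nbs E C w)" using T fin by (intro card_nbs_mono) auto
        also have "\<dots> = 2" using deg w T by blast
        finally show ?thesis using False by simp
      qed
      \<comment> \<open>In a part T without a spare colour all inner degrees are two, or one next to
        v. So T is joined to the rest of the cycle through v only (\<open>bd\<close>), and by a
        single edge (\<open>nv\<close>).\<close>
      have eq2: "card (nbs E T w) + (if E v w then 1 else 0) = 2" if w: "w \<in> T" for w
        using eq[OF w] neg[OF w] M[of w] T w by fastforce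
      have "u \<notin> T"
      proof
        assume u: "u \<in> T"
        have "card (M u) = card (L u)" using vu by (auto simp: M_def)
        then have "2 \<le> card (M u)" using L vu by auto
        then show False using neg[OF u] eq2[OF u] vu by auto
      qed
      have bd: "z = v" if "w \<in> T" "z \<in> C - T" "E w z" for w z
      proof (rule ccontr)
        assume "z \<noteq> v"
        show False
        proof (cases "E v w")
          case True
          have "insert v (insert z (nbs E T w)) \<subseteq> nbs E C w"
            using T vu that sym True by (auto simp: nbs_def)
          then have "card (insert v (insert z (nbs E T w))) \<le> 2"
            using deg[of w] that T card_mono[of "nbs E C w"] fin by fastforce
          moreover have "v \<notin> insert z (nbs E T w)" "z \<notin> nbs E T w"
            using T that \<open>z \<noteq> v\<close> by (auto simp: nbs_def)
          ultimately have "card (nbs E T w) = 0" using finT by simp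
          then show False using eq2[OF that(1)] True by simp
        next
          case False
          have "card (nbs E T w) < card (nbs E C w)"
            using T fin that by (intro card_nbs_less[of _ _ z]) auto
          then show False using eq2[OF that(1)] False deg that T by auto
        qed
      qed
      obtain t z where tz: "t \<in> T" "z \<in> C - T" "E t z"
        using conn_boundary[OF con, of T] T \<open>u \<notin> T\<close> vu by blast
      have Evt: "E v t" using bd[OF tz] tz sym by blast
      have nv: "nbs E T v = {t}"
      proof -
        have "{u, t} \<subseteq> nbs E C v" using vu Evt tz T by (auto simp: nbs_def)
        moreover have "u \<noteq> t" using tz \<open>u \<notin> T\<close> by auto
        ultimately have "{u, t} = nbs E C v"
          using deg[OF vu(1)] fin by (intro card_subset_eq) auto
        then show ?thesis using \<open>u \<notin> T\<close> tz Evt T by (auto simp: nbs_def)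
      qed
      have "(\<Sum>w\<in>T. card (nbs E T w)) + (\<Sum>w\<in>T. if E v w then 1 else 0) = (\<Sum>w\<in>T. 2)"
        unfolding sum.distrib[symmetric] using eq2 by (intro sum.cong) auto
      moreover have "(\<Sum>w\<in>T. if E v w then 1 else 0) = card (nbs E T v)"
        using finT by (simp add: nbs_def sum.If_cases Int_def)
      ultimately have "(\<Sum>w\<in>T. card (nbs E T w)) + 1 = 2 * card T" using nv by simp
      moreover have "even (\<Sum>w\<in>T. card (nbs E T w))" using even_sum_degrees[OF finT] .
      ultimately show False by (metis even_Suc dvd_triv_left Suc_eq_plus1)
    qed
  qed
  then obtain c where c: "list_col E (C - {v}) M c" by blast
  have "c w \<noteq> a" if w: "w \<in> C - {v}" "E v w" for w
  proof -
    have "c w \<in> M w" using c w by (simp add: list_col_def)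
    then show ?thesis using w by (simp add: M_def)
  qed
  then have "list_col E C L (c(v := a))"
    using vu sym irr by (intro list_col_insert[OF c]) (auto simp: M_def)
  then show ?thesis by blast
qed

text \<open>Unequal lists are covered by \<open>list_col_cycle\<close>. For equal lists two common
  colours suffice: colouring the path left by deleting x gives both neighbours of x the same colour,
  because the path has an odd number of vertices.\<close>

lemma list_col_even_cycle:
  fixes L :: "'a \<Rightarrow> 'c set"
  assumes C: "ind_cyc E C" and L: "\<And>v. v \<in> C \<Longrightarrow> 2 \<le> card (L v)"
    and ev: "even (card C)"
  shows "\<exists>c. list_col E C L c"
proof (cases "\<exists>x\<in>C. \<exists>y\<in>C. L x \<noteq> L y")
  case True
  then obtain x y where "x \<in> C" "y \<in> C" "L x \<noteq> L y" by blast
  then show ?thesis using L by (intro list_col_cycle[OF C])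
next
  case False
  have fin: "finite C" and con: "conn E C" and deg: "\<And>v. v \<in> C \<Longrightarrow> card (nbs E C v) = 2"
    using C by (auto simp: ind_cyc_def)
  obtain x where x: "x \<in> C" using C by (auto simp: ind_cyc_def)
  obtain a b where ab: "a \<in> L x" "b \<in> L x" "a \<noteq> b"
    using L[OF x] by (auto simp: card_le_Suc_iff numeral_2_eq_2)
  have "\<exists>c. list_col E (C - {x}) (\<lambda>_. {a, b}) c"
  proof (rule list_col_proper_subset[OF fin con])
    show "C - {x} \<subset> C" using x by blast
    show "card (nbs E C v) \<le> card {a, b}" if "v \<in> C" for v using deg[OF that] ab by simp
  qed
  then obtain c where c: "list_col E (C - {x}) (\<lambda>_. {a, b}) c" by blast
  obtain s t where st: "nbs E C x = {s, t}" "s \<noteq> t" using deg[OF x] by (meson card_2_iff)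
  have st': "s \<in> C - {x}" "t \<in> C - {x}" "E x s" "E x t"
    using st irr by (auto simp: nbs_def set_eq_iff)
  have cst: "c s = c t"
  proof (rule ccontr)
    assume ne: "c s \<noteq> c t"
    define A where "A = {v \<in> C - {x}. c v = a}"
    define B where "B = {v \<in> C - {x}. c v = b}"
    have AB: "C - {x} = A \<union> B" "A \<inter> B = {}" "finite A" "finite B"
      using c fin ab by (auto simp: A_def B_def list_col_def)
    have noA: "nbs E C v \<subseteq> insert x B" if v: "v \<in> A" for v
    proof
      fix w assume w: "w \<in> nbs E C v"
      show "w \<in> insert x B"
      proof (cases "w = x")
        case False
        then have "w \<in> C - {x}" "v \<in> C - {x}" "E v w"
          using w v by (auto simp: nbs_def A_def B_def)
        then have "c v \<noteq> c w" "c w \<in> {a, b}" using c unfolding list_col_def proper_on_def by blast+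
        then show ?thesis using v \<open>w \<in> C - {x}\<close> by (auto simp: A_def B_def)
      qed simp
    qed
    have noB: "nbs E C v \<subseteq> insert x A" if v: "v \<in> B" for v
    proof
      fix w assume w: "w \<in> nbs E C v"
      show "w \<in> insert x A"
      proof (cases "w = x")
        case False
        then have "w \<in> C - {x}" "v \<in> C - {x}" "E v w"
          using w v by (auto simp: nbs_def A_def B_def)
        then have "c v \<noteq> c w" "c w \<in> {a, b}" using c unfolding list_col_def proper_on_def by blast+
        then show ?thesis using v \<open>w \<in> C - {x}\<close> by (auto simp: A_def B_def)
      qed simp
    qed
    have split: "2 = card (nbs E D v) + (if E x v then 1 else 0)"
      if "v \<in> C" "nbs E C v \<subseteq> insert x D" "D \<subseteq> C - {x}" for v D
    proof -
      have "finite D" using that fin finite_subset by blast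
      have "nbs E C v = (if E x v then insert x (nbs E D v) else nbs E D v)"
        using that x sym unfolding nbs_def by auto
      moreover have "x \<notin> nbs E D v" using that by (auto simp: nbs_def)
      ultimately show ?thesis using deg[OF that(1)] \<open>finite D\<close> by (auto split: if_splits)
    qed
    have cnt: "2 * card D = (\<Sum>v\<in>D. card (nbs E D' v)) + card (D \<inter> {s, t})"
      if "D \<subseteq> C - {x}" "D' \<subseteq> C - {x}" "\<And>v. v \<in> D \<Longrightarrow> nbs E C v \<subseteq> insert x D'" for D D'
    proof -
      have "finite D" using that fin finite_subset by blast
      have "2 * card D = (\<Sum>v\<in>D. 2)" by simp
      also have "\<dots> = (\<Sum>v\<in>D. card (nbs E D' v) + (if E x v then 1 else 0))"
        using that by (intro sum.cong refl split) auto
      also have "\<dots> = (\<Sum>v\<in>D. card (nbs E D' v)) + card {v \<in> D. E x v}"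
        using \<open>finite D\<close> by (simp add: sum.distrib sum.If_cases Int_def)
      also have "{v \<in> D. E x v} = D \<inter> {s, t}"
        using st(1) that(1) by (auto simp: nbs_def set_eq_iff)
      finally show ?thesis .
    qed
    \<comment> \<open>The edges between the colour classes, counted from both sides. As each class
      contains one neighbour of x, the classes have equal size, against the parity of the
      cycle.\<close>
    have "(\<Sum>v\<in>A. card (nbs E B v)) = (\<Sum>v\<in>B. card (nbs E A v))"
    proof -
      have "(\<Sum>v\<in>A. card (nbs E B v)) = card (SIGMA v:A. nbs E B v)"
        using AB by simp
      also have "\<dots> = card (SIGMA v:B. nbs E A v)"
        by (rule bij_betw_same_card[of prod.swap]) (auto simp: bij_betw_def inj_on_def nbs_def image_iff sym)
      finally show ?thesis using AB by simp
    qed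
    moreover have "2 * card A = (\<Sum>v\<in>A. card (nbs E B v)) + card (A \<inter> {s, t})"
      using AB noA by (intro cnt) auto
    moreover have "2 * card B = (\<Sum>v\<in>B. card (nbs E A v)) + card (B \<inter> {s, t})"
      using AB noB by (intro cnt) auto
    moreover have "card (A \<inter> {s, t}) = 1 \<and> card (B \<inter> {s, t}) = 1"
    proof -
      have "(c s = a \<and> c t = b) \<or> (c s = b \<and> c t = a)"
      proof -
        have "c s \<in> {a, b}" "c t \<in> {a, b}" using c st' by (simp_all add: list_col_def)
        then show ?thesis using ne by auto
      qed
      then have "(A \<inter> {s, t} = {s} \<and> B \<inter> {s, t} = {t}) \<or> (A \<inter> {s, t} = {t} \<and> B \<inter> {s, t} = {s})"
        using st' ab by (auto simp: A_def B_def)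
      then show ?thesis by auto
    qed
    ultimately have "card A = card B" by linarith
    then have "card (C - {x}) = 2 * card A" using AB by (simp add: card_Un_disjoint)
    moreover have "card C = Suc (card (C - {x}))" using x fin by (metis card_Suc_Diff1)
    ultimately show False using ev by simp
  qed
  define d where "d = (if c s = a then b else a)"
  have "list_col E C L (c(x := d))"
  proof (rule list_col_insert[OF c sym irr])
    show "c w \<noteq> d" if "w \<in> C - {x}" "E x w" for w
    proof -
      have "w = s \<or> w = t" using that st(1) by (auto simp: nbs_def set_eq_iff)
      then show ?thesis using cst c st' ab by (auto simp: d_def list_col_def)
    qed
    show "{a, b} \<subseteq> L v" if "v \<in> C - {x}" for v using False x that ab by blast
    show "d \<in> L x" using ab by (auto simp: d_def)
  qed
  then show ?thesis by blast
qed

section \<open>Existence of induced cycles\<close>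

lemma min_degree_2_subset:
  assumes "finite S" "S \<noteq> {}" "\<And>v. v \<in> S \<Longrightarrow> v \<noteq> z \<Longrightarrow> 2 \<le> card (nbs E S v)"
    and "z \<in> S \<Longrightarrow> 1 \<le> card (nbs E S z)"
  shows "\<exists>T\<subseteq>S. T \<noteq> {} \<and> (\<forall>v\<in>T. 2 \<le> card (nbs E T v))"
  using assms
proof (induction "card S" arbitrary: S z rule: less_induct)
  case less
  show ?case
  proof (cases "z \<in> S \<and> card (nbs E S z) = 1")
    case False
    then have "\<forall>v\<in>S. 2 \<le> card (nbs E S v)"
      using less.prems by (metis One_nat_def Suc_1 le_antisym not_less_eq_eq)
    then show ?thesis using less.prems by blast
  next
    case True
    \<comment> \<open>The pendant vertex z is deleted; its neighbour y loses one edge and takes over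
      the role of the exception.\<close>
    then obtain y where y: "nbs E S z = {y}" using card_1_singletonE by blast
    have yS: "y \<in> S" "y \<noteq> z" "E z y" using y irr by (auto simp: nbs_def set_eq_iff)
    have same: "nbs E (S - {z}) v = nbs E S v" if "v \<in> S" "v \<noteq> y" "v \<noteq> z" for v
      using y that sym by (auto simp: nbs_def set_eq_iff)
    have "card (nbs E (S - {z}) y) = card (nbs E S y - {z})"
      by (rule arg_cong[of _ _ card]) (auto simp: nbs_def)
    moreover have "card (nbs E S y) - 1 \<le> card (nbs E S y - {z})"
      using diff_card_le_card_Diff[of "{z}" "nbs E S y"] by simp
    ultimately have y1: "1 \<le> card (nbs E (S - {z}) y)"
      using less.prems(3)[OF yS(1,2)] by linarith
    have "\<exists>T\<subseteq>S - {z}. T \<noteq> {} \<and> (\<forall>v\<in>T. 2 \<le> card (nbs E T v))"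
    proof (rule less.hyps[of _ y])
      show "card (S - {z}) < card S" using True less.prems by (meson card_Diff1_less)
      show "2 \<le> card (nbs E (S - {z}) v)" if "v \<in> S - {z}" "v \<noteq> y" for v
        using same[of v] less.prems(3)[of v] that by auto
    qed (use less.prems yS y1 in auto)
    then show ?thesis by blast
  qed
qed

lemma conn_remove_leaf:
  assumes "conn E T" "finite T" "t \<in> T" "card (nbs E T t) \<le> 1"
  shows "conn E (T - {t})"
  unfolding conn_def
proof (intro allI impI)
  fix S assume S: "S \<subseteq> T - {t}" "S \<noteq> {}" "S \<noteq> T - {t}"
  show "\<exists>v\<in>S. \<exists>u\<in>T - {t} - S. E v u"
  proof (rule ccontr)
    assume no: "\<not> ?thesis"
    obtain v u where vu: "v \<in> S" "u \<in> T - S" "E v u"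
      using conn_boundary[OF assms(1), of S] S assms(3) by blast
    then have "u = t" using no by blast
    obtain v' u' where vu': "v' \<in> T - {t} - S" "u' \<in> T - (T - {t} - S)" "E v' u'"
      using conn_boundary[OF assms(1), of "T - {t} - S"] S assms(3) by blast
    then have "u' = t" using no sym by blast
    have "card {v, v'} \<le> card (nbs E T t)"
    proof (rule card_mono)
      show "{v, v'} \<subseteq> nbs E T t"
        using vu vu' S \<open>u = t\<close> \<open>u' = t\<close> sym by (auto simp: nbs_def)
      show "finite (nbs E T t)" using assms(2) by simp
    qed
    moreover have "v \<noteq> v'" using vu vu' by blast
    ultimately show False using assms(4) by simp
  qed
qed

text \<open>A minimal nonempty vertex set inducing minimum degree 2 is an induced cycle.\<close>

lemma exists_ind_cyc:
  assumes "finite S" "S \<noteq> {}" "\<And>v. v \<in> S \<Longrightarrow> v \<noteq> z \<Longrightarrow> 2 \<le> card (nbs E S v)"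
    and "z \<in> S \<Longrightarrow> 1 \<le> card (nbs E S z)"
  shows "\<exists>C\<subseteq>S. ind_cyc E C"
proof -
  let ?P = "\<lambda>T. T \<subseteq> S \<and> T \<noteq> {} \<and> (\<forall>v\<in>T. 2 \<le> card (nbs E T v))"
  obtain C where C: "?P C" and min: "\<And>T. ?P T \<Longrightarrow> card C \<le> card T"
    using min_degree_2_subset[OF assms] arg_min_nat_lemma[of ?P _ card] by (metis (no_types, lifting))
  have fin: "finite C" using C assms finite_subset by blast
  have noP: "\<not> ?P T" if "T \<subset> C" for T
    using min[of T] psubset_card_mono[OF fin that] by linarith
  have con: "conn E C"
    unfolding conn_def
  proof (intro allI impI, rule ccontr)
    fix T assume T: "T \<subseteq> C" "T \<noteq> {}" "T \<noteq> C" "\<not> (\<exists>v\<in>T. \<exists>u\<in>C - T. E v u)"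
    have "nbs E T v = nbs E C v" if "v \<in> T" for v using T that by (auto simp: nbs_def)
    then have "\<forall>v\<in>T. 2 \<le> card (nbs E T v)" using C T by (metis subsetD)
    then have "?P T" using C T by blast
    then show False using noP[of T] T by blast
  qed
  have "card (nbs E C v) = 2" if v: "v \<in> C" for v
  proof (rule ccontr)
    assume "card (nbs E C v) \<noteq> 2"
    then have deg3: "3 \<le> card (nbs E C v)" using C v by force
    \<comment> \<open>Some component of C - v sees v twice: one that sees it once has at most one
      vertex of inner degree below two, and would contain a smaller set of minimum degree
      two.\<close>
    have "\<exists>Q. is_comp E (C - {v}) Q \<and> 2 \<le> card (nbs E Q v)"
    proof (rule ccontr)
      assume no: "\<not> ?thesis"
      obtain q0 where q0: "q0 \<in> nbs E C v" using deg3 by fastforce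
      then have "q0 \<in> C - {v}" using irr by (auto simp: nbs_def)
      then obtain Q where Q: "is_comp E (C - {v}) Q" "q0 \<in> Q"
        using comp_of[of "C - {v}" q0] fin by blast
      have QC: "Q \<subseteq> C - {v}" "finite Q" using Q fin finite_subset unfolding is_comp_def by blast+
      have "q0 \<in> nbs E Q v" using q0 Q by (auto simp: nbs_def)
      moreover have "card (nbs E Q v) \<le> 1" using no Q by force
      ultimately have nQ: "nbs E Q v = {q0}"
        using QC(2) by (intro card_seteq[symmetric]) auto
      have in_Q: "nbs E C w \<subseteq> insert v (nbs E Q w)" if "w \<in> Q" for w
        using Q that unfolding is_comp_def nbs_def by auto
      have "\<exists>T\<subseteq>Q. T \<noteq> {} \<and> (\<forall>v\<in>T. 2 \<le> card (nbs E T v))"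
      proof (rule min_degree_2_subset[where z = q0])
        show "2 \<le> card (nbs E Q w)" if w: "w \<in> Q" "w \<noteq> q0" for w
        proof -
          have "\<not> E w v" using nQ w sym by (auto simp: nbs_def set_eq_iff)
          then have "nbs E C w \<subseteq> nbs E Q w" using in_Q[OF w(1)] by (auto simp: nbs_def)
          then have "card (nbs E C w) \<le> card (nbs E Q w)" using QC by (intro card_mono) auto
          then show ?thesis using C w QC by fastforce
        qed
        have "card (nbs E C q0) \<le> card (insert v (nbs E Q q0))"
          using in_Q[OF Q(2)] QC by (intro card_mono) auto
        also have "\<dots> \<le> Suc (card (nbs E Q q0))" by (rule card_insert_le_m1) auto
        finally show "1 \<le> card (nbs E Q q0)" using C q0 by (force simp: nbs_def)
      qed (use Q QC in auto)
      then obtain T where "T \<subseteq> Q" "T \<noteq> {}" "\<forall>v\<in>T. 2 \<le> card (nbs E T v)" by blast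
      then show False using noP[of T] QC C v by blast
    qed
    then obtain Q where Q: "is_comp E (C - {v}) Q" "2 \<le> card (nbs E Q v)" by blast
    \<comment> \<open>T will be a smallest connected set off v with two neighbours of v. It has a
      leaf, as C is minimal; every leaf is adjacent to v, and v has exactly two neighbours in T,
      since otherwise the leaf could be dropped. So T + v has minimum degree two but misses a third
      neighbour of v in C.\<close>
    let ?R = "\<lambda>T. T \<subseteq> C - {v} \<and> conn E T \<and> 2 \<le> card (nbs E T v)"
    have "?R Q" using Q unfolding is_comp_def by blast
    then obtain T where T: "?R T" and minT: "\<And>T'. ?R T' \<Longrightarrow> card T \<le> card T'"
      using arg_min_nat_lemma[of ?R Q card] by blast
    have finT: "finite T" using T fin finite_subset by blast
    have leaf: "E v t \<and> card (nbs E T v) = 2" if t: "t \<in> T" "card (nbs E T t) \<le> 1" for t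
    proof (rule ccontr)
      assume no: "\<not> ?thesis"
      have "2 \<le> card (nbs E (T - {t}) v)"
      proof (cases "E v t")
        case True
        then have "3 \<le> card (nbs E T v)" using no T by force
        moreover have "nbs E (T - {t}) v = nbs E T v - {t}" by (auto simp: nbs_def)
        moreover have "card (nbs E T v) - 1 \<le> card (nbs E T v - {t})"
          using diff_card_le_card_Diff[of "{t}" "nbs E T v"] by simp
        ultimately show ?thesis by simp
      next
        case False
        then have "nbs E (T - {t}) v = nbs E T v" by (auto simp: nbs_def)
        then show ?thesis using T by simp
      qed
      then have "?R (T - {t})" using T conn_remove_leaf[OF _ finT t] by blast
      then have "card T \<le> card (T - {t})" using minT by blast
      then show False using t finT by (metis card_Diff1_less not_less)
    qed
    have big: "2 \<le> card T"
      using T finT card_mono[OF finT nbs_subset[of E T v]] by linarith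
    have pos: "1 \<le> card (nbs E T t)" if t: "t \<in> T" for t
    proof -
      have "T \<noteq> {t}" using big by auto
      moreover have "conn E T" using T by blast
      ultimately obtain u where "u \<in> T - {t}" "E t u"
        using t by (elim conn_boundary[of E T "{t}"]) auto
      then have "nbs E T t \<noteq> {}" by (auto simp: nbs_def)
      then show ?thesis using finT by (simp add: Suc_le_eq card_gt_0_iff)
    qed
    have ext: "card (nbs E (insert v T) t) = card (nbs E T t) + (if E v t then 1 else 0)" if "t \<in> T" for t
    proof -
      have "nbs E (insert v T) t = (if E v t then insert v (nbs E T t) else nbs E T t)"
        using sym by (auto simp: nbs_def)
      moreover have "v \<notin> nbs E T t" using T by (auto simp: nbs_def)
      ultimately show ?thesis using finT by auto
    qed
    have "\<exists>t\<in>T. card (nbs E T t) \<le> 1"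
    proof (rule ccontr)
      assume "\<not> ?thesis"
      then have "?P T" using T C big by fastforce
      then show False using noP[of T] T v by blast
    qed
    then have two: "card (nbs E T v) = 2" using leaf by blast
    have vv: "nbs E (insert v T) v = nbs E T v" using irr by (auto simp: nbs_def)
    have "2 \<le> card (nbs E (insert v T) t)" if "t \<in> insert v T" for t
    proof (cases "t = v")
      case True then show ?thesis using vv two by simp
    next
      case False
      then have t: "t \<in> T" using that by blast
      show ?thesis using ext[OF t] pos[OF t] leaf[OF t] by (cases "card (nbs E T t) \<le> 1") auto
    qed
    then have "?P (insert v T)" using T C v by blast
    moreover have "insert v T \<subset> C"
    proof -
      have "insert v T \<noteq> C" using vv two deg3 by auto
      then show ?thesis using T v by blast
    qed
    ultimately show False using noP by blast
  qed
  then show ?thesis using C fin con unfolding ind_cyc_def by blast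
qed

end

section \<open>Hall's theorem\<close>

lemma hall:
  fixes A :: "'i \<Rightarrow> 'b set"
  assumes "finite J" "\<And>j. j \<in> J \<Longrightarrow> finite (A j)"
    and "\<And>J'. J' \<subseteq> J \<Longrightarrow> card J' \<le> card (\<Union>(A ` J'))"
  shows "\<exists>f. inj_on f J \<and> (\<forall>j\<in>J. f j \<in> A j)"
  using assms
proof (induction "card J" arbitrary: J A rule: less_induct)
  case less
  note finJ = less.prems(1) and finA = less.prems(2) and cond = less.prems(3)
  have finU: "finite (\<Union>(A ` I))" if "I \<subseteq> J" for I
    using that finJ finA finite_subset by blast
  show ?case
  proof (cases "\<exists>I. I \<subset> J \<and> I \<noteq> {} \<and> card (\<Union>(A ` I)) = card I")
    \<comment> \<open>A tight subfamily I is matched by itself; the others keep Hall's condition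
      after losing the elements of \<open>?U\<close>.\<close>
    case True
    then obtain I where I: "I \<subset> J" "I \<noteq> {}" "card (\<Union>(A ` I)) = card I" by blast
    let ?U = "\<Union>(A ` I)" and ?B = "\<lambda>j. A j - \<Union>(A ` I)"
    have finI: "finite I" using I finJ finite_subset by blast
    obtain f where f: "inj_on f I" "\<And>j. j \<in> I \<Longrightarrow> f j \<in> A j"
      using less.hyps[of I A] psubset_card_mono[OF finJ I(1)] finI I finA cond
      by (metis (no_types, lifting) order_trans psubset_imp_subset subsetD)
    have "\<exists>g. inj_on g (J - I) \<and> (\<forall>j\<in>J - I. g j \<in> ?B j)"
    proof (rule less.hyps)
      show "card (J - I) < card J"
        using I finJ by (intro psubset_card_mono) auto
      show "finite (J - I)" using finJ by simp
      show "finite (?B j)" if "j \<in> J - I" for j using that finA by auto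
      fix K assume K: "K \<subseteq> J - I"
      have "card K + card I = card (K \<union> I)"
        using K finI finJ by (subst card_Un_disjoint) (auto intro: finite_subset)
      also have "\<dots> \<le> card (\<Union>(A ` (K \<union> I)))" using K I by (intro cond) auto
      also have "\<Union>(A ` (K \<union> I)) = \<Union>(?B ` K) \<union> ?U" by auto
      also have "card \<dots> \<le> card (\<Union>(?B ` K)) + card ?U" by (rule card_Un_le)
      finally show "card K \<le> card (\<Union>(?B ` K))" using I by simp
    qed
    then obtain g where g: "inj_on g (J - I)" "\<And>j. j \<in> J - I \<Longrightarrow> g j \<in> ?B j" by blast
    let ?h = "\<lambda>j. if j \<in> I then f j else g j"
    have "f i \<noteq> g j" if "i \<in> I" "j \<in> J - I" for i j using f(2)[OF that(1)] g(2)[OF that(2)] that by auto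
    then have "inj_on ?h J"
      using f(1) g(1) unfolding inj_on_def by (metis DiffI)
    moreover have "?h j \<in> A j" if "j \<in> J" for j using f(2) g(2)[of j] that by auto
    ultimately show ?thesis by blast
  next
    \<comment> \<open>Without a tight subfamily every nonempty proper subfamily has an element to
      spare, so that any a in A i may be given to i.\<close>
    case False
    show ?thesis
    proof (cases "J = {}")
      case True then show ?thesis by auto
    next
      case False2: False
      then obtain i where i: "i \<in> J" by blast
      have "card {i} \<le> card (\<Union>(A ` {i}))" using i by (intro cond) auto
      then have "A i \<noteq> {}" by auto
      then obtain a where a: "a \<in> A i" by blast
      let ?B = "\<lambda>j. A j - {a}"
      have "\<exists>g. inj_on g (J - {i}) \<and> (\<forall>j\<in>J - {i}. g j \<in> ?B j)"
      proof (rule less.hyps)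
        show "card (J - {i}) < card J" using i finJ by (intro psubset_card_mono) auto
        show "finite (J - {i})" using finJ by simp
        show "finite (?B j)" if "j \<in> J - {i}" for j using that finA by auto
        fix K assume K: "K \<subseteq> J - {i}"
        show "card K \<le> card (\<Union>(?B ` K))"
        proof (cases "K = {}")
          case True then show ?thesis by simp
        next
          case ne: False
          have "card K \<le> card (\<Union>(A ` K))" using K by (intro cond) auto
          moreover have "card K \<noteq> card (\<Union>(A ` K))"
          proof -
            have "K \<subset> J" using K i by blast
            then show ?thesis using False ne by metis
          qed
          moreover have "\<Union>(?B ` K) = \<Union>(A ` K) - {a}" by auto
          moreover have "card (\<Union>(A ` K)) - 1 \<le> card (\<Union>(A ` K) - {a})"
            using diff_card_le_card_Diff[of "{a}" "\<Union>(A ` K)"] by simp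
          ultimately show ?thesis by simp
        qed
      qed
      then obtain g where g: "inj_on g (J - {i})" "\<And>j. j \<in> J - {i} \<Longrightarrow> g j \<in> ?B j" by blast
      have "inj_on (g(i := a)) J"
        using g(1) g(2) unfolding inj_on_def by (simp, blast)
      moreover have "(g(i := a)) j \<in> A j" if "j \<in> J" for j using g(2)[of j] a that by auto
      ultimately show ?thesis by blast
    qed
  qed
qed

text \<open>Hall's theorem for two copies of each element.\<close>

lemma hall_capacity_two:
  fixes A :: "'i \<Rightarrow> 'b set"
  assumes "finite J" "\<And>j. j \<in> J \<Longrightarrow> finite (A j)"
    and "\<And>J'. J' \<subseteq> J \<Longrightarrow> card J' \<le> 2 * card (\<Union>(A ` J'))"
  shows "\<exists>f. (\<forall>j\<in>J. f j \<in> A j) \<and> (\<forall>y. card {j \<in> J. f j = y} \<le> 2)"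
proof -
  have "\<exists>f. inj_on f J \<and> (\<forall>j\<in>J. f j \<in> A j \<times> {0::nat, 1})"
  proof (rule hall)
    fix J' assume J': "J' \<subseteq> J"
    have "(\<Union>j\<in>J'. A j \<times> {0::nat, 1}) = \<Union>(A ` J') \<times> {0, 1}" by auto
    then have "card (\<Union>j\<in>J'. A j \<times> {0::nat, 1}) = card (\<Union>(A ` J')) * 2"
      by (simp add: card_cartesian_product)
    then show "card J' \<le> card (\<Union>j\<in>J'. A j \<times> {0::nat, 1})" using assms(3)[OF J'] by simp
  qed (use assms in auto)
  then obtain f where f: "inj_on f J" "\<And>j. j \<in> J \<Longrightarrow> f j \<in> A j \<times> {0::nat, 1}" by blast
  have "card {j \<in> J. fst (f j) = y} \<le> 2" for y
  proof -
    have "card {j \<in> J. fst (f j) = y} \<le> card ({y} \<times> {0::nat, 1})"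
    proof (rule card_inj_on_le[of f])
      show "inj_on f {j \<in> J. fst (f j) = y}" using f(1) by (auto simp: inj_on_def)
      show "f ` {j \<in> J. fst (f j) = y} \<subseteq> {y} \<times> {0::nat, 1}" using f(2) by fastforce
    qed auto
    then show ?thesis by simp
  qed
  moreover have "fst (f j) \<in> A j" if "j \<in> J" for j
    using f(2)[OF that] by (metis mem_Times_iff)
  ultimately have "(\<forall>j\<in>J. fst (f j) \<in> A j) \<and> (\<forall>y. card {j \<in> J. fst (f j) = y} \<le> 2)"
    by simp
  then show ?thesis by (rule exI[of _ "\<lambda>j. fst (f j)"])
qed

section \<open>Graphs with an independent set of high degree vertices\<close>

text \<open>\<open>Y\<close> stands for the contracted vertices of degree up to six, and
  \<open>w0\<close> is the only low vertex that may see two of them. Four mutually adjacent low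
  vertices are excluded, as no colouring of \<open>Y\<close> could make them 3-colourable.\<close>

locale high_low = sgraph E for E :: "'a \<Rightarrow> 'a \<Rightarrow> bool" +
  fixes V Y :: "'a set" and w0 :: 'a
  assumes finV: "finite V" and YV: "Y \<subseteq> V"
    and low_deg: "v \<in> V - Y \<Longrightarrow> card (nbs E V v) \<le> 3"
    and high_deg: "y \<in> Y \<Longrightarrow> card (nbs E V y) \<le> 6"
    and indep: "y \<in> Y \<Longrightarrow> z \<in> Y \<Longrightarrow> \<not> E y z"
    and single: "v \<in> V - Y \<Longrightarrow> v \<noteq> w0 \<Longrightarrow> card (nbs E Y v) \<le> 1"
    and double: "card (nbs E Y w0) \<le> 2"
    and no_K4: "S \<subseteq> V - Y \<Longrightarrow> card S = 4 \<Longrightarrow> \<exists>u\<in>S. \<exists>v\<in>S. u \<noteq> v \<and> \<not> E u v"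
begin

definition lst :: "('a \<Rightarrow> nat) \<Rightarrow> 'a \<Rightarrow> nat set" where
  "lst p v = {..<3} - p ` nbs E Y v"

definition bad :: "'a set \<Rightarrow> bool" where
  "bad K \<longleftrightarrow> is_comp E (V - Y) K \<and>
     (\<exists>p. (\<forall>y\<in>Y. p y < 3) \<and> \<not> (\<exists>c. list_col E K (lst p) c))"

text \<open>The shape of an end block of a component that resists colouring: at most one vertex, the
  cut vertex, has no neighbour in \<open>Y\<close>. The other vertices are called slots and their
  neighbours in \<open>Y\<close> owners.\<close>

definition leaf_cyc :: "'a set \<Rightarrow> bool" where
  "leaf_cyc C \<longleftrightarrow> ind_cyc E C \<and> odd (card C) \<and> card {v \<in> C. nbs E Y v = {}} \<le> 1"

lemma finY: "finite Y" using finV YV finite_subset by blast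

lemma comp_facts:
  assumes "is_comp E (V - Y) K"
  shows "finite K" "conn E K" "K \<subseteq> V - Y" "K \<noteq> {}"
    and "\<And>v. v \<in> K \<Longrightarrow> card (nbs E K v) + card (nbs E Y v) \<le> 3"
    and "\<And>v p. v \<in> K \<Longrightarrow> card (nbs E K v) \<le> card (lst p v)"
proof -
  show K: "finite K" "conn E K" "K \<subseteq> V - Y" "K \<noteq> {}"
    using assms finV finite_subset[of K V] unfolding is_comp_def by blast+
  show *: "card (nbs E K v) + card (nbs E Y v) \<le> 3" if v: "v \<in> K" for v
  proof -
    have "card (nbs E K v) + card (nbs E Y v) = card (nbs E K v \<union> nbs E Y v)"
      using K finY by (subst card_Un_disjoint) (auto simp: nbs_def)
    also have "\<dots> \<le> card (nbs E V v)"
      using K YV finV by (intro card_mono) (auto simp: nbs_def)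
    also have "\<dots> \<le> 3" using v K low_deg by blast
    finally show ?thesis .
  qed
  show "card (nbs E K v) \<le> card (lst p v)" if v: "v \<in> K" for v p
  proof -
    have "card (p ` nbs E Y v) \<le> card (nbs E Y v)" using finY by (intro card_image_le) auto
    moreover have "card {..<3::nat} - card (p ` nbs E Y v) \<le> card (lst p v)"
      unfolding lst_def using finY by (intro diff_card_le_card_Diff) auto
    ultimately show ?thesis using *[OF v] by simp
  qed
qed

definition rest :: "'a set \<Rightarrow> ('a \<Rightarrow> nat) \<Rightarrow> 'a set \<Rightarrow> ('a \<Rightarrow> nat) \<Rightarrow> 'a \<Rightarrow> nat set" where
  "rest K p C c v = lst p v - c ` nbs E (K - C) v"

text \<open>The list of v is at least as long as its degree in \<open>K\<close>; each neighbour off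
  the cycle costs at most one colour, and two neighbours lie on the cycle.\<close>

lemma card_rest:
  assumes K: "is_comp E (V - Y) K" and C: "ind_cyc E C" "C \<subseteq> K" and v: "v \<in> C"
  shows "2 \<le> card (rest K p C c v)"
proof -
  have fin: "finite K" using comp_facts[OF K] by blast
  have "card (nbs E K v) = 2 + card (nbs E (K - C) v)"
    using card_nbs_split[OF fin C(2), of E v] C(1) v by (simp add: ind_cyc_def)
  moreover have "card (c ` nbs E (K - C) v) \<le> card (nbs E (K - C) v)"
    using fin by (intro card_image_le) auto
  moreover have "card (lst p v) - card (c ` nbs E (K - C) v) \<le> card (rest K p C c v)"
    unfolding rest_def using fin by (intro diff_card_le_card_Diff) auto
  ultimately show ?thesis using comp_facts(6)[OF K, of v p] v C by auto
qed

lemma list_col_combine: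
  assumes "list_col E (K - C) (lst p) c" "list_col E C (rest K p C c) d" "C \<subseteq> K"
  shows "list_col E K (lst p) (\<lambda>v. if v \<in> C then d v else c v)"
  unfolding list_col_def proper_on_def
proof (intro conjI ballI impI)
  fix u v assume uv: "u \<in> K" "v \<in> K" "E u v"
  have cross: "d x \<noteq> c y" if "x \<in> C" "y \<in> K - C" "E x y" for x y
    using assms(2) that unfolding list_col_def rest_def nbs_def by blast
  show "(if u \<in> C then d u else c u) \<noteq> (if v \<in> C then d v else c v)"
  proof (cases "u \<in> C"; cases "v \<in> C")
    assume "u \<in> C" "v \<in> C"
    then show ?thesis using assms(2) uv unfolding list_col_def proper_on_def by simp
  next
    assume "u \<in> C" "v \<notin> C"
    then show ?thesis using cross[of u v] uv by simp
  next
    assume "u \<notin> C" "v \<in> C"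
    then show ?thesis using cross[of v u] uv sym by fastforce
  next
    assume "u \<notin> C" "v \<notin> C"
    then show ?thesis using assms(1) uv unfolding list_col_def proper_on_def by simp
  qed
next
  fix v assume "v \<in> K"
  then show "(if v \<in> C then d v else c v) \<in> lst p v"
    using assms unfolding list_col_def rest_def by auto
qed

lemma list_col_from_unequal:
  assumes K: "is_comp E (V - Y) K" and C: "ind_cyc E C" "C \<subseteq> K"
    and c: "list_col E (K - C) (lst p) c"
    and uv: "u \<in> C" "v \<in> C" "rest K p C c u \<noteq> rest K p C c v"
  shows "\<exists>c. list_col E K (lst p) c"
proof -
  obtain d where "list_col E C (rest K p C c) d"
    using list_col_cycle[OF C(1) card_rest[OF K C] uv] by blast
  then show ?thesis using list_col_combine[OF c _ C(2)] by blast
qed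

end

section \<open>Components to which some colouring of the high vertices does not extend\<close>

locale bad_comp = high_low +
  fixes K :: "'a set" and p :: "'a \<Rightarrow> nat"
  assumes compK: "is_comp E (V - Y) K" and no_col: "\<not> (\<exists>c. list_col E K (lst p) c)"
    and p3: "y \<in> Y \<Longrightarrow> p y < 3"
begin

lemmas K_facts = comp_facts[OF compK]

text \<open>A spare colour anywhere would colour the connected set \<open>K\<close>, so each list is
  as short as the degree allows, and all degrees are full.\<close>

lemma deg_sum:
  assumes "v \<in> K" shows "card (nbs E K v) + card (nbs E Y v) = 3"
proof -
  have "card (lst p v) \<le> card (nbs E K v)"
    using list_col_slack[OF K_facts(1,2) K_facts(6)[of _ p] assms] no_col by force
  moreover have "3 \<le> card (nbs E Y v) + card (lst p v)"
  proof -
    have "card (p ` nbs E Y v) \<le> card (nbs E Y v)" using finY by (intro card_image_le) auto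
    moreover have "card {..<3::nat} - card (p ` nbs E Y v) \<le> card (lst p v)"
      unfolding lst_def using finY by (intro diff_card_le_card_Diff) auto
    ultimately show ?thesis by simp
  qed
  ultimately show ?thesis using K_facts(5)[OF assms] by linarith
qed

lemma subset_col: "T \<subset> K \<Longrightarrow> \<exists>c. list_col E T (lst p) c"
  by (rule list_col_proper_subset[OF K_facts(1,2) _ K_facts(6)])

lemma rest_eq:
  assumes "ind_cyc E C" "C \<subseteq> K" "list_col E (K - C) (lst p) c" "u \<in> C" "v \<in> C"
  shows "rest K p C c u = rest K p C c v"
  using list_col_from_unequal[OF compK assms] no_col by blast

lemma diff_cyc_subset: "ind_cyc E C \<Longrightarrow> C \<subseteq> K \<Longrightarrow> K - C \<subset> K"
  by (auto simp: ind_cyc_def)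

lemma odd_cyc:
  assumes C: "ind_cyc E C" "C \<subseteq> K"
  shows "odd (card C)"
proof
  assume ev: "even (card C)"
  obtain c where c: "list_col E (K - C) (lst p) c" using subset_col diff_cyc_subset[OF C] by blast
  have "\<exists>d. list_col E C (rest K p C c) d"
    by (rule list_col_even_cycle[OF C(1) _ ev]) (rule card_rest[OF compK C])
  then obtain d where "list_col E C (rest K p C c) d" by blast
  then show False using list_col_combine[OF c _ C(2)] no_col by blast
qed

text \<open>The degree is exactly three, and two neighbours lie on the cycle; the list left at v
  depends on the third neighbour alone.\<close>

lemma outer_nb:
  assumes C: "ind_cyc E C" "C \<subseteq> K" and v: "v \<in> C"
  obtains y where "nbs E Y v = {y}" "nbs E (K - C) v = {}"
    | q where "nbs E Y v = {}" "nbs E (K - C) v = {q}" "q \<in> K - C" "E v q"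
proof -
  have "card (nbs E (K - C) v) + card (nbs E Y v) = 1"
    using card_nbs_split[OF K_facts(1) C(2), of E v] C v deg_sum[of v] by (auto simp: ind_cyc_def)
  then consider "card (nbs E (K - C) v) = 0" "card (nbs E Y v) = 1"
    | "card (nbs E (K - C) v) = 1" "card (nbs E Y v) = 0" by linarith
  then show thesis
  proof cases
    case 1
    then show ?thesis using that(1) K_facts(1) by (metis card_1_singletonE card_0_eq finite_Diff finite_nbs)
  next
    case 2
    obtain q where q: "nbs E (K - C) v = {q}" using 2 card_1_singletonE by blast
    then have "q \<in> K - C" "E v q" by (auto simp: nbs_def set_eq_iff)
    then show ?thesis using that(2)[OF _ q] 2 finY by simp
  qed
qed

lemma rest_slot:
  assumes "nbs E Y v = {y}" "nbs E (K - C) v = {}"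
  shows "rest K p C c v = {..<3} - {p y}"
  using assms by (simp add: rest_def lst_def)

lemma rest_attached:
  assumes "nbs E Y v = {}" "nbs E (K - C) v = {q}"
  shows "rest K p C c v = {..<3} - {c q}"
  using assms by (simp add: rest_def lst_def)

lemma lst_lt3: "c \<in> lst p v \<Longrightarrow> c < 3"
  by (simp add: lst_def)

lemma comp_nbs:
  assumes Q: "is_comp E (K - C) Q" and C: "C \<subseteq> K" and v: "v \<in> Q"
  shows "card (nbs E K v) = card (nbs E Q v) + card (nbs E C v)"
proof -
  have "nbs E K v = nbs E Q v \<union> nbs E C v"
    using Q C v unfolding is_comp_def nbs_def by auto
  moreover have "nbs E Q v \<inter> nbs E C v = {}" using Q unfolding is_comp_def nbs_def by auto
  moreover have "finite Q" "finite C"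
    using K_facts(1) Q C finite_subset unfolding is_comp_def by blast+
  ultimately show ?thesis by (simp add: card_Un_disjoint)
qed

text \<open>If a component of the rest met the cycle in two edges, its colouring could be changed at one
  attachment so that the lists left on the cycle differ.\<close>

lemma single_attachment:
  assumes C: "ind_cyc E C" "C \<subseteq> K" and Q: "is_comp E (K - C) Q"
    and e: "v1 \<in> C" "v2 \<in> C" "q1 \<in> Q" "q2 \<in> Q" "E v1 q1" "E v2 q2"
  shows "v1 = v2"
proof (rule ccontr)
  assume ne: "v1 \<noteq> v2"
  have finC: "finite C" using C by (auto simp: ind_cyc_def)
  have QK: "Q \<subseteq> K - C" "conn E Q" "finite Q" using Q K_facts(1) finite_subset unfolding is_comp_def by blast+
  obtain c0 where c0: "list_col E (K - C) (lst p) c0" using subset_col diff_cyc_subset[OF C] by blast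
  have glue: "list_col E (K - C) (lst p) (\<lambda>v. if v \<in> Q then d v else c0 v)"
    if d: "list_col E Q (lst p) d" for d
    unfolding list_col_def proper_on_def
  proof (intro conjI ballI impI)
    fix u v assume uv: "u \<in> K - C" "v \<in> K - C" "E u v"
    then have "u \<in> Q \<longleftrightarrow> v \<in> Q" using Q sym unfolding is_comp_def by blast
    then show "(if u \<in> Q then d u else c0 u) \<noteq> (if v \<in> Q then d v else c0 v)"
      using c0 d uv unfolding list_col_def proper_on_def by simp
  next
    fix v assume "v \<in> K - C"
    then show "(if v \<in> Q then d v else c0 v) \<in> lst p v"
      using c0 d unfolding list_col_def by auto
  qed
  have att: "nbs E Y v = {} \<and> nbs E (K - C) v = {q}" if "v \<in> C" "q \<in> Q" "E v q" for v q
  proof -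
    have q: "q \<in> nbs E (K - C) v" using that QK by (auto simp: nbs_def)
    show ?thesis by (rule outer_nb[OF C that(1)]) (use q in auto)
  qed
  have CQ: "1 \<le> card (nbs E C q)" if "v \<in> C" "E v q" for v q
  proof -
    have "v \<in> nbs E C q" using that sym by (auto simp: nbs_def)
    then show ?thesis using finC by (metis One_nat_def Suc_leI card_gt_0_iff empty_iff finite_nbs)
  qed
  have degQ: "card (nbs E Q v) + card (nbs E C v) \<le> card (lst p v)" if "v \<in> Q" for v
    using comp_nbs[OF Q C(2) that] K_facts(6)[of v p] that QK by auto
  show False
  proof (cases "\<exists>v3\<in>C. nbs E Q v3 = {}")
    case True
    then obtain v3 where v3: "v3 \<in> C" "nbs E Q v3 = {}" by blast
    \<comment> \<open>Recolouring Q does not change the list left at v3, which is all colours but a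
      fixed b. So it suffices to give q1 a colour other than b: then the list left at v1 is a
      different one.\<close>
    obtain b where b: "\<And>d. rest K p C (\<lambda>v. if v \<in> Q then d v else c0 v) v3 = {..<3} - {b}" "b < 3"
    proof (rule outer_nb[OF C v3(1)])
      fix y assume y: "nbs E Y v3 = {y}" "nbs E (K - C) v3 = {}"
      then have "y \<in> Y" by (auto simp: nbs_def)
      then show thesis using that[of "p y"] rest_slot[OF y] p3 by blast
    next
      fix q assume q: "nbs E Y v3 = {}" "nbs E (K - C) v3 = {q}" "q \<in> K - C" "E v3 q"
      then have "q \<notin> Q" using v3 by (auto simp: nbs_def)
      moreover have "c0 q < 3" using c0 q lst_lt3 unfolding list_col_def by blast
      ultimately show thesis using that[of "c0 q"] rest_attached[OF q(1,2)] by simp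
    qed
    define M where "M v = (if v = q1 then lst p v - {b} else lst p v)" for v
    have M1: "card (lst p q1) \<le> Suc (card (M q1))"
      using diff_card_le_card_Diff[of "{b}" "lst p q1"] by (simp add: M_def)
    \<comment> \<open>The edge from q1 to the cycle pays for the colour taken away at q1, and the
      second edge leaves slack at q2.\<close>
    have "\<exists>d. list_col E Q M d"
    proof (rule list_col_slack[where r = q2])
      show "card (nbs E Q v) \<le> card (M v)" if v: "v \<in> Q" for v
        using degQ[OF v] M1 CQ[OF e(1,5)] by (cases "v = q1") (auto simp: M_def)
      show "card (nbs E Q q2) < card (M q2)"
      proof (cases "q1 = q2")
        case False
        then show ?thesis using degQ[OF e(4)] CQ[OF e(2,6)] by (simp add: M_def)
      next
        case True
        have "{v1, v2} \<subseteq> nbs E C q1" using e True sym by (auto simp: nbs_def)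
        then have "2 \<le> card (nbs E C q1)"
          using card_mono[of "nbs E C q1" "{v1, v2}"] finC ne by simp
        then show ?thesis using degQ[OF e(3)] M1 True by simp
      qed
    qed (use QK e in auto)
    then obtain d where d: "list_col E Q M d" by blast
    then have d': "list_col E Q (lst p) d" unfolding list_col_def M_def by (auto split: if_splits)
    have "d q1 \<noteq> b" "d q1 < 3" using d e lst_lt3 unfolding list_col_def M_def by force+
    moreover have "rest K p C (\<lambda>v. if v \<in> Q then d v else c0 v) v1 = {..<3} - {d q1}"
      using rest_attached att[OF e(1,3,5)] e by simp
    moreover have "rest K p C (\<lambda>v. if v \<in> Q then d v else c0 v) v1
        = rest K p C (\<lambda>v. if v \<in> Q then d v else c0 v) v3"
      by (rule rest_eq[OF C glue[OF d'] e(1) v3(1)])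
    ultimately show False using b by auto
  next
    case False
    then have allQ: "\<exists>q\<in>Q. E v q" if "v \<in> C" for v using that by (auto simp: nbs_def)
    then obtain h where h: "\<And>v. v \<in> C \<Longrightarrow> h v \<in> Q \<and> E v (h v)" by metis
    \<comment> \<open>Were all cycle vertices attached to one vertex q, the cycle would be a
      triangle and form a K4 with q.\<close>
    have "\<exists>u\<in>C. \<exists>v\<in>C. h u \<noteq> h v"
    proof (rule ccontr)
      assume "\<not> ?thesis"
      then obtain q where q: "\<And>v. v \<in> C \<Longrightarrow> h v = q" by metis
      have "C \<subseteq> nbs E K q" using h q C sym by (fastforce simp: nbs_def)
      then have "card C \<le> 3"
        using card_mono[of "nbs E K q" C] K_facts(1) deg_sum[of q] h[OF e(1)] q[OF e(1)] QK by fastforce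
      have nC: "nbs E C v \<subseteq> C - {v}" for v using irr by (auto simp: nbs_def)
      have full: "nbs E C v = C - {v}" "card C = 3" if "v \<in> C" for v
      proof -
        have "2 = card (nbs E C v)" using C that by (simp add: ind_cyc_def)
        moreover have "card (C - {v}) = card C - 1" using that finC by simp
        moreover have "card (nbs E C v) \<le> card (C - {v})" using nC finC by (intro card_mono) auto
        ultimately have "card C = 3" "card (C - {v}) = card (nbs E C v)"
          using \<open>card C \<le> 3\<close> by linarith+
        then show "nbs E C v = C - {v}" "card C = 3"
          using card_subset_eq[OF _ nC[of v]] finC by simp_all
      qed
      have qC: "q \<in> Q" "q \<notin> C" using h[OF e(1)] q[OF e(1)] QK by auto
      have "insert q C \<subseteq> V - Y" using qC QK C K_facts(3) by blast
      moreover have "card (insert q C) = 4" using full[OF e(1)] qC finC by simp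
      ultimately obtain u v where uv: "u \<in> insert q C" "v \<in> insert q C" "u \<noteq> v" "\<not> E u v"
        using no_K4 by blast
      have "E a b" if "a \<in> C" "b \<in> C" "a \<noteq> b" for a b
        using full(1)[OF that(1)] that by (auto simp: nbs_def)
      moreover have "E a q" "E q a" if "a \<in> C" for a using h[OF that] q[OF that] sym by auto
      ultimately show False using uv by blast
    qed
    then obtain u1 u2 where u: "u1 \<in> C" "u2 \<in> C" "h u1 \<noteq> h u2" by blast
    have "\<not> C \<subseteq> {u1, u2}"
    proof
      assume "C \<subseteq> {u1, u2}"
      then have "nbs E C u1 \<subseteq> {u2}" using irr by (auto simp: nbs_def)
      then have "card (nbs E C u1) \<le> card {u2}" by (intro card_mono) auto
      then show False using C u by (simp add: ind_cyc_def)
    qed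
    then obtain u3 where u3: "u3 \<in> C" "u3 \<noteq> u1" "u3 \<noteq> u2" by blast
    \<comment> \<open>An extra edge forces different colours on h u1 and h u2, and hence different
      lists on the cycle. Each end pays for it with its edge to C, and the edge from u3 provides the
      slack.\<close>
    define F where "F a b \<longleftrightarrow> E a b \<or> (a = h u1 \<and> b = h u2) \<or> (a = h u2 \<and> b = h u1)" for a b
    interpret F: sgraph F
      by unfold_locales (use sym irr u in \<open>auto simp: F_def\<close>)
    have degF: "card (nbs F Q v) \<le> card (nbs E Q v) + (if v = h u1 \<or> v = h u2 then 1 else 0)" for v
    proof -
      have "nbs F Q v \<subseteq> nbs E Q v \<union> (if v = h u1 then {h u2} else if v = h u2 then {h u1} else {})"
        by (auto simp: nbs_def F_def)
      then have "card (nbs F Q v) \<le> card (nbs E Q v \<union> (if v = h u1 then {h u2} else if v = h u2 then {h u1} else {}))"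
        using QK by (intro card_mono) auto
      also have "\<dots> \<le> card (nbs E Q v) + card (if v = h u1 then {h u2} else if v = h u2 then {h u1} else {})"
        by (rule card_Un_le)
      finally show ?thesis by (auto split: if_splits)
    qed
    have "\<exists>d. list_col F Q (lst p) d"
    proof (rule F.list_col_slack[where r = "h u3"])
      show "conn F Q" using QK by (auto intro: conn_rel_mono simp: F_def)
      show "card (nbs F Q v) \<le> card (lst p v)" if v: "v \<in> Q" for v
      proof (cases "v = h u1 \<or> v = h u2")
        case True
        then have "1 \<le> card (nbs E C v)" using CQ u h by blast
        then show ?thesis using degF[of v] degQ[OF v] True by auto
      next
        case False
        then show ?thesis using degF[of v] degQ[OF v] by auto
      qed
      show "card (nbs F Q (h u3)) < card (lst p (h u3))"
      proof (cases "h u3 = h u1 \<or> h u3 = h u2")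
        case True
        then obtain u' where u': "u' \<in> C" "u' \<noteq> u3" "h u' = h u3" using u u3 by metis
        then have "{u', u3} \<subseteq> nbs E C (h u3)" using h[of u'] h[of u3] u3 sym by (auto simp: nbs_def)
        then have "2 \<le> card (nbs E C (h u3))"
          using card_mono[of "nbs E C (h u3)" "{u', u3}"] finC u' by simp
        then show ?thesis using degF[of "h u3"] degQ[of "h u3"] h[OF u3(1)] True by auto
      next
        case False
        have "1 \<le> card (nbs E C (h u3))" using CQ u3 h by blast
        then show ?thesis using degF[of "h u3"] degQ[of "h u3"] h[OF u3(1)] False by auto
      qed
    qed (use QK u3 h in auto)
    then obtain d where d: "list_col F Q (lst p) d" by blast
    then have d': "list_col E Q (lst p) d" by (auto simp: list_col_def proper_on_def F_def)
    have "d (h u1) \<noteq> d (h u2)"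
      using d h[OF u(1)] h[OF u(2)] unfolding list_col_def proper_on_def F_def by blast
    moreover have "d (h u1) < 3" "d (h u2) < 3"
      using d h[OF u(1)] h[OF u(2)] lst_lt3 unfolding list_col_def by blast+
    moreover have "rest K p C (\<lambda>v. if v \<in> Q then d v else c0 v) v = {..<3} - {d (h v)}" if "v \<in> C" for v
      using rest_attached[of v C "h v"] att[of v "h v"] h[OF that] that by simp
    moreover have "rest K p C (\<lambda>v. if v \<in> Q then d v else c0 v) u1
        = rest K p C (\<lambda>v. if v \<in> Q then d v else c0 v) u2"
      by (rule rest_eq[OF C glue[OF d'] u(1,2)])
    ultimately show False using u by auto
  qed
qed

text \<open>By \<open>single_attachment\<close> and \<open>outer_nb\<close> a single edge joins
  \<open>Q\<close> to the cycle; its end q1 is the only vertex of \<open>Q\<close> that may have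
  fewer than two neighbours inside \<open>Q\<close>.\<close>

lemma comp_ind_cyc:
  assumes C: "ind_cyc E C" "C \<subseteq> K" and Q: "is_comp E (K - C) Q"
    and sing: "\<And>v. v \<in> Q \<Longrightarrow> card (nbs E Y v) \<le> 1"
  shows "\<exists>C'\<subseteq>Q. ind_cyc E C'"
proof -
  have QK: "Q \<subseteq> K - C" "Q \<noteq> {}" "finite Q" "finite C"
    using Q C K_facts(1) finite_subset[of Q K] unfolding is_comp_def ind_cyc_def by blast+
  have "Q \<noteq> K" using QK C by (auto simp: ind_cyc_def)
  then obtain q1 v1 where e: "q1 \<in> Q" "v1 \<in> K - Q" "E q1 v1"
    using conn_boundary[OF K_facts(2), of Q] QK by blast
  then have v1: "v1 \<in> C" using Q unfolding is_comp_def by blast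
  have one: "card (nbs E C q) \<le> 1" if "q \<in> Q" for q
  proof -
    have "\<forall>a\<in>nbs E C q. \<forall>b\<in>nbs E C q. a = b"
      using single_attachment[OF C Q _ _ that that] sym by (auto simp: nbs_def)
    then show ?thesis using QK(4) by (simp add: card_le_Suc0_iff_eq)
  qed
  show ?thesis
  proof (rule exists_ind_cyc[where z = q1])
    show "2 \<le> card (nbs E Q q)" if q: "q \<in> Q" "q \<noteq> q1" for q
    proof -
      have "nbs E C q = {}"
      proof (rule ccontr)
        assume "nbs E C q \<noteq> {}"
        then obtain a where a: "a \<in> C" "E a q" using sym by (auto simp: nbs_def)
        have Ev: "E v1 q1" using e sym by blast
        have "a = v1" using single_attachment[OF C Q a(1) v1 q(1) e(1) a(2) Ev] .
        have "{q, q1} \<subseteq> nbs E (K - C) v1" using a \<open>a = v1\<close> q e Ev QK by (auto simp: nbs_def)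
        then show False by (rule_tac outer_nb[OF C v1]) (use q in auto)
      qed
      then show ?thesis using comp_nbs[OF Q C(2) q(1)] deg_sum[of q] sing[OF q(1)] q QK by auto
    qed
    show "1 \<le> card (nbs E Q q1)"
      using comp_nbs[OF Q C(2) e(1)] deg_sum[of q1] sing[OF e(1)] one[OF e(1)] e QK by auto
  qed (use QK in auto)
qed

text \<open>The cycle is chosen such that the component of its complement that contains
  \<open>R\<close> is largest. A second component would contain a cycle whose complement has a
  larger one. So the complement is a single component, which is attached to one cycle vertex
  only.\<close>

lemma leaf_avoiding:
  assumes C0: "ind_cyc E C0" "C0 \<subseteq> K - R" and R: "R \<subseteq> K" "R \<noteq> {}" "conn E R"
    and sing: "\<And>v. v \<in> K - R \<Longrightarrow> card (nbs E Y v) \<le> 1"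
  shows "\<exists>C\<subseteq>K - R. leaf_cyc C"
proof -
  let ?P = "\<lambda>(C, Q). ind_cyc E C \<and> C \<subseteq> K - R \<and> is_comp E (K - C) Q \<and> R \<subseteq> Q"
  have ex: "\<exists>Q. is_comp E (K - C) Q \<and> R' \<subseteq> Q"
    if "R' \<subseteq> K - C" "R' \<noteq> {}" "conn E R'" for C R'
    using comp_extend[of "K - C" R'] that K_facts(1) by blast
  obtain Q0 where "?P (C0, Q0)" using ex[of R C0] C0 R by blast
  moreover have "card (snd X) < Suc (card K)" if "?P X" for X
    using that K_facts(1) card_mono[of K "snd X"] unfolding is_comp_def by fastforce
  ultimately obtain X where X: "?P X" and max: "\<And>X'. ?P X' \<Longrightarrow> card (snd X') \<le> card (snd X)"
    using ex_has_greatest_nat[of ?P "(C0, Q0)" "\<lambda>X. card (snd X)" "Suc (card K)"] by blast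
  obtain C Q where XC: "X = (C, Q)" by (cases X)
  have C: "ind_cyc E C" "C \<subseteq> K - R" "C \<subseteq> K" "C \<noteq> {}" and Q: "is_comp E (K - C) Q" "R \<subseteq> Q"
    using X XC by (auto simp: ind_cyc_def)
  have QK: "Q \<subseteq> K - C" "Q \<noteq> {}" "conn E Q" using Q unfolding is_comp_def by blast+
  have all: "K - C \<subseteq> Q"
  proof
    fix q assume q: "q \<in> K - C"
    show "q \<in> Q"
    proof (rule ccontr)
      assume "q \<notin> Q"
      obtain Q' where Q': "is_comp E (K - C) Q'" "q \<in> Q'"
        using comp_of[OF _ q] K_facts(1) by blast
      have "Q \<inter> Q' = {}" using comp_disjoint[OF Q(1) Q'(1)] Q' \<open>q \<notin> Q\<close> by blast
      moreover have Q'K: "Q' \<subseteq> K - C" using Q' unfolding is_comp_def by blast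
      ultimately have "card (nbs E Y v) \<le> 1" if "v \<in> Q'" for v
        using sing[of v] that Q(2) by blast
      then obtain C' where C': "C' \<subseteq> Q'" "ind_cyc E C'"
        using comp_ind_cyc[OF C(1,3) Q'(1)] by blast
      have "Q \<noteq> K" using QK C by blast
      then obtain x y where xy: "x \<in> Q" "y \<in> K - Q" "E x y"
        using conn_boundary[OF K_facts(2), of Q] QK by blast
      then have "y \<in> C" using Q(1) unfolding is_comp_def by blast
      have "conn E (Q \<union> C)"
        using conn_Un[OF QK(3) _ xy(1) \<open>y \<in> C\<close> xy(3) sym[OF xy(3)]] C(1) by (auto simp: ind_cyc_def)
      moreover have "Q \<union> C \<subseteq> K - C'" using QK C C' Q'K \<open>Q \<inter> Q' = {}\<close> by blast
      ultimately obtain Q'' where Q'': "is_comp E (K - C') Q''" "Q \<union> C \<subseteq> Q''"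
        using ex[of "Q \<union> C" C'] QK by blast
      have "?P (C', Q'')" using C' Q'' Q'K Q(2) \<open>Q \<inter> Q' = {}\<close> by auto
      then have "card Q'' \<le> card Q" using max[of "(C', Q'')"] XC by simp
      moreover have "finite Q''" using Q'' K_facts(1) finite_subset unfolding is_comp_def by blast
      moreover have "Q \<subset> Q''" using Q'' QK C by blast
      ultimately show False using psubset_card_mono[of Q'' Q] by linarith
    qed
  qed
  have "u = v" if uv: "u \<in> C" "v \<in> C" "nbs E Y u = {}" "nbs E Y v = {}" for u v
  proof -
    obtain q where q: "q \<in> K - C" "E u q" by (rule outer_nb[OF C(1,3) uv(1)]) (use uv in auto)
    obtain r where r: "r \<in> K - C" "E v r" by (rule outer_nb[OF C(1,3) uv(2)]) (use uv in auto)
    show ?thesis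
      using single_attachment[OF C(1,3) Q(1) uv(1,2), of q r] q r all by blast
  qed
  then have "card {v \<in> C. nbs E Y v = {}} \<le> 1"
    using C(1) by (auto simp: card_le_Suc0_iff_eq ind_cyc_def)
  then have "leaf_cyc C" using C odd_cyc by (simp add: leaf_cyc_def)
  then show ?thesis using C by blast
qed

text \<open>The three alternatives fit the count of slots in Hall's condition: three on one cycle,
  two on each of two disjoint cycles, or two with the third one forgiven because of
  \<open>w0\<close>.\<close>

lemma leaf_structure:
  "(leaf_cyc K \<and> (\<forall>v\<in>K. nbs E Y v \<noteq> {})) \<or>
   (\<exists>C1 C2. C1 \<subseteq> K \<and> C2 \<subseteq> K \<and> leaf_cyc C1 \<and> leaf_cyc C2 \<and> C1 \<inter> C2 = {}) \<or>
   (w0 \<in> K \<and> (\<exists>C\<subseteq>K. leaf_cyc C))"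
proof (cases "w0 \<in> K \<and> card (nbs E Y w0) = 2")
  \<comment> \<open>Here \<open>w0\<close> has degree one in \<open>K\<close> and so lies on no
    cycle.\<close>
  case True
  then have d1: "card (nbs E K w0) = 1" using deg_sum[of w0] by simp
  have "\<exists>C0\<subseteq>K. ind_cyc E C0"
  proof (rule exists_ind_cyc[where z = w0])
    show "2 \<le> card (nbs E K v)" if "v \<in> K" "v \<noteq> w0" for v
      using deg_sum[OF that(1)] single[of v] that K_facts(3) by fastforce
  qed (use K_facts d1 in auto)
  then obtain C0 where C0: "C0 \<subseteq> K" "ind_cyc E C0" by blast
  have "w0 \<notin> C0"
    using C0 d1 card_nbs_mono[OF K_facts(1) C0(1), of E w0] by (auto simp: ind_cyc_def)
  then have "\<exists>C\<subseteq>K - {w0}. leaf_cyc C"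
    using C0 True single K_facts(3) conn_singleton by (intro leaf_avoiding[of C0]) auto
  then show ?thesis using True by blast
next
  case False
  have sing: "card (nbs E Y v) \<le> 1" if "v \<in> K" for v
    using single[of v] double False that K_facts(3) by (cases "v = w0") auto
  have "\<exists>C0\<subseteq>K. ind_cyc E C0"
  proof (rule exists_ind_cyc)
    show "2 \<le> card (nbs E K v)" if "v \<in> K" for v using deg_sum[OF that] sing[OF that] by simp
    then show "1 \<le> card (nbs E K w0)" if "w0 \<in> K" using that by fastforce
  qed (use K_facts in auto)
  then obtain C0 where C0: "C0 \<subseteq> K" "ind_cyc E C0" by blast
  have con: "conn E C" "C \<noteq> {}" if "ind_cyc E C" for C using that by (auto simp: ind_cyc_def)
  show ?thesis
  proof (cases "C0 = K")
    case True
    then have K: "ind_cyc E K" using C0 by simp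
    have slots: "nbs E Y v \<noteq> {}" if "v \<in> K" for v
      by (rule outer_nb[OF K subset_refl that]) auto
    then have "{v \<in> K. nbs E Y v = {}} = {}" by blast
    then have "card {v \<in> K. nbs E Y v = {}} \<le> 1" by (metis card.empty zero_le)
    then have "leaf_cyc K" using K odd_cyc[OF K] by (simp add: leaf_cyc_def)
    then show ?thesis using slots by blast
  next
    case ne: False
    then obtain q where q: "q \<in> K - C0" using C0 by blast
    obtain Q where Q: "is_comp E (K - C0) Q" using comp_of[OF _ q] K_facts(1) by blast
    then obtain C' where C': "C' \<subseteq> Q" "ind_cyc E C'"
      using comp_ind_cyc[OF C0(2,1) Q] sing unfolding is_comp_def by blast
    then have "C' \<subseteq> K - C0" using Q unfolding is_comp_def by blast
    then obtain C1 where C1: "C1 \<subseteq> K - C0" "leaf_cyc C1"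
      using leaf_avoiding[OF C'(2), of C0] C0 con sing by blast
    then have C1': "ind_cyc E C1" by (simp add: leaf_cyc_def)
    have "\<exists>C2\<subseteq>K - C1. leaf_cyc C2"
      using leaf_avoiding[OF C0(2), of C1] C0 C1 con[OF C1'] sing by blast
    then obtain C2 where "C2 \<subseteq> K - C1" "leaf_cyc C2" by blast
    then show ?thesis using C1 by blast
  qed
qed

text \<open>The colouring \<open>p\<close> has served to derive the structure of \<open>K\<close>;
  now \<open>r\<close> is any other one. A slot has no neighbour in \<open>K - C\<close>, so its
  list depends on \<open>r\<close> alone, and two owners of different colours leave different lists
  on the cycle.\<close>

lemma extend_unequal_slots:
  assumes C: "leaf_cyc C" "C \<subseteq> K" and uv: "u \<in> C" "v \<in> C" "y \<in> nbs E Y u" "z \<in> nbs E Y v"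
    and r: "r y < (3::nat)" "r z < 3" "r y \<noteq> r z"
  shows "\<exists>c. list_col E K (lst r) c"
proof -
  have C': "ind_cyc E C" using C by (simp add: leaf_cyc_def)
  have "\<exists>c. list_col E (K - C) (lst r) c"
    using list_col_proper_subset[OF K_facts(1,2) diff_cyc_subset[OF C' C(2)]] K_facts(6) by blast
  then obtain c where c: "list_col E (K - C) (lst r) c" by blast
  have rest: "rest K r C c x = {..<3} - {r a}" if "x \<in> C" "a \<in> nbs E Y x" for x a
    by (rule outer_nb[OF C' C(2) that(1)]) (use that in \<open>auto simp: rest_def lst_def\<close>)
  have "rest K r C c u \<noteq> rest K r C c v"
    using rest[OF uv(1,3)] rest[OF uv(2,4)] r by auto
  then show ?thesis using list_col_from_unequal[OF compK C' C(2) c uv(1,2)] by blast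
qed

end

section \<open>Colouring the high vertices in order of rank\<close>

lemma backward_coloring:
  fixes \<sigma> :: "'a \<Rightarrow> nat"
  assumes "finite Y" "inj_on \<sigma> Y" "\<And>y. y \<in> Y \<Longrightarrow> card (D y) \<le> 2"
    and D: "\<And>y d. y \<in> Y \<Longrightarrow> d \<in> D y \<Longrightarrow> d \<in> Y \<and> \<sigma> d < \<sigma> y"
    and finD: "\<And>y. finite (D y)"
  shows "\<exists>p. (\<forall>y\<in>Y. p y < (3::nat)) \<and> (\<forall>y\<in>Y. \<forall>d\<in>D y. p d \<noteq> p y)"
proof -
  define F where "F u v \<longleftrightarrow> u \<in> Y \<and> v \<in> Y \<and> (u \<in> D v \<or> v \<in> D u)" for u v
  have "\<exists>c. list_col F Y (\<lambda>_. {..<3::nat}) c"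
  proof (rule degenerate_list_col)
    show "F u v \<Longrightarrow> F v u" for u v by (auto simp: F_def)
    show "\<not> F v v" for v using D by (auto simp: F_def)
  next
    fix T assume T: "T \<subseteq> Y" "T \<noteq> {}"
    have finT: "finite T" using T assms(1) finite_subset by blast
    \<comment> \<open>In the graph of forbidden pairs the neighbours of the highest ranked vertex v
      of T all belong to \<open>D v\<close>.\<close>
    then have "Max (\<sigma> ` T) \<in> \<sigma> ` T" using T by (intro Max_in) auto
    then obtain v where v: "v \<in> T" "\<sigma> v = Max (\<sigma> ` T)" by auto
    have le: "\<sigma> u \<le> \<sigma> v" if "u \<in> T" for u using that finT v by simp
    have "nbs F T v \<subseteq> D v"
    proof
      fix u assume "u \<in> nbs F T v"
      then have u: "u \<in> T" "u \<in> Y" "v \<in> Y" "v \<in> D u \<or> u \<in> D v" by (auto simp: nbs_def F_def)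
      then show "u \<in> D v" using D[of u v] le[OF u(1)] by auto
    qed
    then have "card (nbs F T v) \<le> card (D v)" using finD by (intro card_mono) auto
    then show "\<exists>v\<in>T. card (nbs F T v) < card {..<3::nat}" using v T assms(3)[of v] by fastforce
  qed (use assms in auto)
  then obtain c where c: "list_col F Y (\<lambda>_. {..<3::nat}) c" by blast
  have "c d \<noteq> c y" if "y \<in> Y" "d \<in> D y" for y d
    using c D[OF that] that unfolding list_col_def proper_on_def F_def by blast
  then show ?thesis using c unfolding list_col_def by (intro exI[of _ c]) auto
qed

context high_low
begin

text \<open>The ranking decides which owner of a slot on a leaf cycle avoids the colour of the lowest
  ranked owner. The bounds on the slots of other owners are Hall's condition for capacity two, as
  every high vertex has at most six neighbours.\<close>

theorem three_colorable:
  fixes \<sigma> :: "'a \<Rightarrow> nat"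
  assumes inj: "inj_on \<sigma> Y"
    and slots: "\<And>C f. C \<subseteq> V - Y \<Longrightarrow> leaf_cyc C \<Longrightarrow> f \<in> Y \<Longrightarrow> (\<exists>v\<in>C. E v f) \<Longrightarrow>
      (\<And>y v. y \<in> Y \<Longrightarrow> v \<in> C \<Longrightarrow> E v y \<Longrightarrow> \<sigma> f \<le> \<sigma> y) \<Longrightarrow>
      2 \<le> card {v \<in> C. \<exists>y\<in>Y. E v y \<and> y \<noteq> f} \<and>
      ((\<forall>v\<in>C. nbs E Y v \<noteq> {}) \<longrightarrow> 3 \<le> card {v \<in> C. \<exists>y\<in>Y. E v y \<and> y \<noteq> f})"
  shows "\<exists>c. proper_on E V c \<and> (\<forall>v\<in>V. c v < (3::nat))"
proof -
  define owner where "owner C y \<longleftrightarrow> y \<in> Y \<and> (\<exists>v\<in>C. E v y)" for C y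
  \<comment> \<open>The owner whose colour the assigned owner has to avoid; its lowest rank makes
    the avoiding relation acyclic.\<close>
  define first where "first C = (SOME f. owner C f \<and> (\<forall>y. owner C y \<longrightarrow> \<sigma> f \<le> \<sigma> y))" for C
  define others where "others C = {v \<in> C. \<exists>y\<in>Y. E v y \<and> y \<noteq> first C}" for C
  have first: "owner C (first C) \<and> (\<forall>y. owner C y \<longrightarrow> \<sigma> (first C) \<le> \<sigma> y)" if C: "leaf_cyc C" for C
  proof -
    obtain x where x: "x \<in> C" and C': "finite C" "\<And>v. v \<in> C \<Longrightarrow> card (nbs E C v) = 2"
      using C unfolding leaf_cyc_def ind_cyc_def by blast
    have "card (nbs E C x) \<le> card C" using C' by (intro card_mono nbs_subset) auto
    then have "2 \<le> card C" using C'(2)[OF x] by simp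
    then have "{v \<in> C. nbs E Y v = {}} \<noteq> C" using C by (auto simp: leaf_cyc_def)
    then obtain y where "owner C y" by (auto simp: owner_def nbs_def)
    then show ?thesis
      unfolding first_def
      using someI_ex[of "\<lambda>f. owner C f \<and> (\<forall>y. owner C y \<longrightarrow> \<sigma> f \<le> \<sigma> y)"]
        ex_has_least_nat[of "owner C" y \<sigma>] by blast
  qed
  have others2: "2 \<le> card (others C) \<and> ((\<forall>v\<in>C. nbs E Y v \<noteq> {}) \<longrightarrow> 3 \<le> card (others C))"
    if "C \<subseteq> V - Y" "leaf_cyc C" for C
    unfolding others_def using slots[OF that, of "first C"] first[OF that(2)] by (auto simp: owner_def)
  \<comment> \<open>Three slots of other owners are wanted per component, since a high vertex has at
    most six neighbours and may serve two components. The component containing \<open>w0\<close> is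
    forgiven one.\<close>
  define good where "good K \<F> \<longleftrightarrow> (\<forall>C\<in>\<F>. C \<subseteq> K \<and> leaf_cyc C) \<and>
      3 \<le> card (\<Union>(others ` \<F>)) + (if w0 \<in> K then 1 else 0)" for K \<F>
  define J where "J = {K. bad K}"
  have J: "is_comp E (V - Y) K" if "K \<in> J" for K using that by (auto simp: J_def bad_def)
  have JV: "K \<subseteq> V - Y" "finite K" if "K \<in> J" for K using comp_facts[OF J[OF that]] by blast+
  have finJ: "finite J"
    using JV finV by (intro finite_subset[of J "Pow V"]) auto
  have bad_loc: "\<exists>p. bad_comp E V Y w0 K p" if "K \<in> J" for K
    using that unfolding J_def bad_def bad_comp_def bad_comp_axioms_def
    using high_low_axioms by blast
  have "\<exists>\<F>. good K \<F>" if K: "K \<in> J" for K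
  proof -
    obtain p where "bad_comp E V Y w0 K p" using bad_loc[OF K] by blast
    then interpret bad_comp E V Y w0 K p .
    have fin: "finite (others C)" if "C \<subseteq> K" for C
      using that JV(2)[OF K] finite_subset by (fastforce simp: others_def)
    have sub: "C \<subseteq> V - Y" if "C \<subseteq> K" for C using that JV(1)[OF K] by blast
    show ?thesis
      using leaf_structure
    proof (elim disjE conjE exE)
      assume "leaf_cyc K" "\<forall>v\<in>K. nbs E Y v \<noteq> {}"
      then have "good K {K}" using others2[of K] JV(1)[OF K] by (simp add: good_def)
      then show ?thesis by blast
    next
      fix C1 C2 assume C: "C1 \<subseteq> K" "C2 \<subseteq> K" "leaf_cyc C1" "leaf_cyc C2" "C1 \<inter> C2 = {}"
      have "card (others C1 \<union> others C2) = card (others C1) + card (others C2)"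
        using C fin by (intro card_Un_disjoint) (auto simp: others_def)
      then have "good K {C1, C2}"
        using others2[of C1] others2[of C2] C sub by (simp add: good_def)
      then show ?thesis by blast
    next
      fix C assume C: "w0 \<in> K" "C \<subseteq> K" "leaf_cyc C"
      then have "good K {C}" using others2[of C] sub by (simp add: good_def)
      then show ?thesis by blast
    qed
  qed
  then obtain \<F> where F: "\<And>K. K \<in> J \<Longrightarrow> good K (\<F> K)" by metis
  have FC: "C \<subseteq> K" "leaf_cyc C" if "K \<in> J" "C \<in> \<F> K" for K C
    using F[OF that(1)] that(2) by (auto simp: good_def)
  define O' where "O' K = \<Union>(others ` \<F> K)" for K
  define A where "A K = {y \<in> Y. \<exists>C\<in>\<F> K. \<exists>v\<in>C. E v y \<and> y \<noteq> first C}" for K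
  have OK: "O' K \<subseteq> K" if "K \<in> J" for K
    using FC[OF that] unfolding O'_def others_def by blast
  have "\<exists>\<phi>. (\<forall>K\<in>J. \<phi> K \<in> A K) \<and> (\<forall>y. card {K \<in> J. \<phi> K = y} \<le> 2)"
  proof (rule hall_capacity_two[OF finJ])
    show "finite (A K)" for K using finY by (simp add: A_def)
    fix J' assume J': "J' \<subseteq> J"
    have finJ': "finite J'" using J' finJ finite_subset by blast
    have AY: "\<Union>(A ` J') \<subseteq> Y" "finite (\<Union>(A ` J'))"
      using finY finite_subset[of "\<Union>(A ` J')" Y] by (auto simp: A_def)
    have disj: "K \<inter> K' = {}" if "K \<in> J'" "K' \<in> J'" "K \<noteq> K'" for K K'
      using comp_disjoint[OF J J] that J' by blast
    \<comment> \<open>The components are disjoint, so their slots are counted without repetition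
      among the neighbours of the available owners; at most one component contains
      \<open>w0\<close>.\<close>
    have "3 * card J' = (\<Sum>K\<in>J'. 3)" by simp
    also have "\<dots> \<le> (\<Sum>K\<in>J'. card (O' K) + (if w0 \<in> K then 1 else 0))"
    proof (rule sum_mono)
      fix K assume "K \<in> J'"
      then have "good K (\<F> K)" using F J' by blast
      then show "3 \<le> card (O' K) + (if w0 \<in> K then 1 else 0)" by (simp add: good_def O'_def)
    qed
    also have "\<dots> = (\<Sum>K\<in>J'. card (O' K)) + card {K \<in> J'. w0 \<in> K}"
      using finJ' by (simp add: sum.distrib sum.If_cases Int_def)
    also have "(\<Sum>K\<in>J'. card (O' K)) = card (\<Union>(O' ` J'))"
    proof (rule card_UN_disjoint[symmetric, OF finJ'])
      show "\<forall>K\<in>J'. finite (O' K)" using OK JV J' finite_subset by blast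
      show "\<forall>K\<in>J'. \<forall>K'\<in>J'. K \<noteq> K' \<longrightarrow> O' K \<inter> O' K' = {}" using OK disj J' by blast
    qed
    also have "card {K \<in> J'. w0 \<in> K} \<le> 1"
      using disj finJ' by (auto simp: card_le_Suc0_iff_eq)
    also have "card (\<Union>(O' ` J')) \<le> card (\<Union>y\<in>\<Union>(A ` J'). nbs E V y)"
    proof (rule card_mono)
      show "finite (\<Union>y\<in>\<Union>(A ` J'). nbs E V y)"
        by (rule finite_UN_I[OF AY(2)]) (simp add: finV)
      show "\<Union>(O' ` J') \<subseteq> (\<Union>y\<in>\<Union>(A ` J'). nbs E V y)"
      proof
        fix v assume "v \<in> \<Union>(O' ` J')"
        then obtain K C y where v: "K \<in> J'" "C \<in> \<F> K" "v \<in> C" "y \<in> Y" "E v y" "y \<noteq> first C"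
          by (auto simp: O'_def others_def)
        then have "y \<in> A K" by (auto simp: A_def)
        moreover have "v \<in> V" using v FC(1)[of K C] JV(1)[of K] J' by blast
        then have "v \<in> nbs E V y" using v sym by (auto simp: nbs_def)
        ultimately show "v \<in> (\<Union>y\<in>\<Union>(A ` J'). nbs E V y)" using v by blast
      qed
    qed
    also have "card (\<Union>y\<in>\<Union>(A ` J'). nbs E V y) \<le> (\<Sum>y\<in>\<Union>(A ` J'). card (nbs E V y))"
      using AY by (intro card_UN_le) auto
    also have "\<dots> \<le> (\<Sum>y\<in>\<Union>(A ` J'). 6)" using high_deg AY by (intro sum_mono) blast
    finally have "3 * card J' \<le> 6 * card (\<Union>(A ` J')) + 1" by simp
    \<comment> \<open>The surplus of one is lost in the division by three.\<close>
    then show "card J' \<le> 2 * card (\<Union>(A ` J'))" by presburger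
  qed
  then obtain \<phi> where phi: "\<And>K. K \<in> J \<Longrightarrow> \<phi> K \<in> A K" "\<And>y. card {K \<in> J. \<phi> K = y} \<le> 2" by blast
  have "\<exists>C. C \<in> \<F> K \<and> (\<exists>v\<in>C. E v (\<phi> K)) \<and> \<phi> K \<noteq> first C" if "K \<in> J" for K
    using phi(1)[OF that] by (auto simp: A_def)
  then obtain \<gamma> where g: "\<And>K. K \<in> J \<Longrightarrow> \<gamma> K \<in> \<F> K \<and> (\<exists>v\<in>\<gamma> K. E v (\<phi> K)) \<and> \<phi> K \<noteq> first (\<gamma> K)"
    by metis
  \<comment> \<open>The vertices whose colours y must avoid, one for each component assigned to
    y.\<close>
  define D where "D y = (\<lambda>K. first (\<gamma> K)) ` {K \<in> J. \<phi> K = y}" for y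
  have phiY: "\<phi> K \<in> Y" if "K \<in> J" for K using phi(1)[OF that] by (simp add: A_def)
  have "\<exists>p. (\<forall>y\<in>Y. p y < (3::nat)) \<and> (\<forall>y\<in>Y. \<forall>d\<in>D y. p d \<noteq> p y)"
  proof (rule backward_coloring[OF finY inj])
    show "card (D y) \<le> 2" for y
      unfolding D_def using phi(2)[of y] finJ by (intro order_trans[OF card_image_le]) auto
    show "finite (D y)" for y using finJ by (simp add: D_def)
    fix y d assume "y \<in> Y" "d \<in> D y"
    then obtain K where K: "K \<in> J" "\<phi> K = y" "d = first (\<gamma> K)" by (auto simp: D_def)
    have "owner (\<gamma> K) y" using g[OF K(1)] K \<open>y \<in> Y\<close> by (auto simp: owner_def)
    moreover have f: "owner (\<gamma> K) d" "\<And>z. owner (\<gamma> K) z \<Longrightarrow> \<sigma> d \<le> \<sigma> z"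
      using first[of "\<gamma> K"] FC(2)[OF K(1)] g[OF K(1)] K by blast+
    ultimately have "\<sigma> d \<le> \<sigma> y" by blast
    moreover have "\<sigma> d \<noteq> \<sigma> y"
      using inj g[OF K(1)] K f(1) \<open>y \<in> Y\<close> by (auto simp: owner_def inj_on_def)
    ultimately show "d \<in> Y \<and> \<sigma> d < \<sigma> y" using f(1) by (simp add: owner_def)
  qed
  then obtain p where p: "\<And>y. y \<in> Y \<Longrightarrow> p y < (3::nat)" "\<And>y d. y \<in> Y \<Longrightarrow> d \<in> D y \<Longrightarrow> p d \<noteq> p y"
    by blast
  have ext: "\<exists>c. list_col E K (lst p) c" if K: "is_comp E (V - Y) K" for K
  proof (cases "K \<in> J")
    case False
    then show ?thesis using K p(1) by (auto simp: J_def bad_def)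
  next
    case True
    obtain q where "bad_comp E V Y w0 K q" using bad_loc[OF True] by blast
    then interpret bad_comp E V Y w0 K q .
    have C: "leaf_cyc (\<gamma> K)" "\<gamma> K \<subseteq> K" using FC g True by blast+
    obtain u where u: "u \<in> \<gamma> K" "E u (\<phi> K)" using g[OF True] by blast
    have ow: "owner (\<gamma> K) (first (\<gamma> K))" using first[OF C(1)] by blast
    then obtain v where v: "v \<in> \<gamma> K" "E v (first (\<gamma> K))" "first (\<gamma> K) \<in> Y" by (auto simp: owner_def)
    have "first (\<gamma> K) \<in> D (\<phi> K)" using True by (auto simp: D_def)
    then have "p (first (\<gamma> K)) \<noteq> p (\<phi> K)" using p(2) phiY[OF True] by blast
    then show ?thesis
      using extend_unequal_slots[OF C u(1) v(1), of "\<phi> K" "first (\<gamma> K)" p] u v phiY[OF True] p(1)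
      by (auto simp: nbs_def)
  qed
  then obtain d where d: "\<And>K. is_comp E (V - Y) K \<Longrightarrow> list_col E K (lst p) (d K)" by metis
  have "\<exists>K. is_comp E (V - Y) K \<and> v \<in> K" if "v \<in> V - Y" for v
    using comp_of[OF _ that] finV by blast
  then obtain k where k: "\<And>v. v \<in> V - Y \<Longrightarrow> is_comp E (V - Y) (k v) \<and> v \<in> k v" by metis
  define c where "c v = (if v \<in> Y then p v else d (k v) v)" for v
  have mem: "d (k v) v \<in> lst p v" if "v \<in> V - Y" for v
    using d k[OF that] unfolding list_col_def by blast
  have "c u \<noteq> c v" if uv: "u \<in> V" "v \<in> V" "E u v" for u v
  proof -
    have cross: "c a \<noteq> c b" if ab: "a \<in> Y" "b \<in> V - Y" "E b a" for a b
    proof -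
      have "p a \<in> p ` nbs E Y b" using ab by (simp add: nbs_def)
      then have "p a \<noteq> d (k b) b" using mem[OF ab(2)] by (auto simp: lst_def)
      then show ?thesis using ab by (simp add: c_def)
    qed
    show ?thesis
    proof (cases "u \<in> Y"; cases "v \<in> Y")
      assume "u \<in> Y" "v \<in> Y" then show ?thesis using indep uv by blast
    next
      assume "u \<in> Y" "v \<notin> Y" then show ?thesis using cross[of u v] uv sym by blast
    next
      assume "u \<notin> Y" "v \<in> Y" then show ?thesis using cross[of v u] uv by fastforce
    next
      assume *: "u \<notin> Y" "v \<notin> Y"
      then have ku: "is_comp E (V - Y) (k u)" "u \<in> k u" and kv: "is_comp E (V - Y) (k v)" "v \<in> k v"
        using k uv by blast+
      have "v \<in> k u" using ku uv * unfolding is_comp_def by blast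
      then have "k u = k v" using comp_disjoint[OF ku(1) kv(1)] kv by blast
      then show ?thesis
        using d[OF ku(1)] ku \<open>v \<in> k u\<close> uv * unfolding list_col_def proper_on_def by (auto simp: c_def)
    qed
  qed
  moreover have "c v < 3" if "v \<in> V" for v
    using that p(1) mem[of v] by (auto simp: c_def lst_def)
  ultimately show ?thesis unfolding proper_on_def by blast
qed

end

section \<open>Contracting stars\<close>

locale subcubic = sgraph E for E :: "'a \<Rightarrow> 'a \<Rightarrow> bool" +
  fixes V :: "'a set"
  assumes fin: "finite V" and E_V: "E u v \<Longrightarrow> u \<in> V \<and> v \<in> V"
    and deg3: "card (nbs E V v) \<le> 3"
    and tri: "E u v \<Longrightarrow> E v w \<Longrightarrow> \<not> E w u"
begin

definition N :: "'a \<Rightarrow> 'a set" where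
  "N v = nbs E V v"

definition N2 :: "'a \<Rightarrow> 'a set" where
  "N2 x = (\<Union>u\<in>N x. N u - {x})"

text \<open>The odd cycles that are left intact when the star of \<open>x\<close> is
  contracted.\<close>

definition odd_cyc_off :: "'a \<Rightarrow> 'a set \<Rightarrow> bool" where
  "odd_cyc_off x C \<longleftrightarrow> ind_cyc E C \<and> C \<subseteq> V \<and> odd (card C) \<and> C \<inter> insert x (N x) = {}"

fun ball :: "nat \<Rightarrow> 'a set \<Rightarrow> 'a set" where
  "ball 0 S = S"
| "ball (Suc n) S = ball n S \<union> (\<Union>v\<in>ball n S. N v)"

lemma in_N: "u \<in> N v \<longleftrightarrow> E v u"
  using E_V by (auto simp: N_def nbs_def)

lemma fin_N [simp]: "finite (N v)"
  by (simp add: N_def fin)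

lemma card_N: "card (N v) \<le> 3"
  using deg3 by (simp add: N_def)

lemma in_N2: "v \<in> N2 x \<longleftrightarrow> v \<noteq> x \<and> (\<exists>u. E x u \<and> E u v)"
  by (auto simp: N2_def in_N)

lemma N2_sym: "v \<in> N2 x \<longleftrightarrow> x \<in> N2 v"
  using sym by (auto simp: in_N2)

lemma fin_N2 [simp]: "finite (N2 v)"
  by (simp add: N2_def)

lemma N_N2_disjoint: "N x \<inter> N2 x = {}"
proof -
  have False if "E x v" "E x u" "E u v" for u v using tri[OF that(2,3)] sym[OF that(1)] by blast
  then show ?thesis by (auto simp: in_N in_N2)
qed

lemma card_N_minus: "E v u \<Longrightarrow> card (N v - {u}) \<le> 2"
  using card_N[of v] by (simp add: in_N)

lemma card_UN_bound:
  assumes "finite S" "\<And>u. u \<in> S \<Longrightarrow> card (F u) \<le> k"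
  shows "card (\<Union>u\<in>S. F u) \<le> k * card S"
proof -
  have "card (\<Union>u\<in>S. F u) \<le> (\<Sum>u\<in>S. card (F u))" using assms by (intro card_UN_le)
  also have "\<dots> \<le> (\<Sum>u\<in>S. k)" using assms by (intro sum_mono) auto
  finally show ?thesis by (simp add: mult.commute)
qed

lemma card_N2: "card (N2 x) \<le> 6"
proof -
  have "card (N2 x) \<le> 2 * card (N x)"
    unfolding N2_def using card_N_minus sym by (intro card_UN_bound) (auto simp: in_N)
  then show ?thesis using card_N[of x] by linarith
qed

lemma odd_cyc_card:
  assumes "ind_cyc E C" "odd (card C)"
  shows "5 \<le> card C"
proof -
  have fC: "finite C" "C \<noteq> {}" and d: "\<And>v. v \<in> C \<Longrightarrow> card (nbs E C v) = 2"
    using assms by (auto simp: ind_cyc_def)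
  obtain v where v: "v \<in> C" using fC by blast
  have sub: "nbs E C u \<subseteq> C - {u}" for u using irr by (auto simp: nbs_def)
  have "card (nbs E C v) \<le> card (C - {v})" using fC sub by (intro card_mono) auto
  then have "3 \<le> card C" using d v fC by simp
  moreover have "card C \<noteq> 3"
  proof
    assume c3: "card C = 3"
    have full: "nbs E C u = C - {u}" if "u \<in> C" for u
      using that d fC c3 sub by (intro card_subset_eq) auto
    obtain a b where "nbs E C v = {a, b}" "a \<noteq> b" using d[OF v] by (meson card_2_iff)
    then have ab: "a \<in> C" "b \<in> C" "E v a" "E v b" by (auto simp: nbs_def set_eq_iff)
    then have "E a b" using full[OF ab(1)] \<open>a \<noteq> b\<close> by (auto simp: nbs_def set_eq_iff)
    then show False using tri[OF ab(3) _ ] ab sym by blast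
  qed
  moreover have "card C \<noteq> 4" using assms by auto
  ultimately show ?thesis by linarith
qed

lemma cyc_outer:
  assumes "ind_cyc E C" "C \<subseteq> V" "v \<in> C"
  shows "card (N v - C) \<le> 1"
proof -
  have "nbs E C v = N v \<inter> C" by (auto simp: nbs_def in_N)
  then have "card (N v \<inter> C) = 2" using assms by (auto simp: ind_cyc_def)
  moreover have "card (N v) = card (N v \<inter> C) + card (N v - C)"
    by (metis card_Int_Diff fin_N)
  ultimately show ?thesis using card_N[of v] by linarith
qed

text \<open>A cycle vertex has at most one neighbour off the cycle, and for \<open>v\<close> this is
  the vertex linking it to \<open>x\<close>.\<close>

lemma cyc_N2_nbs:
  assumes C: "odd_cyc_off x C" and v: "v \<in> C" "v \<in> N2 x"
  shows "N v \<subseteq> C \<union> N x"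
proof
  fix w assume w: "w \<in> N v"
  obtain u where u: "E x u" "E u v" using v by (auto simp: in_N2)
  have "u \<notin> C" using C u by (auto simp: odd_cyc_off_def in_N)
  have "w = u" if "w \<notin> C"
  proof -
    have "card (N v - C) \<le> 1" using C v by (intro cyc_outer) (auto simp: odd_cyc_off_def)
    moreover have "u \<in> N v - C" "w \<in> N v - C" using u w that \<open>u \<notin> C\<close> sym by (auto simp: in_N)
    ultimately show ?thesis by (simp add: card_le_Suc0_iff_eq)
  qed
  then show "w \<in> C \<union> N x" using u by (auto simp: in_N)
qed

text \<open>Of the at most six vertices in the second neighbourhood those on the cycle are absorbed,
  and the one cycle vertex elsewhere adds at most one new neighbour. As an odd cycle has at least
  five vertices, at most three neighbours remain: contracting star and cycle together gives a vertex
  of low degree.\<close>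

lemma pure_outside:
  assumes C: "odd_cyc_off x C" and one: "card (C - N2 x) \<le> 1"
  defines "Z \<equiv> insert x (N x) \<union> C"
  shows "card ((\<Union>v\<in>Z. N v) - Z) + card (C \<inter> N2 x) \<le> 7" "4 \<le> card (C \<inter> N2 x)"
    and "card Z \<le> 5 + card (C \<inter> N2 x)"
proof -
  have cyc: "ind_cyc E C" "C \<subseteq> V" "odd (card C)" and disj: "C \<inter> insert x (N x) = {}"
    using C by (auto simp: odd_cyc_off_def)
  have finC: "finite C" using cyc by (simp add: ind_cyc_def)
  have split: "card C = card (C \<inter> N2 x) + card (C - N2 x)" using finC by (metis card_Int_Diff)
  then show P4: "4 \<le> card (C \<inter> N2 x)" using odd_cyc_card[OF cyc(1,3)] one by linarith
  have "(\<Union>v\<in>Z. N v) - Z \<subseteq> (N2 x - C) \<union> (\<Union>v\<in>C - N2 x. N v - C)"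
  proof
    fix w assume "w \<in> (\<Union>v\<in>Z. N v) - Z"
    then obtain v where v: "v \<in> Z" "E v w" and w: "w \<notin> Z" by (auto simp: in_N)
    have wx: "w \<noteq> x" "w \<notin> C" "w \<notin> N x" using w by (auto simp: Z_def)
    consider "v = x" | "v \<in> N x" | "v \<in> C" "v \<in> N2 x" | "v \<in> C" "v \<notin> N2 x"
      using v by (auto simp: Z_def)
    then show "w \<in> (N2 x - C) \<union> (\<Union>v\<in>C - N2 x. N v - C)"
    proof cases
      case 1 then show ?thesis using v wx by (simp add: in_N)
    next
      case 2 then show ?thesis using v wx by (auto simp: in_N in_N2)
    next
      case 3 then show ?thesis using cyc_N2_nbs[OF C 3] v wx by (auto simp: in_N)
    next
      case 4 then show ?thesis using v wx by (auto simp: in_N)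
    qed
  qed
  then have "card ((\<Union>v\<in>Z. N v) - Z) \<le> card ((N2 x - C) \<union> (\<Union>v\<in>C - N2 x. N v - C))"
    using finC by (intro card_mono) auto
  also have "\<dots> \<le> card (N2 x - C) + card (\<Union>v\<in>C - N2 x. N v - C)" by (rule card_Un_le)
  also have "card (\<Union>v\<in>C - N2 x. N v - C) \<le> 1 * card (C - N2 x)"
    using finC cyc_outer[OF cyc(1,2)] by (intro card_UN_bound) auto
  also have "card (N2 x - C) \<le> 6 - card (C \<inter> N2 x)"
    using card_N2[of x] by (simp add: card_Diff_subset_Int Int_commute)
  finally show "card ((\<Union>v\<in>Z. N v) - Z) + card (C \<inter> N2 x) \<le> 7"
    using one card_mono[of "N2 x" "C \<inter> N2 x"] card_N2[of x] by auto
  have "card Z \<le> card (insert x (N x)) + card C" unfolding Z_def by (rule card_Un_le)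
  also have "card (insert x (N x)) \<le> Suc (card (N x))" by (rule card_insert_le_m1) auto
  finally show "card Z \<le> 5 + card (C \<inter> N2 x)" using split one card_N[of x] by linarith
qed

lemma ball_mono: "S \<subseteq> T \<Longrightarrow> ball n S \<subseteq> ball n T"
  by (induction n) auto

lemma ball_step: "v \<in> ball n S \<Longrightarrow> E v u \<Longrightarrow> u \<in> ball (Suc n) S"
  by (auto simp: in_N)

lemma ball_le: "m \<le> n \<Longrightarrow> ball m S \<subseteq> ball n S"
  by (induction rule: dec_induct) auto

text \<open>A run is a proper 3-colouring in which some vertices carry two colours.\<close>

definition run :: "('a \<Rightarrow> nat set) \<Rightarrow> bool" where
  "run D \<longleftrightarrow> (\<forall>v\<in>V. D v \<subseteq> {..<3} \<and> D v \<noteq> {}) \<and> (\<forall>u v. E u v \<longrightarrow> D u \<inter> D v = {})"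

end

text \<open>In a run the neighbours of every vertex of \<open>Xn \<union> Xp\<close> are to share one colour. The star of such
  a vertex is contracted, for \<open>x \<in> Xp\<close> together with the odd cycle \<open>Cf x\<close>.\<close>

locale packing = subcubic +
  fixes Xn Xp :: "'a set" and Cf :: "'a \<Rightarrow> 'a set" and \<sigma> :: "'a \<Rightarrow> nat" and w0 :: 'a
  assumes connV: "conn E V"
    and X_V: "Xn \<union> Xp \<subseteq> V" and X_disj: "Xn \<inter> Xp = {}"
    and pure: "x \<in> Xp \<Longrightarrow> odd_cyc_off x (Cf x) \<and> card (Cf x - N2 x) = 1"
    and Z_disj: "x \<in> Xn \<union> Xp \<Longrightarrow> y \<in> Xn \<union> Xp \<Longrightarrow> x \<noteq> y \<Longrightarrow>
      (insert x (N x) \<union> (if x \<in> Xp then Cf x else {})) \<inter>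
      (insert y (N y) \<union> (if y \<in> Xp then Cf y else {})) = {}"
    and far: "x \<in> Xn \<Longrightarrow> y \<in> Xn \<Longrightarrow> x \<noteq> y \<Longrightarrow> u \<in> insert x (N x) \<Longrightarrow> v \<in> insert y (N y) \<Longrightarrow> \<not> E u v"
    and zone: "x \<in> Xp \<Longrightarrow> y \<in> Xn \<Longrightarrow> y \<notin> ball 3 (insert x (N x) \<union> Cf x)"
    and sing: "v \<noteq> w0 \<Longrightarrow> y \<in> Xn \<Longrightarrow> z \<in> Xn \<Longrightarrow> v \<in> N2 y \<Longrightarrow> v \<in> N2 z \<Longrightarrow> y = z"
    and doub: "card {y \<in> Xn. w0 \<in> N2 y} \<le> 2"
    and inj: "inj_on \<sigma> Xn"
    and not_pure: "f \<in> Xn \<Longrightarrow> odd_cyc_off f C \<Longrightarrow> 2 \<le> card (C - N2 f)"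
    and heavy: "f \<in> Xn \<Longrightarrow> odd_cyc_off f C \<Longrightarrow> card (C - N2 f) \<le> 2 \<Longrightarrow> a \<in> C \<Longrightarrow> a \<notin> N2 f \<Longrightarrow>
      y \<in> Xn \<Longrightarrow> y \<noteq> f \<Longrightarrow> a \<in> N2 y \<Longrightarrow> C \<inter> insert y (N y) = {} \<Longrightarrow> \<sigma> y < \<sigma> f"
    and large: "x \<in> Xp \<Longrightarrow> y \<in> Xp \<Longrightarrow> x \<noteq> y \<Longrightarrow> 36 < card V"
begin

section \<open>The contracted graph\<close>

definition Z :: "'a \<Rightarrow> 'a set" where
  "Z x = insert x (N x) \<union> (if x \<in> Xp then Cf x else {})"

text \<open>The sets \<open>Z x\<close> are disjoint, so the choice is determined. A contracted set
  is named by its centre.\<close>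

definition rep :: "'a \<Rightarrow> 'a" where
  "rep v = (if \<exists>x\<in>Xn \<union> Xp. v \<in> Z x then (SOME x. x \<in> Xn \<union> Xp \<and> v \<in> Z x) else v)"

definition E' :: "'a \<Rightarrow> 'a \<Rightarrow> bool" where
  "E' p q \<longleftrightarrow> p \<noteq> q \<and> (\<exists>a b. E a b \<and> rep a = p \<and> rep b = q)"

definition ordinary :: "'a \<Rightarrow> bool" where
  "ordinary v \<longleftrightarrow> v \<in> V \<and> (\<forall>x\<in>Xn \<union> Xp. v \<notin> Z x)"

lemma Z_unique: "x \<in> Xn \<union> Xp \<Longrightarrow> y \<in> Xn \<union> Xp \<Longrightarrow> v \<in> Z x \<Longrightarrow> v \<in> Z y \<Longrightarrow> x = y"
  using Z_disj[of x y] unfolding Z_def by blast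

lemma rep_Z: assumes "x \<in> Xn \<union> Xp" "v \<in> Z x" shows "rep v = x"
proof -
  have "\<exists>x. x \<in> Xn \<union> Xp \<and> v \<in> Z x" using assms by blast
  from someI_ex[OF this] have "rep v \<in> Xn \<union> Xp \<and> v \<in> Z (rep v)"
    unfolding rep_def using assms by auto
  then show ?thesis using Z_unique assms by blast
qed

lemma rep_ordinary: "ordinary v \<Longrightarrow> rep v = v"
  by (auto simp: rep_def ordinary_def)

lemma self_Z: "x \<in> Z x"
  by (simp add: Z_def)

lemma rep_cases:
  assumes "v \<in> V"
  obtains x where "x \<in> Xn \<union> Xp" "v \<in> Z x" "rep v = x" | "ordinary v" "rep v = v"
  using assms rep_Z rep_ordinary unfolding ordinary_def by blast

lemma rep_eq_X: "v \<in> V \<Longrightarrow> x \<in> Xn \<union> Xp \<Longrightarrow> rep v = x \<Longrightarrow> v \<in> Z x"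
  by (erule rep_cases) (use self_Z in \<open>auto simp: ordinary_def\<close>)

lemma rep_eq_ordinary: "v \<in> V \<Longrightarrow> ordinary p \<Longrightarrow> rep v = p \<Longrightarrow> v = p"
  by (erule rep_cases) (use self_Z in \<open>auto simp: ordinary_def\<close>)

lemma V'_cases:
  assumes "p \<in> rep ` V" obtains "p \<in> Xn \<union> Xp" | "ordinary p"
  using assms by (auto elim: rep_cases)

lemma E'_ordinary:
  assumes "ordinary p" "ordinary q"
  shows "E' p q \<longleftrightarrow> E p q"
proof
  assume "E' p q"
  then obtain a b where ab: "E a b" "rep a = p" "rep b = q" by (auto simp: E'_def)
  then have "a = p" "b = q" using rep_eq_ordinary assms E_V by blast+
  then show "E p q" using ab by simp
next
  assume "E p q"
  then show "E' p q" using rep_ordinary assms irr by (auto simp: E'_def)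
qed

lemma E'_sym: "E' p q \<Longrightarrow> E' q p"
  using sym unfolding E'_def by blast

lemma Xn_Z: "x \<in> Xn \<Longrightarrow> Z x = insert x (N x)"
  using X_disj by (auto simp: Z_def)

lemma Xp_Z: "x \<in> Xp \<Longrightarrow> Z x = insert x (N x) \<union> Cf x"
  by (auto simp: Z_def)

text \<open>By \<open>far\<close> no edge joins two stars of \<open>Xn\<close>, and
  \<open>zone\<close> keeps the contracted cycles away from them. So a contracted star is adjacent
  to uncontracted vertices only, which lie at distance two from its centre.\<close>

lemma E'_high:
  assumes p: "p \<in> rep ` V" and y: "y \<in> Xn" and E: "E' p y"
  shows "ordinary p \<and> p \<in> N2 y"
proof -
  obtain a b where ab: "E a b" "rep a = p" "rep b = y" "p \<noteq> y" using E by (auto simp: E'_def)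
  have V: "a \<in> V" "b \<in> V" using ab E_V by blast+
  have b: "b \<in> insert y (N y)" using rep_eq_X[OF V(2), of y] ab y Xn_Z[OF y] by blast
  show ?thesis
  proof (cases rule: rep_cases[OF V(1)])
    case (1 x)
    show ?thesis
    proof (cases "x \<in> Xn")
      case True
      then show ?thesis using far[OF True y] ab b 1 Xn_Z[OF True] by auto
    next
      case False
      then have x: "x \<in> Xp" using 1 by blast
      have "a \<in> ball 0 (Z x)" using 1 by simp
      then have "b \<in> ball 1 (Z x)" using ball_step[of a 0] ab by simp
      moreover have "y \<in> ball 2 (Z x)"
      proof (cases "b = y")
        case True then show ?thesis using \<open>b \<in> ball 1 (Z x)\<close> ball_le[of 1 2 "Z x"] by auto
      next
        case False
        then have "E b y" using b sym by (auto simp: in_N)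
        then show ?thesis using ball_step[of b 1 "Z x" y] \<open>b \<in> ball 1 (Z x)\<close> by (simp add: numeral_2_eq_2)
      qed
      then have "y \<in> ball 3 (Z x)" using ball_le[of 2 3 "Z x"] by auto
      then show ?thesis using zone[OF x y] Xp_Z[OF x] by simp
    qed
  next
    case 2
    then have p: "ordinary p" "a = p" using ab by auto
    have "p \<notin> Z y" using p y by (auto simp: ordinary_def)
    then have "p \<notin> N y" "p \<noteq> y" by (auto simp: Z_def)
    then have "b \<noteq> y" using ab p sym by (auto simp: in_N)
    then have "E y b" using b by (auto simp: in_N)
    then show ?thesis using p ab sym \<open>p \<noteq> y\<close> by (auto simp: in_N2)
  qed
qed

lemma E'_high_iff:
  assumes "ordinary p" "y \<in> Xn"
  shows "E' p y \<longleftrightarrow> p \<in> N2 y"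
proof
  assume "E' p y"
  then show "p \<in> N2 y" using E'_high[of p y] assms rep_ordinary[OF assms(1)]
    by (metis image_eqI ordinary_def)
next
  assume "p \<in> N2 y"
  then obtain u where u: "E y u" "E u p" by (auto simp: in_N2)
  have "rep u = y" using rep_Z[of y u] u assms(2) by (auto simp: Z_def in_N)
  moreover have "p \<noteq> y" using assms self_Z by (auto simp: ordinary_def)
  ultimately show "E' p y" using u sym rep_ordinary[OF assms(1)] unfolding E'_def by blast
qed

lemma nbs_E'_X:
  assumes "x \<in> Xn \<union> Xp"
  shows "nbs E' (rep ` V) x \<subseteq> rep ` ((\<Union>v\<in>Z x. N v) - Z x)"
proof
  fix q assume "q \<in> nbs E' (rep ` V) x"
  then obtain a b where ab: "E a b" "rep a = x" "rep b = q" "x \<noteq> q" by (auto simp: nbs_def E'_def)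
  then have "a \<in> Z x" using rep_eq_X[of a x] assms E_V by blast
  moreover have "b \<notin> Z x" using rep_Z[of x b] assms ab by auto
  ultimately show "q \<in> rep ` ((\<Union>v\<in>Z x. N v) - Z x)" using ab by (force simp: in_N)
qed

lemma nbs_E'_ordinary: assumes "ordinary p" shows "nbs E' (rep ` V) p \<subseteq> rep ` N p"
proof
  fix q assume "q \<in> nbs E' (rep ` V) p"
  then obtain a b where ab: "E a b" "rep a = p" "rep b = q" by (auto simp: nbs_def E'_def)
  then have "a = p" using rep_eq_ordinary assms E_V by blast
  then show "q \<in> rep ` N p" using ab by (auto simp: in_N)
qed

lemma card_nbs_ordinary: assumes "ordinary p" shows "card (nbs E' (rep ` V) p) \<le> 3"
proof -
  have "card (nbs E' (rep ` V) p) \<le> card (rep ` N p)"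
    by (intro card_mono nbs_E'_ordinary assms) auto
  also have "\<dots> \<le> card (N p)" by (rule card_image_le) simp
  finally show ?thesis using card_N[of p] by linarith
qed

lemma fin_Z: "finite (Z x)"
  using pure[of x] by (auto simp: Z_def odd_cyc_off_def ind_cyc_def)

lemma card_nbs_X:
  assumes "x \<in> Xn \<union> Xp"
  shows "card (nbs E' (rep ` V) x) \<le> card ((\<Union>v\<in>Z x. N v) - Z x)"
proof -
  have fin: "finite ((\<Union>v\<in>Z x. N v) - Z x)" using fin_Z by auto
  have "card (nbs E' (rep ` V) x) \<le> card (rep ` ((\<Union>v\<in>Z x. N v) - Z x))"
    by (intro card_mono nbs_E'_X assms finite_imageI fin)
  also have "\<dots> \<le> card ((\<Union>v\<in>Z x. N v) - Z x)" by (rule card_image_le[OF fin])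
  finally show ?thesis .
qed

lemma card_nbs_Xn: assumes "y \<in> Xn" shows "card (nbs E' (rep ` V) y) \<le> 6"
proof -
  have "(\<Union>v\<in>Z y. N v) - Z y \<subseteq> N2 y"
  proof
    fix w assume "w \<in> (\<Union>v\<in>Z y. N v) - Z y"
    then obtain v where "v \<in> Z y" "w \<in> N v" "w \<notin> Z y" by blast
    then have v: "v = y \<or> E y v" "E v w" and w: "w \<noteq> y" "\<not> E y w"
      using Xn_Z[OF assms] by (simp_all add: in_N)
    then have "E y v" by blast
    then show "w \<in> N2 y" using v w by (auto simp: in_N2)
  qed
  then have "card ((\<Union>v\<in>Z y. N v) - Z y) \<le> card (N2 y)" by (intro card_mono) auto
  moreover have "card (nbs E' (rep ` V) y) \<le> card ((\<Union>v\<in>Z y. N v) - Z y)"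
    using assms by (intro card_nbs_X) simp
  ultimately show ?thesis using card_N2[of y] by linarith
qed

lemma card_nbs_Xp:
  assumes "x \<in> Xp"
  shows "card (nbs E' (rep ` V) x) + card (Cf x \<inter> N2 x) \<le> 7" "4 \<le> card (Cf x \<inter> N2 x)"
    "card (Z x) \<le> 5 + card (Cf x \<inter> N2 x)"
proof -
  have C: "odd_cyc_off x (Cf x)" "card (Cf x - N2 x) \<le> 1" using pure[OF assms] by auto
  show "4 \<le> card (Cf x \<inter> N2 x)" "card (Z x) \<le> 5 + card (Cf x \<inter> N2 x)"
    using pure_outside(2,3)[OF C] Xp_Z[OF assms] by simp_all
  have "card (nbs E' (rep ` V) x) \<le> card ((\<Union>v\<in>Z x. N v) - Z x)"
    using assms by (intro card_nbs_X) simp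
  then show "card (nbs E' (rep ` V) x) + card (Cf x \<inter> N2 x) \<le> 7"
    using pure_outside(1)[OF C] Xp_Z[OF assms] by simp
qed

lemma ind_cyc_ordinary:
  assumes C: "ind_cyc E' C" and ord: "\<And>v. v \<in> C \<Longrightarrow> ordinary v"
  shows "ind_cyc E C"
proof -
  have nbs: "nbs E C v = nbs E' C v" if "v \<in> C" for v
    using E'_ordinary ord that by (auto simp: nbs_def)
  have "conn E C"
    unfolding conn_def
  proof (intro allI impI)
    fix T assume T: "T \<subseteq> C" "T \<noteq> {}" "T \<noteq> C"
    then obtain v u where "v \<in> T" "u \<in> C - T" "E' v u"
      using C conn_boundary[of E' C T] unfolding ind_cyc_def by blast
    then show "\<exists>v\<in>T. \<exists>u\<in>C - T. E v u" using E'_ordinary ord T by blast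
  qed
  then show ?thesis using C nbs by (auto simp: ind_cyc_def)
qed

text \<open>With at most one contracted vertex \<open>S\<close> would contain a triangle of the
  original graph. Otherwise all four vertices have their three neighbours in \<open>S\<close>, so by
  connectedness they are the whole contracted graph. Each comes from at most nine vertices, and 4 *
  9 = 36 contradicts \<open>large\<close>.\<close>

lemma no_K4':
  assumes S: "S \<subseteq> rep ` V - Xn" "card S = 4"
  shows "\<exists>u\<in>S. \<exists>v\<in>S. u \<noteq> v \<and> \<not> E' u v"
proof (rule ccontr)
  assume "\<not> ?thesis"
  then have K: "E' u v" if "u \<in> S" "v \<in> S" "u \<noteq> v" for u v using that by blast
  have finS: "finite S" using S(2) card.infinite by fastforce
  have ord: "ordinary v" if "v \<in> S" "v \<notin> Xp" for v using S that V'_cases[of v] by blast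
  show False
  proof (cases "\<exists>x y. x \<in> S \<inter> Xp \<and> y \<in> S \<inter> Xp \<and> x \<noteq> y")
    case False
    then have "card (S \<inter> Xp) \<le> 1" using finS by (auto simp: card_le_Suc0_iff_eq)
    moreover have "card S = card (S \<inter> Xp) + card (S - Xp)" using finS by (metis card_Int_Diff)
    ultimately have "3 \<le> card (S - Xp)" using S(2) by linarith
    then obtain T where "T \<subseteq> S - Xp" "card T = 3" using obtain_subset_with_card_n by metis
    then obtain a b d where T: "a \<in> S - Xp" "b \<in> S - Xp" "d \<in> S - Xp" "a \<noteq> b" "b \<noteq> d" "d \<noteq> a"
      by (auto simp: card_3_iff)
    have EE: "E p q" if "p \<in> S - Xp" "q \<in> S - Xp" "p \<noteq> q" for p q
      using K[of p q] E'_ordinary[of p q] ord that by blast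
    have "E a b" "E b d" "E d a" using EE T by blast+
    then show False using tri by blast
  next
    case True
    then obtain x y where "x \<in> Xp" "y \<in> Xp" "x \<noteq> y" by blast
    then have big: "36 < card V" by (rule large)
    define U where "U = {v \<in> V. rep v \<in> S}"
    have low: "card (nbs E' (rep ` V) p) \<le> 3" if "p \<in> S" for p
    proof (cases "p \<in> Xp")
      case True then show ?thesis using card_nbs_Xp(1,2)[OF True] by linarith
    next
      case False then show ?thesis using card_nbs_ordinary ord that by blast
    qed
    have nb: "nbs E' (rep ` V) p = S - {p}" if "p \<in> S" for p
    proof -
      have "S - {p} \<subseteq> nbs E' (rep ` V) p" using K[OF that] S(1) by (auto simp: nbs_def)
      then show ?thesis
        using low[OF that] finS that S(2) fin by (intro card_seteq[symmetric]) auto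
    qed
    have closed: "v \<in> U" if "u \<in> U" "E u v" for u v
    proof (cases "rep u = rep v")
      case True then show ?thesis using that E_V by (auto simp: U_def)
    next
      case False
      then have "rep v \<in> nbs E' (rep ` V) (rep u)" using that E_V by (auto simp: nbs_def E'_def)
      then show ?thesis using nb[of "rep u"] that E_V by (auto simp: U_def)
    qed
    obtain p where "p \<in> S" using S(2) by fastforce
    then obtain v where v: "v \<in> V" "p = rep v" using S(1) by blast
    have "U = V"
    proof (rule ccontr)
      assume "U \<noteq> V"
      moreover have "U \<subseteq> V" "U \<noteq> {}" using v \<open>p \<in> S\<close> by (auto simp: U_def)
      ultimately obtain a b where "a \<in> U" "b \<in> V - U" "E a b"
        using conn_boundary[OF connV, of U] by blast
      then show False using closed by blast
    qed
    \<comment> \<open>Three outer neighbours leave at most 7 - 3 = 4 cycle vertices in the second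
      neighbourhood, so \<open>Z p\<close> has at most 5 + 4 vertices.\<close>
    have fib: "card {v \<in> V. rep v = p} \<le> 9" if "p \<in> S" for p
    proof (cases "p \<in> Xp")
      case True
      have "card (S - {p}) = 3" using that S(2) finS by simp
      then have "card (Z p) \<le> 9" using card_nbs_Xp[OF True] nb[OF that] by simp
      moreover have "card {v \<in> V. rep v = p} \<le> card (Z p)"
        using True rep_eq_X fin_Z by (intro card_mono) auto
      ultimately show ?thesis by linarith
    next
      case False
      then have "{v \<in> V. rep v = p} \<subseteq> {p}" using rep_eq_ordinary ord that by blast
      then have "card {v \<in> V. rep v = p} \<le> card {p}" by (intro card_mono) auto
      then show ?thesis by simp
    qed
    have "V \<subseteq> (\<Union>p\<in>S. {v \<in> V. rep v = p})" using \<open>U = V\<close> by (auto simp: U_def)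
    then have "card V \<le> card (\<Union>p\<in>S. {v \<in> V. rep v = p})"
      using finS fin by (intro card_mono) auto
    also have "\<dots> \<le> 9 * card S" by (rule card_UN_bound[OF finS fib])
    finally show False using big S(2) by simp
  qed
qed

text \<open>Such a cycle turns out to be an odd cycle of the original graph. At least three of its
  vertices lie off \<open>N2 f\<close>: if only two did, one of them would have another owner, which
  by \<open>heavy\<close> ranks below \<open>f\<close>. At most one of the three is without
  owner.\<close>

lemma slots_bound:
  assumes CV: "C \<subseteq> rep ` V - Xn" and C: "ind_cyc E' C" "odd (card C)"
    and leaf: "card {v \<in> C. nbs E' Xn v = {}} \<le> 1" and f: "f \<in> Xn"
    and min: "\<And>y v. y \<in> Xn \<Longrightarrow> v \<in> C \<Longrightarrow> E' v y \<Longrightarrow> \<sigma> f \<le> \<sigma> y"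
  shows "2 \<le> card {v \<in> C. \<exists>y\<in>Xn. E' v y \<and> y \<noteq> f} \<and>
    ((\<forall>v\<in>C. nbs E' Xn v \<noteq> {}) \<longrightarrow> 3 \<le> card {v \<in> C. \<exists>y\<in>Xn. E' v y \<and> y \<noteq> f})"
proof -
  let ?ns = "{v \<in> C. nbs E' Xn v = {}}"
  have finC: "finite C" using C by (simp add: ind_cyc_def)
  have high: "ordinary v \<and> v \<in> N2 y" if "v \<in> C" "y \<in> Xn" "E' v y" for v y
    using E'_high[of v y] that CV by blast
  \<comment> \<open>A contracted cycle has no owner, so it is the one exception that a leaf cycle
    admits. Its neighbour a on C then has an owner y, which lies within distance three of the
    contracted set, against \<open>zone\<close>.\<close>
  have noXp: "x \<notin> Xp" if x: "x \<in> C" for x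
  proof
    assume xp: "x \<in> Xp"
    then have "\<not> ordinary x" using self_Z by (auto simp: ordinary_def)
    then have xns: "x \<in> ?ns" using high[OF x] x by (auto simp: nbs_def)
    have "card (nbs E' C x) = 2" using C x by (simp add: ind_cyc_def)
    then obtain a where a: "a \<in> C" "E' x a" by (fastforce simp: nbs_def card_2_iff)
    then have "a \<noteq> x" by (auto simp: E'_def)
    then have "a \<notin> ?ns" using leaf xns finC by (auto simp: card_le_Suc0_iff_eq)
    then obtain y where y: "y \<in> Xn" "E' a y" using a by (auto simp: nbs_def)
    then have oa: "ordinary a" "a \<in> N2 y" using high a by blast+
    obtain b where b: "b \<in> Z x" "E b a"
    proof -
      obtain p q where pq: "E p q" "rep p = x" "rep q = a" using a by (auto simp: E'_def)
      then have "q = a" "p \<in> Z x" using rep_eq_ordinary oa rep_eq_X xp E_V by blast+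
      then show thesis using that pq by blast
    qed
    obtain u where u: "E y u" "E u a" using oa by (auto simp: in_N2)
    have "b \<in> ball 0 (Z x)" using b by simp
    then have "a \<in> ball (Suc 0) (Z x)" using ball_step b by blast
    then have "u \<in> ball (Suc (Suc 0)) (Z x)" using ball_step u sym by blast
    then have "y \<in> ball (Suc (Suc (Suc 0))) (Z x)" using ball_step u sym by blast
    then show False using zone[OF xp y(1)] Xp_Z[OF xp] by (simp add: numeral_3_eq_3)
  qed
  have ord: "ordinary v" if "v \<in> C" for v using V'_cases[of v] that CV noXp by blast
  have slot: "E' v y \<longleftrightarrow> v \<in> N2 y" if "v \<in> C" "y \<in> Xn" for v y
    using E'_high_iff ord that by blast
  have cyc: "ind_cyc E C" using ind_cyc_ordinary[OF C(1)] ord by blast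
  have offZ: "C \<inter> insert x (N x) = {}" if "x \<in> Xn" for x
    using ord that Xn_Z[OF that] by (auto simp: ordinary_def)
  have off: "odd_cyc_off f C"
    using cyc C(2) offZ[OF f] ord by (auto simp: odd_cyc_off_def ordinary_def)
  have sub: "(C - N2 f) - ?ns \<subseteq> {v \<in> C. \<exists>y\<in>Xn. E' v y \<and> y \<noteq> f}"
    using slot f by (auto simp: nbs_def)
  have three: "3 \<le> card (C - N2 f)"
  proof (rule ccontr)
    assume "\<not> ?thesis"
    then have two: "card (C - N2 f) = 2" using not_pure[OF f off] by linarith
    have "\<not> C - N2 f \<subseteq> ?ns"
    proof
      assume "C - N2 f \<subseteq> ?ns"
      then have "card (C - N2 f) \<le> card ?ns" using finC by (intro card_mono) auto
      then show False using two leaf by simp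
    qed
    then obtain a y where a: "a \<in> C" "a \<notin> N2 f" "y \<in> Xn" "E' a y" by (auto simp: nbs_def)
    have "y \<noteq> f" using a slot f by blast
    then have "\<sigma> y < \<sigma> f" using heavy[OF f off _ a(1,2,3)] two slot[OF a(1,3)] a(4) offZ[OF a(3)] by simp
    then show False using min[OF a(3,1,4)] by simp
  qed
  have fin': "finite {v \<in> C. \<exists>y\<in>Xn. E' v y \<and> y \<noteq> f}" using finC by simp
  have "card (C - N2 f) - card ?ns \<le> card ((C - N2 f) - ?ns)"
    using finC by (intro diff_card_le_card_Diff) auto
  then have "card (C - N2 f) \<le> card {v \<in> C. \<exists>y\<in>Xn. E' v y \<and> y \<noteq> f} + card ?ns"
    using card_mono[OF fin' sub] by linarith
  moreover have "card ?ns = 0" if "\<forall>v\<in>C. nbs E' Xn v \<noteq> {}"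
  proof -
    have "?ns = {}" using that by blast
    then show ?thesis by (metis card.empty)
  qed
  ultimately have le: "card (C - N2 f) \<le> card {v \<in> C. \<exists>y\<in>Xn. E' v y \<and> y \<noteq> f} + card ?ns"
    and ns: "\<forall>v\<in>C. nbs E' Xn v \<noteq> {} \<Longrightarrow> card ?ns = 0" by blast+
  show ?thesis
  proof (intro conjI impI)
    show "2 \<le> card {v \<in> C. \<exists>y\<in>Xn. E' v y \<and> y \<noteq> f}" using le three leaf by linarith
    show "3 \<le> card {v \<in> C. \<exists>y\<in>Xn. E' v y \<and> y \<noteq> f}" if "\<forall>v\<in>C. nbs E' Xn v \<noteq> {}"
      using le three ns[OF that] by linarith
  qed
qed

lemma high_low': "high_low E' (rep ` V) Xn w0"
proof (unfold_locales, goal_cases)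
  case 1 then show ?case by (rule E'_sym)
next
  case 2 then show ?case by (simp add: E'_def)
next
  case 3 then show ?case using fin by simp
next
  case 4
  have "rep x = x" if "x \<in> Xn" for x using rep_Z[of x x] that self_Z by simp
  then show ?case using X_V by force
next
  case (5 v)
  then consider "v \<in> Xp" | "ordinary v" using V'_cases[of v] by blast
  then show ?case
  proof cases
    case 1 then show ?thesis using card_nbs_Xp(1,2)[OF 1] by linarith
  next
    case 2 then show ?thesis by (rule card_nbs_ordinary)
  qed
next
  case (6 y) then show ?case by (rule card_nbs_Xn)
next
  case (7 y z)
  have "rep y = y" using rep_Z[of y y] 7 self_Z by simp
  then have "y \<in> rep ` V" using 7 X_V by (metis UnCI image_eqI subsetD)
  moreover have "\<not> ordinary y" using 7 self_Z by (auto simp: ordinary_def)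
  ultimately show ?case using E'_high[of y z] 7 by blast
next
  case (8 v)
  have "y = z" if "y \<in> nbs E' Xn v" "z \<in> nbs E' Xn v" for y z
    using E'_high[of v y] E'_high[of v z] that 8 sing[of v y z] by (auto simp: nbs_def)
  moreover have "finite (nbs E' Xn v)" using X_V fin finite_subset by fastforce
  ultimately show ?case by (auto simp: card_le_Suc0_iff_eq)
next
  case 9
  have fX: "finite {y \<in> Xn. w0 \<in> N2 y}" using X_V fin finite_subset[of Xn V] by auto
  have "y \<in> {y \<in> Xn. w0 \<in> N2 y}" if "y \<in> nbs E' Xn w0" for y
  proof -
    have "E' w0 y" "y \<in> Xn" using that by (auto simp: nbs_def)
    moreover have "w0 \<in> rep ` V" using \<open>E' w0 y\<close> E_V by (auto simp: E'_def)
    ultimately show ?thesis using E'_high[of w0 y] by blast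
  qed
  then have "card (nbs E' Xn w0) \<le> card {y \<in> Xn. w0 \<in> N2 y}" using fX by (intro card_mono) auto
  then show ?case using doub by linarith
next
  case (10 S) then show ?case by (rule no_K4')
qed

lemma contracted_coloring:
  "\<exists>c. proper_on E' (rep ` V) c \<and> (\<forall>v\<in>rep ` V. c v < (3::nat))"
proof -
  interpret H: high_low E' "rep ` V" Xn w0 by (rule high_low')
  show ?thesis
  proof (rule H.three_colorable[OF inj])
    fix C f
    assume "C \<subseteq> rep ` V - Xn" "H.leaf_cyc C" "f \<in> Xn"
      "\<And>y v. y \<in> Xn \<Longrightarrow> v \<in> C \<Longrightarrow> E' v y \<Longrightarrow> \<sigma> f \<le> \<sigma> y"
    then show "2 \<le> card {v \<in> C. \<exists>y\<in>Xn. E' v y \<and> y \<noteq> f} \<and>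
      ((\<forall>v\<in>C. nbs E' Xn v \<noteq> {}) \<longrightarrow> 3 \<le> card {v \<in> C. \<exists>y\<in>Xn. E' v y \<and> y \<noteq> f})"
      by (intro slots_bound) (auto simp: H.leaf_cyc_def)
  qed
qed

text \<open>All vertices of the contracted cycle except the one outside the second neighbourhood;
  the latter is not adjacent to \<open>N x\<close> and may share the colour of the neighbours of
  \<open>x\<close>.\<close>

definition inner :: "'a \<Rightarrow> 'a set" where
  "inner x = (if x \<in> Xp then Cf x \<inter> N2 x else {})"

text \<open>The neighbours of a contracted vertex share one colour, which leaves two colours to the centre
  and an alternating colouring to the rest of a contracted cycle.\<close>

theorem run_exists: "\<exists>D. run D \<and> (\<forall>x\<in>Xn \<union> Xp. 2 \<le> card (D x))"
proof -
  obtain c where c: "proper_on E' (rep ` V) c" "\<And>v. v \<in> rep ` V \<Longrightarrow> c v < (3::nat)"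
    using contracted_coloring by blast
  have repX: "rep x = x" if "x \<in> Xn \<union> Xp" for x using rep_Z[of x x] that self_Z by blast
  have c3: "c x < 3" if "x \<in> Xn \<union> Xp" for x
    using c(2)[of x] repX[OF that] X_V that by (metis image_eqI subsetD)
  have "\<exists>d. list_col E (inner x) (\<lambda>_. {..<3} - {c x}) d" if x: "x \<in> Xn \<union> Xp" for x
  proof (cases "x \<in> Xp")
    case False
    then show ?thesis by (auto simp: inner_def list_col_def proper_on_def)
  next
    case True
    then have C: "ind_cyc E (Cf x)" "card (Cf x - N2 x) = 1" using pure by (auto simp: odd_cyc_off_def)
    \<comment> \<open>One vertex of the cycle is left out, so two colours suffice although the cycle
      is odd.\<close>
    then have "Cf x - N2 x \<noteq> {}" by (metis card.empty zero_neq_one)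
    then have "Cf x \<inter> N2 x \<noteq> Cf x" by blast
    then have "\<exists>d. list_col E (Cf x \<inter> N2 x) (\<lambda>_. {..<3} - {c x}) d"
      using C(1) c3[OF x] by (intro list_col_proper_subset[of "Cf x"]) (auto simp: ind_cyc_def)
    then show ?thesis using True by (simp add: inner_def)
  qed
  then obtain d where d: "\<And>x. x \<in> Xn \<union> Xp \<Longrightarrow> list_col E (inner x) (\<lambda>_. {..<3} - {c x}) (d x)"
    by metis
  define D where "D v = (if v \<in> Xn \<union> Xp then {..<3} - {c v}
      else if v \<in> inner (rep v) \<and> rep v \<in> Xn \<union> Xp then {d (rep v) v} else {c (rep v)})" for v
  have Xp_inner: "x \<in> Xp \<Longrightarrow> v \<in> inner x \<Longrightarrow> v \<in> Cf x \<and> v \<in> N2 x \<and> odd_cyc_off x (Cf x)" for x v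
    using pure by (auto simp: inner_def)
  have innerZ: "inner x \<subseteq> Z x" for x by (auto simp: inner_def Z_def)
  \<comment> \<open>All neighbours of an inner vertex lie in \<open>Z x\<close>, so its colour,
    which differs from that of the contracted vertex, meets no conflict outside.\<close>
  have inner_nbs: "N v \<subseteq> Z x" if "x \<in> Xn \<union> Xp" "v \<in> inner x" for x v
  proof -
    have "x \<in> Xp" using that by (auto simp: inner_def split: if_splits)
    then show ?thesis using Xp_inner that cyc_N2_nbs[of x "Cf x" v] by (auto simp: Z_def)
  qed
  have X_notin_N: "v \<notin> Xn \<union> Xp" if "x \<in> Xn \<union> Xp" "v \<in> Z x" "v \<noteq> x" for v x
    using Z_unique[of x v v] self_Z that by blast
  have val: "(v = x \<and> D v = {..<3} - {c x}) \<or> (v \<in> inner x \<and> D v = {d x v} \<and> d x v \<in> {..<3} - {c x}) \<or>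
      (v \<in> Z x \<and> v \<noteq> x \<and> v \<notin> inner x \<and> D v = {c x})" if xv: "x \<in> Xn \<union> Xp" "v \<in> Z x" for v x
  proof (cases "v = x")
    case True
    then show ?thesis using xv(1) by (simp add: D_def)
  next
    case False
    have nX: "v \<notin> Xn \<union> Xp" and r: "rep v = x" using X_notin_N[OF xv False] rep_Z[OF xv] by blast+
    show ?thesis
    proof (cases "v \<in> inner x")
      case True
      then have "d x v \<in> {..<3} - {c x}" using d[OF xv(1)] unfolding list_col_def by blast
      moreover have "D v = {d x v}" unfolding D_def r using nX True xv(1) by simp
      ultimately show ?thesis using True by blast
    next
      case out: False
      have "D v = {c x}" unfolding D_def r using nX out by simp
      then show ?thesis using False out xv by blast
    qed
  qed
  have Dord: "D v = {c v}" if "ordinary v" for v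
  proof -
    have "v \<notin> Xn \<union> Xp" using that self_Z by (auto simp: ordinary_def)
    then show ?thesis unfolding D_def rep_ordinary[OF that] by simp
  qed
  \<comment> \<open>The vertices that share the colour c x are independent: the neighbours of x by
    triangle-freeness, and the only cycle vertex concerned is not adjacent to them.\<close>
  have outer: "\<not> E u v" if x: "x \<in> Xn \<union> Xp" "u \<in> Z x" "v \<in> Z x" "u \<noteq> x" "v \<noteq> x"
    "u \<notin> inner x" "v \<notin> inner x" for u v x
  proof
    assume E: "E u v"
    have cl: "w \<in> N x \<or> (x \<in> Xp \<and> w \<in> Cf x - N2 x)" if "w \<in> Z x" "w \<noteq> x" "w \<notin> inner x" for w
      using that by (auto simp: Z_def inner_def split: if_splits)
    have NN: False if "E a b" "a \<in> N x" "b \<in> N x" for a b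
      using tri[of x a b] that sym[of x b] by (simp add: in_N)
    have NC: False if "E a b" "a \<in> N x" "x \<in> Xp" "b \<in> Cf x - N2 x" for a b
    proof -
      have "b \<noteq> x" using that pure[OF that(3)] by (auto simp: odd_cyc_off_def)
      then have "b \<in> N2 x" using that by (auto simp: in_N in_N2)
      then show False using that by blast
    qed
    have CC: False if "x \<in> Xp" "u \<in> Cf x - N2 x" "v \<in> Cf x - N2 x"
    proof -
      have "card (Cf x - N2 x) = 1" using pure[OF that(1)] by blast
      then obtain q where "Cf x - N2 x = {q}" by (rule card_1_singletonE)
      then have "u = v" using that by simp
      then show False using E irr by blast
    qed
    show False
      using cl[OF x(2,4,6)] cl[OF x(3,5,7)] E sym[OF E] NN NC CC by blast
  qed
  have disj: "D u \<inter> D v = {}" if E: "E u v" for u v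
  proof -
    have V: "u \<in> V" "v \<in> V" using E E_V by blast+
    have same: "D u \<inter> D v = {}" if x: "x \<in> Xn \<union> Xp" "u \<in> Z x" "v \<in> Z x" for x
    proof -
      have ins: False if "a \<in> inner x" "E a x" for a
      proof -
        have "a \<in> N2 x" using that(1) by (auto simp: inner_def split: if_splits)
        moreover have "a \<in> N x" using sym[OF that(2)] by (simp add: in_N)
        ultimately show False using N_N2_disjoint by blast
      qed
      have dd: "d x u \<noteq> d x v" if "u \<in> inner x" "v \<in> inner x"
        using d[OF x(1)] that E unfolding list_col_def proper_on_def by blast
      show ?thesis
      proof (cases "u = x")
        case True
        then have "v \<noteq> x" "v \<notin> inner x" using E irr ins[of v] sym[OF E] by blast+
        then show ?thesis using val[OF x(1,2)] val[OF x(1,3)] True by auto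
      next
        case u: False
        show ?thesis
        proof (cases "v = x")
          case True
          then have "u \<notin> inner x" using E ins[of u] by blast
          then show ?thesis using val[OF x(1,2)] val[OF x(1,3)] True u by auto
        next
          case v: False
          have "u \<in> inner x \<or> v \<in> inner x" using outer[OF x u v] E by blast
          then show ?thesis using val[OF x(1,2)] val[OF x(1,3)] dd u v by auto
        qed
      qed
    qed
    have other: "v \<notin> inner (rep v) \<and> v \<notin> Xn \<union> Xp" if "rep u \<noteq> rep v" "v \<in> Z x" "x \<in> Xn \<union> Xp" "E u v" for u v x
    proof -
      have r: "rep v = x" using rep_Z that by blast
      have "u \<notin> Z x" using rep_Z[of x u] r that by auto
      have "u \<in> N v" using sym[OF that(4)] by (simp add: in_N)
      then have "v \<notin> inner x" using inner_nbs[of x v] that(3) \<open>u \<notin> Z x\<close> by blast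
      moreover have "v \<noteq> x" using \<open>u \<notin> Z x\<close> \<open>u \<in> N v\<close> by (auto simp: Z_def)
      ultimately show ?thesis using r X_notin_N[OF that(3,2)] by simp
    qed
    have Drep: "D v = {c (rep v)}" if "rep u \<noteq> rep v" "E u v" for u v
    proof -
      have "v \<in> V" using that E_V by blast
      then show ?thesis
      proof (cases rule: rep_cases)
        case (1 x) then show ?thesis using other[OF that(1) 1(2,1) that(2)] by (simp add: D_def)
      next
        case 2 then show ?thesis using Dord by simp
      qed
    qed
    show ?thesis
    proof (cases "rep u = rep v")
      case False
      then have "E' (rep u) (rep v)" using E by (auto simp: E'_def)
      then have "c (rep u) \<noteq> c (rep v)" using c(1) V unfolding proper_on_def by blast
      then show ?thesis using Drep[OF False E] Drep[of v u] False sym[OF E] by simp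
    next
      case True
      show ?thesis
      proof (cases rule: rep_cases[OF V(1)])
        case (1 x)
        then have "v \<in> Z x" using rep_eq_X[OF V(2), of x] True by simp
        then show ?thesis using same 1 by blast
      next
        case 2
        then have "u = v" using rep_eq_ordinary[OF V(2), of u] True by simp
        then show ?thesis using E irr by blast
      qed
    qed
  qed
  have two: "card ({..<3::nat} - {a}) \<ge> 2" for a
    using diff_card_le_card_Diff[of "{a}" "{..<3::nat}"] by simp
  have "D v \<subseteq> {..<3} \<and> D v \<noteq> {}" if v: "v \<in> V" for v
  proof (cases rule: rep_cases[OF v])
    case (1 x)
    have "{..<3::nat} - {c x} \<noteq> {}" using two[of "c x"] by (metis card.empty not_numeral_le_zero)
    then show ?thesis
      using val[OF 1(1,2)] c3[OF 1(1)] by (elim disjE conjE) simp_all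
  next
    case 2
    then have "c v < 3" using c(2)[of v] v by (metis image_eqI)
    then show ?thesis using Dord[OF 2(1)] by simp
  qed
  then have "run D" using disj by (simp add: run_def)
  moreover have "2 \<le> card (D x)" if "x \<in> Xn \<union> Xp" for x using two that by (simp add: D_def)
  ultimately show ?thesis by blast
qed

end

section \<open>Partition into classes\<close>

text \<open>Vertices are placed in increasing order of \<tau>. Later placements do not change the
  set of earlier members of a class, so what holds at a placement persists.\<close>

lemma greedy_classes:
  fixes \<tau> :: "'a \<Rightarrow> nat"
  assumes "finite V" "inj_on \<tau> V" and m: "0 < m"
    and step: "\<And>v c. v \<in> V \<Longrightarrow> (\<And>u. u \<in> V \<Longrightarrow> c u < m) \<Longrightarrow> \<exists>k<m. Q v {u \<in> V. \<tau> u < \<tau> v \<and> c u = k}"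
  shows "\<exists>\<kappa>. \<forall>v\<in>V. \<kappa> v < (m::nat) \<and> Q v {u \<in> V. \<tau> u < \<tau> v \<and> \<kappa> u = \<kappa> v}"
proof -
  have "\<exists>\<kappa>. (\<forall>v. \<kappa> v < m) \<and> (\<forall>v\<in>V. \<tau> v < n \<longrightarrow> Q v {u \<in> V. \<tau> u < \<tau> v \<and> \<kappa> u = \<kappa> v})" for n
  proof (induction n)
    case 0 then show ?case using m by (intro exI[of _ "\<lambda>_. 0"]) simp
  next
    case (Suc n)
    then obtain \<kappa> where k: "\<And>v. \<kappa> v < m"
      "\<And>v. v \<in> V \<Longrightarrow> \<tau> v < n \<Longrightarrow> Q v {u \<in> V. \<tau> u < \<tau> v \<and> \<kappa> u = \<kappa> v}" by blast
    show ?case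
    proof (cases "\<exists>v\<in>V. \<tau> v = n")
      case False
      have "Q v {u \<in> V. \<tau> u < \<tau> v \<and> \<kappa> u = \<kappa> v}" if "v \<in> V" "\<tau> v < Suc n" for v
      proof -
        have "\<tau> v \<noteq> n" using False that(1) by blast
        then have "\<tau> v < n" using that(2) by simp
        then show ?thesis using k(2) that(1) by blast
      qed
      then show ?thesis using k(1) by (intro exI[of _ \<kappa>]) simp
    next
      case True
      then obtain v where v: "v \<in> V" "\<tau> v = n" by blast
      obtain j where j: "j < m" "Q v {u \<in> V. \<tau> u < \<tau> v \<and> \<kappa> u = j}"
        using step[OF v(1), of \<kappa>] k(1) by blast
      have eq: "{u \<in> V. \<tau> u < \<tau> w \<and> (\<kappa>(v := j)) u = (\<kappa>(v := j)) w}
          = {u \<in> V. \<tau> u < \<tau> w \<and> \<kappa> u = (if w = v then j else \<kappa> w)}" if "\<tau> w \<le> n" for w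
        using that v by auto
      have "Q w {u \<in> V. \<tau> u < \<tau> w \<and> (\<kappa>(v := j)) u = (\<kappa>(v := j)) w}"
        if w: "w \<in> V" "\<tau> w < Suc n" for w
      proof (cases "w = v")
        case True then show ?thesis using j eq[of w] v by simp
      next
        case False
        then have "\<tau> w \<noteq> n" using assms(2) w v by (metis inj_onD)
        then have "\<tau> w < n" using w by simp
        then show ?thesis using k(2)[OF w(1)] eq[of w] False by simp
      qed
      then show ?thesis using k(1) j(1) by (intro exI[of _ "\<kappa>(v := j)"]) simp
    qed
  qed
  from this[of "Suc (Max (\<tau> ` V))"] obtain \<kappa> where "\<And>v. \<kappa> v < m"
    "\<And>v. v \<in> V \<Longrightarrow> \<tau> v < Suc (Max (\<tau> ` V)) \<Longrightarrow> Q v {u \<in> V. \<tau> u < \<tau> v \<and> \<kappa> u = \<kappa> v}" by blast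
  moreover have "\<tau> v < Suc (Max (\<tau> ` V))" if "v \<in> V" for v
    using assms(1) that by (simp add: less_Suc_eq_le)
  ultimately show ?thesis by blast
qed

lemma free_class:
  assumes "finite A" "card A < m"
  shows "\<exists>k<m. \<forall>u\<in>A. c u \<noteq> (k::nat)"
proof (rule ccontr)
  assume "\<not> ?thesis"
  then have "{..<m} \<subseteq> c ` A" by force
  then have "card {..<m} \<le> card (c ` A)" using assms(1) by (intro card_mono) auto
  also have "\<dots> \<le> card A" using assms(1) by (rule card_image_le)
  finally show False using assms(2) by simp
qed

section \<open>Zones that the earlier members of a class have to avoid\<close>

context subcubic
begin

definition pure :: "'a \<Rightarrow> bool" where
  "pure x \<longleftrightarrow> (\<exists>C. odd_cyc_off x C \<and> card (C - N2 x) \<le> 1)"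

definition pure_cyc :: "'a \<Rightarrow> 'a set" where
  "pure_cyc x = (SOME C. odd_cyc_off x C \<and> card (C - N2 x) \<le> 1)"

text \<open>Of two cycle vertices off the second neighbourhood one may be without owner, which
  leaves a single slot not owned by \<open>x\<close>, one fewer than Hall's condition needs.\<close>

definition heavy :: "'a \<Rightarrow> bool" where
  "heavy x \<longleftrightarrow> \<not> pure x \<and> (\<exists>C. odd_cyc_off x C \<and> card (C - N2 x) \<le> 2)"

text \<open>The vertices at distance three; \<open>f\<close> does not occur, as it has no neighbour
  in \<open>N2 f\<close>.\<close>

definition L3 :: "'a \<Rightarrow> 'a set" where
  "L3 f = (\<Union>v\<in>N2 f. N v) - N f - N2 f"

text \<open>For \<open>a\<close> at distance three from \<open>f\<close>: the neighbours of
  \<open>a\<close> at distance four.\<close>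

definition L4 :: "'a \<Rightarrow> 'a \<Rightarrow> 'a set" where
  "L4 f a = N a - N2 f - L3 f"

text \<open>Distances one to four, and behind a vertex \<open>a\<close> at distance three with at
  most one neighbour further out also the next step. The cycle vertices in question are of this
  kind, and every \<open>a\<close> contributes at most three vertices, be it two or 1 + 2.\<close>

definition heavy_zone :: "'a \<Rightarrow> 'a set" where
  "heavy_zone f = N f \<union> N2 f \<union> L3 f \<union>
     (\<Union>a\<in>L3 f. L4 f a \<union> (if card (L4 f a) \<le> 1 then \<Union>u\<in>L4 f a. N u - {a} else {}))"

definition pure_zone :: "'a \<Rightarrow> 'a set" where
  "pure_zone x = ball 3 (insert x (N x) \<union> pure_cyc x)"

lemma pure_cyc: "pure x \<Longrightarrow> odd_cyc_off x (pure_cyc x) \<and> card (pure_cyc x - N2 x) \<le> 1"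
  unfolding pure_def pure_cyc_def by (rule someI_ex)

lemma fin_ball [simp]: "finite S \<Longrightarrow> finite (ball n S)"
  by (induction n) auto

lemma ball_Suc_growth:
  assumes "finite S" "\<And>u. card (N u) \<le> Suc k"
  shows "card (ball (Suc (Suc n)) S - ball (Suc n) S) \<le> k * card (ball (Suc n) S - ball n S)"
proof -
  have "ball (Suc (Suc n)) S - ball (Suc n) S
      \<subseteq> (\<Union>u\<in>ball (Suc n) S - ball n S. N u - ball (Suc n) S)"
  proof
    fix w assume w: "w \<in> ball (Suc (Suc n)) S - ball (Suc n) S"
    then obtain u where u: "u \<in> ball (Suc n) S" "w \<in> N u" by auto
    then have "u \<notin> ball n S" using w by auto
    then show "w \<in> (\<Union>u\<in>ball (Suc n) S - ball n S. N u - ball (Suc n) S)" using u w by blast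
  qed
  then have "card (ball (Suc (Suc n)) S - ball (Suc n) S)
      \<le> card (\<Union>u\<in>ball (Suc n) S - ball n S. N u - ball (Suc n) S)"
    using assms(1) by (intro card_mono) (auto simp del: ball.simps)
  also have "\<dots> \<le> k * card (ball (Suc n) S - ball n S)"
  proof (rule card_UN_bound)
    show "finite (ball (Suc n) S - ball n S)" using assms(1) by (simp del: ball.simps)
    fix u assume u: "u \<in> ball (Suc n) S - ball n S"
    then obtain p where p: "p \<in> ball n S" "E p u" by (auto simp: in_N)
    then have "p \<in> N u" "p \<in> ball (Suc n) S" using sym by (auto simp: in_N)
    then have "card (N u - ball (Suc n) S) \<le> card (N u - {p})" by (intro card_mono) auto
    also have "\<dots> \<le> k" using assms(2)[of u] \<open>p \<in> N u\<close> by simp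
    finally show "card (N u - ball (Suc n) S) \<le> k" .
  qed
  finally show ?thesis .
qed

lemma card_ball_Suc:
  assumes "finite S" shows "card (ball (Suc n) S) = card (ball n S) + card (ball (Suc n) S - ball n S)"
  using assms by (subst card_Un_disjoint[symmetric]) (auto intro: arg_cong[of _ _ card])

lemma card_ball_bound:
  assumes S: "finite S" and k: "\<And>u. card (N u) \<le> Suc k"
    and one: "card ((\<Union>v\<in>S. N v) - S) \<le> d"
  shows "card (ball 3 S) \<le> card S + d + k * d + k * (k * d)"
    and "card (ball 4 S) \<le> card S + d + k * d + k * (k * d) + k * (k * (k * d))"
proof -
  let ?s = "\<lambda>n. card (ball (Suc n) S - ball n S)"
  have "ball (Suc 0) S - ball 0 S = (\<Union>v\<in>S. N v) - S" by auto
  then have 0: "?s 0 \<le> d" using one by simp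
  have g: "?s (Suc n) \<le> k * ?s n" for n by (rule ball_Suc_growth[OF S k])
  have 1: "?s (Suc 0) \<le> k * d" using le_trans[OF g mult_le_mono2[OF 0]] .
  have 2: "?s (Suc (Suc 0)) \<le> k * (k * d)" using le_trans[OF g mult_le_mono2[OF 1]] .
  have 3: "?s (Suc (Suc (Suc 0))) \<le> k * (k * (k * d))" using le_trans[OF g mult_le_mono2[OF 2]] .
  have num: "(3::nat) = Suc (Suc (Suc 0))" "(4::nat) = Suc (Suc (Suc (Suc 0)))" by simp_all
  note b = card_ball_Suc[OF S, of 0] card_ball_Suc[OF S, of "Suc 0"]
    card_ball_Suc[OF S, of "Suc (Suc 0)"] card_ball_Suc[OF S, of "Suc (Suc (Suc 0))"]
  have b0: "card (ball 0 S) = card S" by simp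
  show "card (ball 3 S) \<le> card S + d + k * d + k * (k * d)"
    unfolding num using b b0 0 1 2 by linarith
  show "card (ball 4 S) \<le> card S + d + k * d + k * (k * d) + k * (k * (k * d))"
    unfolding num using b b0 0 1 2 3 by linarith
qed

text \<open>For \<open>k = 2\<close> the bounds are 22 and 46; for \<open>k = 1\<close>, maximum
  degree two, they are 7 and 9.\<close>

lemma card_ball_point:
  assumes k: "\<And>u. card (N u) \<le> Suc k"
  shows "card (ball 3 {v}) \<le> 1 + Suc k + k * Suc k + k * (k * Suc k)"
    and "card (ball 4 {v}) \<le> 1 + Suc k + k * Suc k + k * (k * Suc k) + k * (k * (k * Suc k))"
proof -
  have "card ((\<Union>u\<in>{v}. N u) - {v}) \<le> card (N v)" by (intro card_mono) auto
  then have "card ((\<Union>u\<in>{v}. N u) - {v}) \<le> Suc k" using k[of v] by linarith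
  from card_ball_bound[OF _ k this]
  show "card (ball 3 {v}) \<le> 1 + Suc k + k * Suc k + k * (k * Suc k)"
    and "card (ball 4 {v}) \<le> 1 + Suc k + k * Suc k + k * (k * Suc k) + k * (k * (k * Suc k))" by simp_all
qed

text \<open>At most 11 vertices are contracted and at most three neighbours lead out, so there are
  at most 11 + 3 + 6 + 12 vertices.\<close>

lemma card_pure_zone:
  assumes "pure x" shows "card (pure_zone x) \<le> 41"
proof -
  let ?Z = "insert x (N x) \<union> pure_cyc x"
  have C: "odd_cyc_off x (pure_cyc x)" "card (pure_cyc x - N2 x) \<le> 1" using pure_cyc[OF assms] by auto
  have finC: "finite (pure_cyc x)" using C by (auto simp: odd_cyc_off_def ind_cyc_def)
  have P6: "card (pure_cyc x \<inter> N2 x) \<le> 6"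
    using card_mono[of "N2 x" "pure_cyc x \<inter> N2 x"] card_N2[of x] by auto
  have "card ((\<Union>v\<in>?Z. N v) - ?Z) \<le> 3" using pure_outside(1,2)[OF C] by linarith
  moreover have "card (N u) \<le> Suc 2" for u using card_N[of u] by simp
  ultimately have "card (pure_zone x) \<le> card ?Z + 3 + 2 * 3 + 2 * (2 * 3)"
    unfolding pure_zone_def using finC by (intro card_ball_bound(1)) auto
  then show ?thesis using pure_outside(3)[OF C] P6 by linarith
qed

lemma fin_L3 [simp]: "finite (L3 f)" by (simp add: L3_def)
lemma fin_L4 [simp]: "finite (L4 f a)" by (simp add: L4_def)

lemma fin_heavy_zone: "finite (heavy_zone f)"
  by (simp add: heavy_zone_def)

lemma ball4_heavy_zone: "ball 4 {f} \<subseteq> insert f (heavy_zone f)"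
proof -
  define U where "U S = (\<Union>v\<in>S. N v)" for S
  have U: "U (A \<union> B) = U A \<union> U B" "U {f} = N f" for A B by (auto simp: U_def)
  have NN: "U (N f) \<subseteq> {f} \<union> N2 f" by (auto simp: N2_def U_def)
  have NN2: "U (N2 f) \<subseteq> N f \<union> N2 f \<union> L3 f" by (auto simp: L3_def U_def)
  have NL3: "U (L3 f) \<subseteq> N2 f \<union> L3 f \<union> (\<Union>a\<in>L3 f. L4 f a)" by (auto simp: L4_def U_def)
  have step: "ball (Suc n) {f} \<subseteq> T \<union> U T" if "ball n {f} \<subseteq> T" for n T
    using that by (auto simp: U_def)
  have 1: "ball (Suc 0) {f} \<subseteq> {f} \<union> N f" by simp
  have 2: "ball (Suc (Suc 0)) {f} \<subseteq> {f} \<union> N f \<union> N2 f"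
    using step[OF 1] NN unfolding U by blast
  have 3: "ball (Suc (Suc (Suc 0))) {f} \<subseteq> {f} \<union> N f \<union> N2 f \<union> L3 f"
    using step[OF 2] NN NN2 unfolding U by blast
  have 4: "(4::nat) = Suc (Suc (Suc (Suc 0)))" by simp
  have "ball 4 {f} \<subseteq> {f} \<union> N f \<union> N2 f \<union> L3 f \<union> (\<Union>a\<in>L3 f. L4 f a)"
    using step[OF 3] NN NN2 NL3 unfolding U 4 by blast
  also have "\<dots> \<subseteq> insert f (heavy_zone f)" by (auto simp: heavy_zone_def)
  finally show ?thesis .
qed

text \<open>A vertex with an odd cycle that nearly lies in its second neighbourhood has few vertices at
  distance three, so that each of them may contribute three conflicts.\<close>

lemma card_L3_heavy:
  assumes C: "odd_cyc_off f C" "card (C - N2 f) \<le> 2"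
  shows "card (L3 f) \<le> 8"
proof -
  have cyc: "ind_cyc E C" "odd (card C)" and finC: "finite C"
    using C by (auto simp: odd_cyc_off_def ind_cyc_def)
  have "card C = card (C \<inter> N2 f) + card (C - N2 f)" using finC by (metis card_Int_Diff)
  then have P: "3 \<le> card (C \<inter> N2 f)" using odd_cyc_card[OF cyc] C(2) by linarith
  \<comment> \<open>Cycle vertices in \<open>N2 f\<close> lead to distance three only along the
    cycle. The at most three other vertices of \<open>N2 f\<close> contribute two each, which with
    the two cycle vertices off \<open>N2 f\<close> makes 8.\<close>
  have "L3 f \<subseteq> (C - N2 f) \<union> (\<Union>v\<in>N2 f - C. N v - N f)"
  proof
    fix w assume "w \<in> L3 f"
    then obtain v where v: "v \<in> N2 f" "w \<in> N v" "w \<notin> N f" "w \<notin> N2 f" by (auto simp: L3_def)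
    show "w \<in> (C - N2 f) \<union> (\<Union>v\<in>N2 f - C. N v - N f)"
    proof (cases "v \<in> C")
      case True then show ?thesis using cyc_N2_nbs[OF C(1) True v(1)] v by blast
    next
      case False then show ?thesis using v by blast
    qed
  qed
  then have "card (L3 f) \<le> card ((C - N2 f) \<union> (\<Union>v\<in>N2 f - C. N v - N f))"
    using finC by (intro card_mono) auto
  also have "\<dots> \<le> card (C - N2 f) + card (\<Union>v\<in>N2 f - C. N v - N f)" by (rule card_Un_le)
  also have "card (\<Union>v\<in>N2 f - C. N v - N f) \<le> 2 * card (N2 f - C)"
  proof (rule card_UN_bound)
    fix v assume "v \<in> N2 f - C"
    then obtain u where u: "E f u" "E u v" by (auto simp: in_N2)
    then have "card (N v - N f) \<le> card (N v - {u})" by (intro card_mono) (auto simp: in_N)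
    also have "\<dots> \<le> 2" using u sym by (intro card_N_minus) auto
    finally show "card (N v - N f) \<le> 2" .
  qed simp
  also have "card (N2 f - C) \<le> 6 - card (C \<inter> N2 f)"
    using card_N2[of f] by (simp add: card_Diff_subset_Int Int_commute)
  finally show ?thesis using P C(2) by simp
qed

text \<open>There are at most 3 + 6 + 8 vertices at the distances one to three, and three more for
  each of the 8 at distance three: 41 in all.\<close>

lemma card_heavy_zone:
  assumes C: "odd_cyc_off f C" "card (C - N2 f) \<le> 2"
  shows "card (heavy_zone f) \<le> 41"
proof -
  let ?B = "\<lambda>a. L4 f a \<union> (if card (L4 f a) \<le> 1 then \<Union>u\<in>L4 f a. N u - {a} else {})"
  have B: "card (?B a) \<le> 3" if a: "a \<in> L3 f" for a
  proof (cases "card (L4 f a) \<le> 1")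
    case True
    have "card (\<Union>u\<in>L4 f a. N u - {a}) \<le> 2 * card (L4 f a)"
      using card_N_minus sym by (intro card_UN_bound) (auto simp: L4_def in_N)
    moreover have "card (?B a) \<le> card (L4 f a) + card (\<Union>u\<in>L4 f a. N u - {a})"
      using True card_Un_le[of "L4 f a" "\<Union>u\<in>L4 f a. N u - {a}"] by simp
    ultimately show ?thesis using True by linarith
  next
    case False
    obtain v where v: "v \<in> N2 f" "E v a" using a by (auto simp: L3_def in_N)
    have "card (L4 f a) \<le> card (N a - {v})" using v by (intro card_mono) (auto simp: L4_def)
    also have "\<dots> \<le> 2" using v sym by (intro card_N_minus) auto
    finally show ?thesis using False by simp
  qed
  have "card (\<Union>a\<in>L3 f. ?B a) \<le> 3 * card (L3 f)" by (rule card_UN_bound) (use B in auto)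
  moreover have "card (heavy_zone f) \<le> card (N f \<union> N2 f \<union> L3 f) + card (\<Union>a\<in>L3 f. ?B a)"
    unfolding heavy_zone_def by (rule card_Un_le)
  moreover have "card (N f \<union> N2 f \<union> L3 f) \<le> card (N f) + card (N2 f) + card (L3 f)"
    using card_Un_le[of "N f \<union> N2 f" "L3 f"] card_Un_le[of "N f" "N2 f"] by linarith
  ultimately show ?thesis using card_L3_heavy[OF C] card_N[of f] card_N2[of f] by linarith
qed

text \<open>With at most two cycle vertices off \<open>N2 f\<close>, each of them has a cycle
  neighbour in \<open>N2 f\<close> and is at distance three. Hence no cycle neighbour of
  \<open>a\<close> is in \<open>L4 f a\<close>, which has at most one element, and the zone covers
  the two steps from \<open>a\<close> to the owner \<open>y\<close>.\<close>

lemma heavy_zone_owner: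
  assumes C: "odd_cyc_off f C" "card (C - N2 f) \<le> 2" and a: "a \<in> C" "a \<notin> N2 f"
    and y: "a \<in> N2 y" "y \<noteq> f" "C \<inter> insert y (N y) = {}"
  shows "y \<in> heavy_zone f"
proof -
  have cyc: "ind_cyc E C" "C \<subseteq> V" "odd (card C)" and off: "C \<inter> insert f (N f) = {}"
    using C by (auto simp: odd_cyc_off_def)
  have finC: "finite C" using cyc by (simp add: ind_cyc_def)
  have near: "b \<in> L3 f" if b: "b \<in> C" "b \<notin> N2 f" for b
  proof -
    have "\<exists>z\<in>nbs E C b. z \<in> N2 f"
    proof (rule ccontr)
      assume "\<not> ?thesis"
      then have "insert b (nbs E C b) \<subseteq> C - N2 f" using b by (auto simp: nbs_def)
      then have "card (insert b (nbs E C b)) \<le> card (C - N2 f)" using finC by (intro card_mono) auto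
      moreover have "b \<notin> nbs E C b" using irr by (auto simp: nbs_def)
      ultimately show False using C(2) cyc b finC by (simp add: ind_cyc_def)
    qed
    then obtain z where "z \<in> N2 f" "E z b" using sym by (auto simp: nbs_def)
    then show ?thesis using b off by (auto simp: L3_def in_N)
  qed
  have "L4 f a \<subseteq> N a - C" using near by (auto simp: L4_def)
  then have "card (L4 f a) \<le> card (N a - C)" by (intro card_mono) auto
  also have "\<dots> \<le> 1" by (rule cyc_outer[OF cyc(1,2) a(1)])
  finally have one: "card (L4 f a) \<le> 1" .
  obtain u where u: "E y u" "E u a" using y by (auto simp: in_N2)
  have "u \<in> N a" using u sym by (auto simp: in_N)
  then consider "u \<in> L4 f a" | "u \<in> N2 f" | "u \<in> L3 f" by (auto simp: L4_def)
  then show ?thesis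
  proof cases
    case 1
    have "y \<in> N u - {a}" using u y a sym by (auto simp: in_N)
    then have "y \<in> (\<Union>u\<in>L4 f a. N u - {a})" using 1 by blast
    then show ?thesis using one near[OF a] unfolding heavy_zone_def by auto
  next
    case 2
    then have "y \<in> N f \<union> N2 f \<union> L3 f" using u sym by (auto simp: L3_def in_N)
    then show ?thesis by (auto simp: heavy_zone_def)
  next
    case 3
    have "y \<in> N u" using u sym by (auto simp: in_N)
    then have "y \<in> N2 f \<union> L3 f \<union> L4 f u" by (auto simp: L4_def)
    then show ?thesis using 3 by (auto simp: heavy_zone_def)
  qed
qed

end

section \<open>The order in which vertices are placed\<close>

lemma rank_exists:
  fixes key :: "'a \<Rightarrow> nat"
  assumes "finite V"
  shows "\<exists>\<tau>::'a \<Rightarrow> nat. inj_on \<tau> V \<and> (\<forall>u\<in>V. \<forall>v\<in>V. key u < key v \<longrightarrow> \<tau> u < \<tau> v)"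
proof -
  obtain idx :: "'a \<Rightarrow> nat" and n where idx: "idx ` V = {i. i < n}" "inj_on idx V"
    using finite_imp_inj_to_nat_seg[OF assms] by blast
  have lt: "idx v < n" if "v \<in> V" for v using idx(1) that by blast
  \<comment> \<open>The key dominates; ties are broken by an enumeration of
    \<open>V\<close>.\<close>
  define \<tau> where "\<tau> v = key v * n + idx v" for v
  have less: "\<tau> u < \<tau> v" if "u \<in> V" "v \<in> V" "key u < key v" for u v
  proof -
    have "\<tau> u < Suc (key u) * n" using lt[OF that(1)] by (simp add: \<tau>_def)
    also have "\<dots> \<le> key v * n" using that(3) by (intro mult_le_mono1) simp
    finally show ?thesis by (simp add: \<tau>_def)
  qed
  have "inj_on \<tau> V"
  proof (rule inj_onI)
    fix u v assume uv: "u \<in> V" "v \<in> V" "\<tau> u = \<tau> v"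
    then have "key u = key v" using less[of u v] less[of v u] by force
    then have "idx u = idx v" using uv by (simp add: \<tau>_def)
    then show "u = v" using idx(2) uv by (simp add: inj_on_def)
  qed
  then show ?thesis using less by blast
qed

context subcubic
begin

lemma ball_trans: "p \<in> ball j S \<Longrightarrow> ball k {p} \<subseteq> ball (j + k) S"
  by (induction k) auto

lemma ball_sym: "u \<in> ball n {v} \<Longrightarrow> v \<in> ball n {u}"
proof (induction n arbitrary: u)
  case 0 then show ?case by simp
next
  case (Suc n)
  show ?case
  proof (cases "u \<in> ball n {v}")
    case True
    have "ball n {u} \<subseteq> ball (Suc n) {u}" by (rule ball_le) simp
    then show ?thesis using Suc.IH[OF True] by blast
  next
    case False
    then obtain p where p: "p \<in> ball n {v}" "E p u" using Suc.prems by (auto simp: in_N)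
    have "p \<in> ball 1 {u}" using sym[OF p(2)] by (simp add: in_N)
    then have "ball n {p} \<subseteq> ball (1 + n) {u}" by (rule ball_trans)
    then show ?thesis using Suc.IH[OF p(1)] by auto
  qed
qed

lemma ball_1: "E v u \<Longrightarrow> u \<in> ball 1 {v}"
  by (simp add: in_N)

lemma ball_path2: "E v u \<Longrightarrow> E u w \<Longrightarrow> w \<in> ball 2 {v}"
  using ball_trans[of u 1 "{v}" 1] ball_1[of v u] ball_1[of u w] by (auto simp: numeral_2_eq_2)

lemma ball_V: "v \<in> V \<Longrightarrow> ball n {v} \<subseteq> V"
  using E_V by (induction n) (auto simp: in_N)

text \<open>By connectedness the distance from \<open>W\<close> is such a level.\<close>

lemma levels_exist:
  assumes con: "conn E V" and W: "W \<subseteq> V" "W \<noteq> {}"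
  shows "\<exists>lev::'a \<Rightarrow> nat. \<forall>v\<in>V - W. \<exists>p. E v p \<and> lev p < lev v"
proof -
  define lev where "lev v = (LEAST n. v \<in> ball n W)" for v
  let ?U = "{v \<in> V. \<exists>n. v \<in> ball n W}"
  have "?U = V"
  proof (rule ccontr)
    assume ne: "?U \<noteq> V"
    have "W \<subseteq> ?U"
    proof
      fix w assume "w \<in> W"
      then have "w \<in> ball 0 W" by simp
      then show "w \<in> ?U" using W \<open>w \<in> W\<close> by blast
    qed
    then obtain v u where vu: "v \<in> ?U" "u \<in> V - ?U" "E v u"
      using conn_boundary[OF con, of ?U] ne W by blast
    then show False using ball_step by blast
  qed
  then have ex: "\<exists>n. v \<in> ball n W" if "v \<in> V" for v using that by blast
  have "\<exists>p. E v p \<and> lev p < lev v" if v: "v \<in> V - W" for v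
  proof -
    have lv: "v \<in> ball (lev v) W" unfolding lev_def using ex v by (metis DiffD1 LeastI_ex)
    have "lev v \<noteq> 0"
    proof
      assume "lev v = 0"
      then show False using lv v by simp
    qed
    then obtain k where k: "lev v = Suc k" using not0_implies_Suc by blast
    have "v \<notin> ball k W"
    proof
      assume "v \<in> ball k W"
      then have "lev v \<le> k" unfolding lev_def by (rule Least_le)
      then show False using k by simp
    qed
    then obtain p where p: "p \<in> ball k W" "E p v" using lv k by (auto simp: in_N)
    have "lev p \<le> k" unfolding lev_def using p(1) by (rule Least_le)
    then show ?thesis using sym[OF p(2)] k by (metis less_Suc_eq_le)
  qed
  then show ?thesis by blast
qed

lemma star_ball:
  assumes "p \<in> insert r (N r)" shows "insert r (N r) \<subseteq> ball 2 {p}"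
proof -
  have p: "p \<in> ball 2 {p}" using ball_le[of 0 2 "{p}"] by auto
  have 1: "ball 1 {p} \<subseteq> ball 2 {p}" by (rule ball_le) simp
  show ?thesis
  proof (cases "p = r")
    case True
    then show ?thesis using p 1 ball_1[of p] in_N by blast
  next
    case False
    then have "E p r" using assms sym in_N by blast
    then show ?thesis using 1 ball_1[of p r] ball_path2[of p r] in_N by blast
  qed
qed

text \<open>Descending from \<open>v\<close>, either the star of \<open>r\<close> is reached within
  two steps, and then all its four vertices lie in the ball, or there are three vertices on the way
  and a fourth next to the third. These will be ranked after \<open>v\<close> and so drop out of its
  conflicts.\<close>

lemma four_later:
  assumes r: "card (N r) = 3" and v: "v \<in> V - insert r (N r)"
    and lev: "\<And>v. v \<in> V - insert r (N r) \<Longrightarrow> \<exists>p. E v p \<and> lev p < (lev v::nat)"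
  shows "\<exists>T\<subseteq>ball 4 {v}. card T = 4 \<and> (\<forall>t\<in>T. t \<in> insert r (N r) \<or> lev t < lev v)"
proof -
  let ?W = "insert r (N r)"
  have "r \<notin> N r" using irr by (simp add: in_N)
  then have W4: "card ?W = 4" using r by simp
  have WT: ?thesis if "p \<in> ?W" "p \<in> ball 2 {v}" for p
  proof -
    have "ball 2 {p} \<subseteq> ball 4 {v}" using ball_trans[OF that(2), of 2] by simp
    then have "?W \<subseteq> ball 4 {v}" using star_ball[OF that(1)] by (rule subset_trans[rotated])
    then show ?thesis using W4 by blast
  qed
  have le: "ball 1 {v} \<subseteq> ball 2 {v}" "ball 2 {v} \<subseteq> ball 4 {v}" "ball 3 {v} \<subseteq> ball 4 {v}"
    by (rule ball_le, simp)+
  obtain p1 where p1: "E v p1" "lev p1 < lev v" using lev[OF v] by blast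
  have b1: "p1 \<in> ball 2 {v}" using ball_1[OF p1(1)] le by blast
  show ?thesis
  proof (cases "p1 \<in> ?W")
    case True then show ?thesis using WT b1 by blast
  next
    case n1: False
    then have "p1 \<in> V - ?W" using p1(1) E_V by blast
    then obtain p2 where p2: "E p1 p2" "lev p2 < lev p1" using lev by blast
    have b2: "p2 \<in> ball 2 {v}" using ball_path2[OF p1(1) p2(1)] .
    show ?thesis
    proof (cases "p2 \<in> ?W")
      case True then show ?thesis using WT b2 by blast
    next
      case n2: False
      then have "p2 \<in> V - ?W" using p2(1) E_V by blast
      then obtain p3 where p3: "E p2 p3" "lev p3 < lev p2" using lev by blast
      have b3: "p3 \<in> ball 3 {v}"
        using ball_step[OF b2 p3(1)] by (simp add: numeral_3_eq_3 numeral_2_eq_2 del: ball.simps)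
      have b4: "q \<in> ball 4 {v}" if "E p3 q" for q
        using ball_step[OF b3 that] by (simp add: eval_nat_numeral del: ball.simps)
      have "\<exists>q. E p3 q \<and> (q \<in> ?W \<or> lev q < lev v) \<and> q \<notin> {p1, p2, p3}"
      proof (cases "p3 \<in> ?W")
        case True
        have "N r \<noteq> {}" using r by auto
        then obtain s where s: "E r s" by (auto simp: in_N)
        show ?thesis
        proof (cases "p3 = r")
          case True
          have "s \<in> ?W" "s \<noteq> p3" using s True irr by (auto simp: in_N)
          then show ?thesis using s True n1 n2 by blast
        next
          case False
          then have "E p3 r" using True sym in_N by blast
          then show ?thesis using False n1 n2 by blast
        qed
      next
        case False
        then have "p3 \<in> V - ?W" using p3(1) E_V by blast
        then obtain q where q: "E p3 q" "lev q < lev p3" using lev by blast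
        then have "q \<notin> {p1, p2, p3}" "lev q < lev v" using p1 p2 p3 by auto
        then show ?thesis using q by blast
      qed
      then obtain q where q: "E p3 q" "q \<in> ?W \<or> lev q < lev v" "q \<notin> {p1, p2, p3}" by blast
      have "{p1, p2, p3, q} \<subseteq> ball 4 {v}" using b1 b2 b3 b4[OF q(1)] le by blast
      moreover have "p1 \<noteq> p2" "p1 \<noteq> p3" "p2 \<noteq> p3" using p2(2) p3(2) by auto
      then have "card {p1, p2, p3, q} = 4" using q(3) by (auto simp: card_insert_if)
      moreover have "\<forall>t\<in>{p1, p2, p3, q}. t \<in> ?W \<or> lev t < lev v" using p1 p2 p3 q(2) by auto
      ultimately show ?thesis by blast
    qed
  qed
qed

section \<open>The choice of the 42 classes\<close>

definition common :: "'a \<Rightarrow> 'a set \<Rightarrow> ('a \<times> 'a) set" where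
  "common v S = {(a, y). a \<in> N2 v \<and> y \<in> S \<and> a \<in> N2 y}"

text \<open>\<open>S\<close> is the set of earlier members of the class. Distance at least five is
  the rule, and \<open>pure\<close> and \<open>heavy\<close> vertices have zones of their own. On
  the star \<open>W\<close> the ball of radius four holds too many earlier vertices; there distance
  four is enough if at most one earlier member is at distance two from a vertex of
  \<open>N2 v\<close>, and from only one such vertex.\<close>

definition admissible :: "'a set \<Rightarrow> 'a \<Rightarrow> 'a set \<Rightarrow> bool" where
  "admissible W v S \<longleftrightarrow>
     (if pure v then S \<inter> pure_zone v = {}
      else if heavy v then S \<inter> heavy_zone v = {}
      else if v \<in> W then S \<inter> ball 3 {v} = {} \<and> card (common v S) \<le> 1
      else S \<inter> ball 4 {v} = {})"

lemma fin_common: "finite (common v S)"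
proof (rule finite_subset)
  show "common v S \<subseteq> (SIGMA a:N2 v. N2 a)" using N2_sym by (auto simp: common_def)
qed simp

text \<open>At most 21 classes contain a vertex at distance at most three from \<open>v\<close>. The 24 paths of
  length four from \<open>v\<close> cannot meet all the other classes twice.\<close>

lemma class_for_centre:
  assumes A: "v \<notin> A" and c: "\<And>u. u \<in> A \<Longrightarrow> c u < (42::nat)"
  shows "\<exists>k<42. {u \<in> A. c u = k} \<inter> ball 3 {v} = {} \<and> card (common v {u \<in> A. c u = k}) \<le> 1"
proof (rule ccontr)
  assume no: "\<not> ?thesis"
  define B where "B = c ` (A \<inter> ball 3 {v})"
  define P where "P = (SIGMA a:N2 v. N2 a - ball 3 {v})"
  have N3: "card (N u) \<le> Suc 2" for u using card_N[of u] by simp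
  have vb: "v \<in> ball 3 {v}" using ball_le[of 0 3 "{v}"] by auto
  have "A \<inter> ball 3 {v} \<subseteq> ball 3 {v} - {v}" using A by blast
  then have "card (A \<inter> ball 3 {v}) \<le> card (ball 3 {v} - {v})" by (intro card_mono) auto
  also have "\<dots> \<le> 21" using card_ball_point(1)[OF N3, of v] vb by simp
  finally have "card B \<le> 21"
    unfolding B_def using card_image_le[of "A \<inter> ball 3 {v}" c] by simp
  moreover have "finite B" unfolding B_def by simp
  moreover have "card {..<42::nat} - card B \<le> card ({..<42} - B)"
    using \<open>finite B\<close> by (rule diff_card_le_card_Diff)
  ultimately have free: "21 \<le> card ({..<42} - B)" by simp
  have finP: "finite P" unfolding P_def by simp
  have four: "card (N2 a - ball 3 {v}) \<le> 4" if a: "a \<in> N2 v" for a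
  proof -
    obtain u where u: "E v u" "E u a" using a by (auto simp: in_N2)
    have "N2 a - ball 3 {v} \<subseteq> (\<Union>w\<in>N a - {u}. N w - {a})"
    proof
      fix y assume y: "y \<in> N2 a - ball 3 {v}"
      then obtain w where w: "E a w" "E w y" "y \<noteq> a" by (auto simp: in_N2)
      have "w \<noteq> u"
      proof
        assume "w = u"
        then have "y \<in> ball 2 {v}" using ball_path2[OF u(1)] w by blast
        moreover have "ball 2 {v} \<subseteq> ball 3 {v}" by (rule ball_le) simp
        ultimately show False using y by blast
      qed
      then show "y \<in> (\<Union>w\<in>N a - {u}. N w - {a})" using w by (auto simp: in_N)
    qed
    then have "card (N2 a - ball 3 {v}) \<le> card (\<Union>w\<in>N a - {u}. N w - {a})"
      by (intro card_mono) auto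
    also have "\<dots> \<le> 2 * card (N a - {u})"
      using card_N_minus sym by (intro card_UN_bound) (auto simp: in_N)
    also have "\<dots> \<le> 2 * 2" using card_N_minus[of a u] u sym by simp
    finally show ?thesis by simp
  qed
  have "card P = (\<Sum>a\<in>N2 v. card (N2 a - ball 3 {v}))" unfolding P_def by simp
  also have "\<dots> \<le> (\<Sum>a\<in>N2 v. 4)" using four by (rule sum_mono)
  also have "\<dots> \<le> 24" using card_N2[of v] by simp
  finally have P24: "card P \<le> 24" .
  have two: "2 \<le> card {x \<in> P. snd x \<in> A \<and> c (snd x) = k}" if k: "k \<in> {..<42} - B" for k
  proof -
    have off: "{u \<in> A. c u = k} \<inter> ball 3 {v} = {}" using k by (auto simp: B_def)
    then have "2 \<le> card (common v {u \<in> A. c u = k})" using no k by fastforce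
    also have "\<dots> \<le> card {x \<in> P. snd x \<in> A \<and> c (snd x) = k}"
    proof (rule card_mono)
      show "finite {x \<in> P. snd x \<in> A \<and> c (snd x) = k}" using finP by simp
      show "common v {u \<in> A. c u = k} \<subseteq> {x \<in> P. snd x \<in> A \<and> c (snd x) = k}"
        using off N2_sym unfolding common_def P_def by auto
    qed
    finally show ?thesis .
  qed
  have "2 * card ({..<42} - B) = (\<Sum>k\<in>{..<42} - B. 2)" by simp
  also have "\<dots> \<le> (\<Sum>k\<in>{..<42} - B. card {x \<in> P. snd x \<in> A \<and> c (snd x) = k})"
    using two by (rule sum_mono)
  also have "\<dots> = card (\<Union>k\<in>{..<42} - B. {x \<in> P. snd x \<in> A \<and> c (snd x) = k})"
    using finP by (intro card_UN_disjoint[symmetric]) auto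
  also have "\<dots> \<le> card P" using finP by (intro card_mono) auto
  finally show False using free P24 by linarith
qed

text \<open>Up to 36 vertices singleton classes are possible; they are chosen because the exclusion
  of K4 with two contracted cycles needs a larger graph. Otherwise an ordinary vertex has at most 41
  conflicts: 46 vertices in the ball, less itself and four later ones.\<close>

lemma exists_classes:
  assumes con: "conn E V"
  shows "\<exists>\<kappa> \<tau> W. inj_on \<tau> V \<and> (\<forall>u\<in>V. \<forall>v\<in>V. pure v \<longrightarrow> \<not> pure u \<longrightarrow> \<tau> u < (\<tau> v::nat)) \<and>
    (\<forall>u\<in>W. \<forall>v\<in>W. u \<in> ball 3 {v}) \<and>
    (\<forall>v\<in>V. \<kappa> v < (42::nat) \<and> admissible W v {u \<in> V. \<tau> u < \<tau> v \<and> \<kappa> u = \<kappa> v}) \<and>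
    (36 < card V \<or> inj_on \<kappa> V)"
proof (cases "card V \<le> 36")
  case True
  obtain idx :: "'a \<Rightarrow> nat" and n where idx: "idx ` V = {i. i < n}" "inj_on idx V"
    using finite_imp_inj_to_nat_seg[OF fin] by blast
  have "n \<le> 36" using True card_image[OF idx(2)] idx(1) by simp
  have idx42: "idx v < 42" if "v \<in> V" for v
  proof -
    have "idx v < n" using idx(1) that by blast
    then show ?thesis using \<open>n \<le> 36\<close> by simp
  qed
  obtain \<tau> :: "'a \<Rightarrow> nat" where t: "inj_on \<tau> V"
    "\<And>u v. u \<in> V \<Longrightarrow> v \<in> V \<Longrightarrow> (if pure u then 1 else 0) < (if pure v then 1 else (0::nat)) \<Longrightarrow> \<tau> u < \<tau> v"
    using rank_exists[OF fin, of "\<lambda>v. if pure v then 1 else 0"] by blast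
  have empty: "{u \<in> V. \<tau> u < \<tau> v \<and> idx u = idx v} = {}" if "v \<in> V" for v
    using idx(2) that by (auto simp: inj_on_def)
  have adm: "admissible {} v {u \<in> V. \<tau> u < \<tau> v \<and> idx u = idx v}" if "v \<in> V" for v
    unfolding empty[OF that]
    by (simp add: admissible_def)
  have "\<forall>u\<in>V. \<forall>v\<in>V. pure v \<longrightarrow> \<not> pure u \<longrightarrow> \<tau> u < \<tau> v" using t(2) by simp
  then show ?thesis
    using idx(2) idx42 adm t(1)
    by (intro exI[of _ idx] exI[of _ \<tau>] exI[of _ "{}"] conjI ballI disjI2) simp_all
next
  case big: False
  have "\<exists>W lev. (\<forall>u\<in>W. \<forall>v\<in>W. u \<in> ball 3 {v}) \<and>
    (\<forall>v\<in>V - W. \<exists>T\<subseteq>ball 4 {v}. card (ball 4 {v}) \<le> 42 + card T \<and>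
       (\<forall>t\<in>T. t \<in> W \<or> lev t < (lev v::nat)))"
  proof (cases "\<exists>r. card (N r) = 3")
    case True
    then obtain r where r: "card (N r) = 3" by blast
    let ?W = "insert r (N r)"
    have "N r \<noteq> {}" using r by auto
    then have W: "?W \<subseteq> V" using E_V by (auto simp: in_N)
    obtain lev :: "'a \<Rightarrow> nat" where lev: "\<And>v. v \<in> V - ?W \<Longrightarrow> \<exists>p. E v p \<and> lev p < lev v"
      using levels_exist[OF con W] by blast
    have N3: "card (N u) \<le> Suc 2" for u using card_N[of u] by simp
    have "card (ball 4 {v}) \<le> 46" for v using card_ball_point(2)[OF N3, of v] by simp
    then have b46: "card (ball 4 {v}) \<le> 42 + 4" for v by simp
    have "\<exists>T\<subseteq>ball 4 {v}. card (ball 4 {v}) \<le> 42 + card T \<and> (\<forall>t\<in>T. t \<in> ?W \<or> lev t < lev v)"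
      if v: "v \<in> V - ?W" for v
    proof -
      obtain T where "T \<subseteq> ball 4 {v}" "card T = 4" "\<forall>t\<in>T. t \<in> ?W \<or> lev t < lev v"
        using four_later[OF r v lev] by blast
      then show ?thesis using b46[of v] by (intro exI[of _ T]) simp
    qed
    moreover have "u \<in> ball 3 {v}" if "u \<in> ?W" "v \<in> ?W" for u v
    proof -
      have "ball 2 {v} \<subseteq> ball 3 {v}" by (rule ball_le) simp
      then show ?thesis using star_ball[OF that(2)] that(1) by blast
    qed
    ultimately show ?thesis by (intro exI[of _ ?W] exI[of _ lev]) blast
  next
    case False
    have N2': "card (N u) \<le> Suc 1" for u
    proof -
      have "card (N u) \<noteq> 3" using False by blast
      then show ?thesis using card_N[of u] by simp
    qed
    have "card (ball 4 {v}) \<le> 42 + card ({} :: 'a set)" for v using card_ball_point(2)[OF N2', of v] by simp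
    then show ?thesis by (intro exI[of _ "{}"] exI[of _ "\<lambda>_. 0"]) simp
  qed
  then obtain W and lev :: "'a \<Rightarrow> nat" where W: "\<forall>u\<in>W. \<forall>v\<in>W. u \<in> ball 3 {v}"
    and later: "\<forall>v\<in>V - W. \<exists>T\<subseteq>ball 4 {v}. card (ball 4 {v}) \<le> 42 + card T \<and>
       (\<forall>t\<in>T. t \<in> W \<or> lev t < lev v)" by (elim exE conjE)
  define M where "M = Suc (Max (lev ` V))"
  have M: "lev v < M" if "v \<in> V" for v using fin that by (simp add: M_def less_Suc_eq_le)
  \<comment> \<open>Decreasing distance from \<open>W\<close>, so that descending neighbours are
    placed later; then \<open>W\<close>, the heavy and finally the pure vertices. The conflicts of
    these three kinds are bounded whatever the order, and a pure vertex in last place keeps its zone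
    free of all other kinds.\<close>
  define key where "key v = (if pure v then M + 3 else if heavy v then M + 2 else if v \<in> W then M + 1
    else M - lev v)" for v
  obtain \<tau> :: "'a \<Rightarrow> nat" where t: "inj_on \<tau> V"
    "\<And>u v. u \<in> V \<Longrightarrow> v \<in> V \<Longrightarrow> key u < key v \<Longrightarrow> \<tau> u < \<tau> v"
    using rank_exists[OF fin, of key] by blast
  have "\<exists>\<kappa>. \<forall>v\<in>V. \<kappa> v < (42::nat) \<and> admissible W v {u \<in> V. \<tau> u < \<tau> v \<and> \<kappa> u = \<kappa> v}"
  proof (rule greedy_classes[OF fin t(1)])
    fix v and c :: "'a \<Rightarrow> nat"
    assume v: "v \<in> V" and c: "\<And>u. u \<in> V \<Longrightarrow> c u < 42"
    let ?A = "{u \<in> V. \<tau> u < \<tau> v}"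
    have eq: "{u \<in> V. \<tau> u < \<tau> v \<and> c u = k} = {u \<in> ?A. c u = k}" for k by auto
    have avoid: "\<exists>k<42. {u \<in> ?A. c u = k} \<inter> R = {}" if R: "finite R" "card (?A \<inter> R) < 42" for R
    proof -
      have "finite (?A \<inter> R)" using R(1) by simp
      then obtain k where "k < 42" "\<forall>u\<in>?A \<inter> R. c u \<noteq> k" using free_class[OF _ R(2)] by blast
      then show ?thesis by (intro exI[of _ k]) auto
    qed
    have avoid': "\<exists>k<42. {u \<in> ?A. c u = k} \<inter> R = {}" if "finite R" "card R \<le> 41" for R
      using avoid[OF that(1)] card_mono[of R "?A \<inter> R"] that by force
    show "\<exists>k<42. admissible W v {u \<in> V. \<tau> u < \<tau> v \<and> c u = k}"
    proof (cases "pure v")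
      case True
      have "finite (pure_zone v)"
        using pure_cyc[OF True] by (auto simp: pure_zone_def odd_cyc_off_def ind_cyc_def)
      then show ?thesis using avoid' card_pure_zone[OF True] True unfolding eq admissible_def by simp
    next
      case np: False
      show ?thesis
      proof (cases "heavy v")
        case True
        then obtain C where "odd_cyc_off v C" "card (C - N2 v) \<le> 2" by (auto simp: heavy_def)
        then have "card (heavy_zone v) \<le> 41" by (rule card_heavy_zone)
        then show ?thesis using avoid' fin_heavy_zone True np unfolding eq admissible_def by simp
      next
        case nh: False
        show ?thesis
        proof (cases "v \<in> W")
          case True
          then show ?thesis
            using class_for_centre[of v ?A c] c np nh unfolding eq admissible_def by (simp del: ball.simps)
        next
          case nW: False
          have "v \<in> V - W" using v nW by blast
          then obtain T where T: "T \<subseteq> ball 4 {v}" "card (ball 4 {v}) \<le> 42 + card T"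
            "\<forall>t\<in>T. t \<in> W \<or> lev t < lev v" 
            using bspec[OF later] by metis
          have kv: "key v = M - lev v" using np nh nW by (simp add: key_def)
          have TA: "t \<notin> ?A" if "t \<in> T" for t
          proof -
            have tV: "t \<in> V" using that T(1) ball_V[OF v] by blast
            have "key v < key t" using T(3) that M[OF v] M[OF tV] unfolding kv by (auto simp: key_def)
            then show ?thesis using t(2)[OF v tV] by simp
          qed
          have "ball 0 {v} \<subseteq> ball 4 {v}" by (rule ball_le) simp
          then have vb: "v \<in> ball 4 {v}" by simp
          have "v \<notin> T" using T(3) nW by auto
          have "?A \<inter> ball 4 {v} \<subseteq> (ball 4 {v} - T) - {v}" using TA by auto
          then have "card (?A \<inter> ball 4 {v}) \<le> card ((ball 4 {v} - T) - {v})"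
            by (intro card_mono finite_Diff fin_ball) auto
          also have "\<dots> < card (ball 4 {v} - T)"
            using vb \<open>v \<notin> T\<close> by (intro psubset_card_mono finite_Diff fin_ball) auto
          also have "\<dots> = card (ball 4 {v}) - card T"
            using T(1) by (intro card_Diff_subset finite_subset[OF T(1)] fin_ball) auto
          also have "\<dots> \<le> 42" using T(2) by simp
          finally show ?thesis
            using avoid[of "ball 4 {v}"] np nh nW unfolding eq admissible_def by (simp del: ball.simps)
        qed
      qed
    qed
  qed simp
  then obtain \<kappa> where k: "\<forall>v\<in>V. \<kappa> v < (42::nat) \<and> admissible W v {u \<in> V. \<tau> u < \<tau> v \<and> \<kappa> u = \<kappa> v}"
    by blast
  have "\<tau> u < \<tau> v" if "u \<in> V" "v \<in> V" "pure v" "\<not> pure u" for u v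
  proof -
    have "key u < key v" using that(3,4) by (auto simp: key_def)
    then show ?thesis by (rule t(2)[OF that(1,2)])
  qed
  then show ?thesis
    using k t(1) W big by (intro exI[of _ \<kappa>] exI[of _ \<tau>] exI[of _ W] conjI) simp_all
qed

end

section \<open>From classes to a colouring with 126 colours\<close>

definition fcol :: "('a \<Rightarrow> 'a \<Rightarrow> bool) \<Rightarrow> 'a set \<Rightarrow> ('a \<Rightarrow> nat set) \<Rightarrow> bool" where
  "fcol E V \<phi> \<longleftrightarrow> (\<forall>v\<in>V. \<phi> v \<subseteq> {..<126} \<and> 43 \<le> card (\<phi> v)) \<and>
     (\<forall>u\<in>V. \<forall>v\<in>V. E u v \<longrightarrow> \<phi> u \<inter> \<phi> v = {})"

text \<open>Colour i of the k-th palette becomes \<open>n * k + i\<close>. This serves 42 palettes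
  of three as well as 15 copies of one palette of eight.\<close>

lemma stack_colourings:
  assumes D: "\<And>k v. k < m \<Longrightarrow> v \<in> V \<Longrightarrow> D k v \<subseteq> {..<n::nat}"
    and E: "\<And>k u v. k < m \<Longrightarrow> u \<in> V \<Longrightarrow> v \<in> V \<Longrightarrow> E u v \<Longrightarrow> D k u \<inter> D k v = {}"
    and size: "n * m \<le> 126" "\<And>v. v \<in> V \<Longrightarrow> 43 \<le> (\<Sum>k<m. card (D k v))"
  shows "\<exists>\<phi>. fcol E V \<phi>"
proof -
  let ?g = "\<lambda>(k, i). n * k + i :: nat"
  define \<phi> where "\<phi> v = ?g ` (SIGMA k:{..<m}. D k v)" for v
  have inj: "k = k' \<and> i = i'" if "n * k + i = n * k' + i'" "i < n" "i' < n" for k i k' i' :: nat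
  proof -
    have "(n * k + i) div n = (n * k' + i') div n" "(n * k + i) mod n = (n * k' + i') mod n"
      using that(1) by simp_all
    then show ?thesis using that(2,3) by simp
  qed
  have "\<phi> v \<subseteq> {..<126}" if v: "v \<in> V" for v
  proof
    fix c assume "c \<in> \<phi> v"
    then obtain k i where ki: "k < m" "i \<in> D k v" "c = n * k + i" by (auto simp: \<phi>_def)
    then have "i < n" using D[OF ki(1) v] by blast
    then have "c < n * Suc k" using ki by simp
    also have "\<dots> \<le> n * m" using ki(1) by (intro mult_le_mono2) simp
    finally show "c \<in> {..<126}" using size(1) by simp
  qed
  moreover have "43 \<le> card (\<phi> v)" if v: "v \<in> V" for v
  proof -
    have "inj_on ?g (SIGMA k:{..<m}. D k v)"
    proof (rule inj_onI, clarify)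
      fix k i k' i' assume a: "n * k + i = n * k' + i'" "k < m" "i \<in> D k v" "k' < m" "i' \<in> D k' v"
      then have "i < n" "i' < n" using D[OF a(2) v] D[OF a(4) v] by blast+
      then show "k = k' \<and> i = i'" by (rule inj[OF a(1)])
    qed
    then have "card (\<phi> v) = card (SIGMA k:{..<m}. D k v)" unfolding \<phi>_def by (rule card_image)
    also have "\<dots> = (\<Sum>k<m. card (D k v))"
      using D v by (intro card_SigmaI ballI) (auto intro: finite_subset)
    finally show ?thesis using size(2)[OF v] by simp
  qed
  moreover have "\<phi> u \<inter> \<phi> v = {}" if uv: "u \<in> V" "v \<in> V" "E u v" for u v
  proof -
    have False if c: "c \<in> \<phi> u" "c \<in> \<phi> v" for c
    proof -
      obtain k i where ki: "k < m" "i \<in> D k u" "c = n * k + i" using c by (auto simp: \<phi>_def)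
      obtain k' i' where ki': "k' < m" "i' \<in> D k' v" "c = n * k' + i'" using c by (auto simp: \<phi>_def)
      have "i < n" "i' < n" using D[OF ki(1) uv(1)] ki(2) D[OF ki'(1) uv(2)] ki'(2) by blast+
      moreover have "n * k + i = n * k' + i'" using ki(3) ki'(3) by (rule subst)
      ultimately have "k = k' \<and> i = i'" by (intro inj)
      then show False using E[OF ki(1) uv] ki(2) ki'(2) by blast
    qed
    then show ?thesis by blast
  qed
  ultimately show ?thesis unfolding fcol_def by blast
qed

context subcubic
begin

text \<open>Such a cycle has no vertex that could take the colour of the neighbours of
  \<open>x\<close>, and the two other colours do not suffice for an odd cycle. This is the case
  removed by gluing.\<close>

definition full :: "'a \<Rightarrow> bool" where
  "full x \<longleftrightarrow> (\<exists>C. odd_cyc_off x C \<and> C \<subseteq> N2 x)"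

lemma star_1: "z \<in> insert x (N x) \<Longrightarrow> z \<in> ball 1 {x}"
  by (auto simp: in_N)

lemma ball_sym_set: "y \<in> S \<Longrightarrow> y \<in> ball n {x} \<Longrightarrow> x \<in> ball n S"
  using ball_sym[of y n x] ball_mono[of "{y}" S n] by blast

text \<open>The one cycle vertex off the second neighbourhood has its cycle neighbours in
  it.\<close>

lemma pure_near:
  assumes "pure x" "z \<in> insert x (N x) \<union> pure_cyc x"
  shows "z \<in> ball 3 {x}"
proof -
  let ?C = "pure_cyc x"
  have C: "odd_cyc_off x ?C" "card (?C - N2 x) \<le> 1" using pure_cyc[OF assms(1)] by auto
  then have finC: "finite ?C" and two: "\<And>v. v \<in> ?C \<Longrightarrow> card (nbs E ?C v) = 2"
    by (auto simp: odd_cyc_off_def ind_cyc_def)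
  have le: "ball 1 {x} \<subseteq> ball 3 {x}" "ball 2 {x} \<subseteq> ball 3 {x}" by (rule ball_le, simp)+
  have n2: "z \<in> ball 2 {x}" if "z \<in> N2 x" for z using that ball_path2 in_N2 by blast
  consider "z \<in> insert x (N x)" | "z \<in> N2 x" | "z \<in> ?C - N2 x" using assms(2) by blast
  then show ?thesis
  proof cases
    case 1 then show ?thesis using star_1 le by blast
  next
    case 2 then show ?thesis using n2 le by blast
  next
    case 3
    have "nbs E ?C z \<noteq> {}" using two[of z] 3 by auto
    then obtain w where w: "w \<in> ?C" "E z w" by (auto simp: nbs_def)
    have "w \<in> N2 x"
    proof (rule ccontr)
      assume "w \<notin> N2 x"
      then have "{z, w} \<subseteq> ?C - N2 x" using 3 w by blast
      then have "card {z, w} \<le> card (?C - N2 x)" using finC by (intro card_mono) auto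
      moreover have "z \<noteq> w" using w irr by blast
      ultimately show False using C(2) by simp
    qed
    then have "z \<in> ball (Suc 2) {x}" using ball_step[OF n2] sym[OF w(2)] by blast
    then show ?thesis by (simp add: numeral_3_eq_3 numeral_2_eq_2 del: ball.simps)
  qed
qed

text \<open>\<open>admissible\<close> restricts earlier members only. As balls are symmetric and
  pure vertices come last, the later member of each pair guarantees what \<open>packing\<close> asks
  of the pair.\<close>

lemma run_of_class:
  assumes con: "conn E V" and A: "A \<subseteq> V" and inj: "inj_on \<tau> A"
    and ord: "\<And>u v. u \<in> A \<Longrightarrow> v \<in> A \<Longrightarrow> pure v \<Longrightarrow> \<not> pure u \<Longrightarrow> \<tau> u < (\<tau> v::nat)"
    and W: "\<And>u v. u \<in> W \<Longrightarrow> v \<in> W \<Longrightarrow> u \<in> ball 3 {v}"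
    and adm: "\<And>v. v \<in> A \<Longrightarrow> admissible W v {u \<in> A. \<tau> u < \<tau> v}"
    and small: "36 < card V \<or> card A \<le> 1"
    and nofull: "\<And>v. v \<in> A \<Longrightarrow> \<not> full v"
  shows "\<exists>D. run D \<and> (\<forall>v\<in>A. 2 \<le> card (D v))"
proof -
  define Xn where "Xn = {v \<in> A. \<not> pure v}"
  define Xp where "Xp = {v \<in> A. pure v}"
  have finA: "finite A" using A fin finite_subset by blast
  define T where "T = Suc (Max (\<tau> ` A))"
  have T: "\<tau> v < T" if "v \<in> A" for v using finA that by (simp add: T_def less_Suc_eq_le)
  \<comment> \<open>The rank for avoiding colours is not the order of placement: heavy vertices come
    above all others, and in reversed order. A heavy f has no earlier member in its zone, so an
    owner y found there was placed later and now ranks below f.\<close>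
  define \<sigma> where "\<sigma> v = (if heavy v then 2 * T - \<tau> v else \<tau> v)" for v
  have cmp: "\<tau> u < \<tau> v \<or> \<tau> v < \<tau> u" if "u \<in> A" "v \<in> A" "u \<noteq> v" for u v
    using inj that by (meson inj_onD linorder_neqE_nat)
  have b34: "ball 3 {v} \<subseteq> ball 4 {v}" for v by (rule ball_le) simp
  have later: "u \<notin> ball 3 {v} \<and> (u \<in> ball 4 {v} \<longrightarrow> v \<in> W \<and> card (common v {u \<in> A. \<tau> u < \<tau> v}) \<le> 1)"
    if uv: "u \<in> Xn" "v \<in> Xn" "\<tau> u < \<tau> v" for u v
  proof -
    have u: "u \<in> {u \<in> A. \<tau> u < \<tau> v}" and v: "\<not> pure v" and "u \<noteq> v" using uv by (auto simp: Xn_def)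
    have ad: "admissible W v {u \<in> A. \<tau> u < \<tau> v}" using adm uv(2) by (simp add: Xn_def)
    consider "heavy v" | "\<not> heavy v" "v \<in> W" | "\<not> heavy v" "v \<notin> W" by blast
    then show ?thesis
    proof cases
      case 1
      then have "u \<notin> heavy_zone v" using ad u v unfolding admissible_def by auto
      then have "u \<notin> ball 4 {v}" using ball4_heavy_zone[of v] \<open>u \<noteq> v\<close> by blast
      then show ?thesis using b34 by blast
    next
      case 2
      then have "{u \<in> A. \<tau> u < \<tau> v} \<inter> ball 3 {v} = {}" "card (common v {u \<in> A. \<tau> u < \<tau> v}) \<le> 1"
        using ad v unfolding admissible_def by auto
      then show ?thesis using u 2 by blast
    next
      case 3
      then have "{u \<in> A. \<tau> u < \<tau> v} \<inter> ball 4 {v} = {}"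
        using ad v unfolding admissible_def by auto
      then show ?thesis using u b34 by blast
    qed
  qed
  have apart: "u \<notin> ball 3 {v}" if "u \<in> Xn" "v \<in> Xn" "u \<noteq> v" for u v
    using later[of u v] later[of v u] cmp[of u v] that ball_sym[of u 3 v] by (auto simp: Xn_def)
  have pureL: "u \<notin> pure_zone v" if "u \<in> A" "v \<in> Xp" "\<tau> u < \<tau> v" for u v
  proof -
    have "{u \<in> A. \<tau> u < \<tau> v} \<inter> pure_zone v = {}"
      using adm that(2) unfolding admissible_def Xp_def by auto
    then show ?thesis using that by blast
  qed
  define Z where "Z x = insert x (N x) \<union> (if x \<in> Xp then pure_cyc x else {})" for x
  have Zn: "Z x = insert x (N x)" if "x \<in> Xn" for x using that by (simp add: Z_def Xn_def Xp_def)
  have Zp: "ball 3 (Z x) = pure_zone x" if "x \<in> Xp" for x using that by (simp add: Z_def pure_zone_def)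
  have b1: "ball 1 {x} \<subseteq> ball 3 {x}" for x by (rule ball_le) simp
  have near: "z \<in> ball 3 {x}" if "x \<in> A" "z \<in> Z x" for x z
    using that pure_near[of x z] star_1[of z x] b1[of x] unfolding Z_def Xp_def
    by (cases "pure x") (simp_all del: ball.simps, blast)
  have path3: "x \<in> ball 3 {y}" if "p \<in> insert x (N x)" "q \<in> insert y (N y)" "p = q \<or> E p q" for x y p q
  proof -
    have "p \<in> ball 2 {y}"
    proof -
      have q: "q \<in> ball 1 {y}" using star_1 that(2) .
      have "ball 1 {y} \<subseteq> ball 2 {y}" by (rule ball_le) simp
      moreover have "p \<in> ball (Suc 1) {y}" if "E q p" using ball_step[OF q that] .
      ultimately show ?thesis using that(3) q sym by (auto simp: numeral_2_eq_2 simp del: ball.simps)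
    qed
    moreover have "x \<in> ball 1 {p}" using ball_sym star_1[OF that(1)] by blast
    ultimately show ?thesis using ball_trans[of p 2 "{y}" 1] by (auto simp del: ball.simps)
  qed
  have disj: "Z x \<inter> Z y = {}" if xy: "x \<in> A" "y \<in> A" "\<tau> x < \<tau> y" for x y
  proof (rule ccontr)
    assume "Z x \<inter> Z y \<noteq> {}"
    then obtain z where z: "z \<in> Z x" "z \<in> Z y" by blast
    show False
    proof (cases "pure y")
      case True
      then have "y \<in> Xp" using xy by (simp add: Xp_def)
      moreover have "x \<in> ball 3 (Z y)" using ball_sym_set[OF z(2) near[OF xy(1) z(1)]] .
      ultimately show False using pureL[of x y] xy Zp by blast
    next
      case False
      moreover have "\<not> pure x" using ord[OF xy(2,1)] xy(3) False by auto
      ultimately have n: "x \<in> Xn" "y \<in> Xn" using xy by (auto simp: Xn_def)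
      then have "x \<in> ball 3 {y}" using path3[of z x z y] z Zn by blast
      then show False using apart[OF n] xy(3) by blast
    qed
  qed
  define pair where "pair v y z \<longleftrightarrow> y \<in> Xn \<and> z \<in> Xn \<and> \<tau> y < \<tau> z \<and> v \<in> N2 y \<and> v \<in> N2 z" for v y z
  have pairW: "z \<in> W \<and> card (common z {u \<in> A. \<tau> u < \<tau> z}) \<le> 1 \<and> (v, y) \<in> common z {u \<in> A. \<tau> u < \<tau> z}"
    if p: "pair v y z" for v y z
  proof -
    have yz: "y \<in> Xn" "z \<in> Xn" "\<tau> y < \<tau> z" "v \<in> N2 y" "v \<in> N2 z" using p by (auto simp: pair_def)
    have "v \<in> ball 2 {z}" using yz(5) ball_path2 in_N2 by blast
    moreover have "y \<in> ball 2 {v}" using yz(4) N2_sym[of v y] ball_path2[of v _ y] in_N2[of y v] by blast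
    ultimately have "y \<in> ball 4 {z}" using ball_trans[of v 2 "{z}" 2] by (auto simp del: ball.simps)
    then show ?thesis using later[OF yz(1-3)] yz by (auto simp: common_def Xn_def)
  qed
  \<comment> \<open>The later member z of such a pair lies in \<open>W\<close>, and members of
    \<open>Xn\<close> are too far apart for two of them to lie in \<open>W\<close>; for this z,
    \<open>common\<close> admits a single v and y. So at most one vertex sees two members.\<close>
  have uniq: "v = v' \<and> y = y' \<and> z = z'" if p: "pair v y z" "pair v' y' z'" for v y z v' y' z'
  proof -
    have "z \<in> ball 3 {z'}" using pairW[OF p(1)] pairW[OF p(2)] W by blast
    then have z: "z = z'" using apart[of z z'] p by (auto simp: pair_def)
    have "(v, y) = (v', y')"
      using pairW[OF p(1)] pairW[OF p(2)] fin_common z by (metis One_nat_def card_le_Suc0_iff_eq)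
    then show ?thesis using z by simp
  qed
  \<comment> \<open>If no vertex sees two members, an arbitrary value serves.\<close>
  define w0 where "w0 = (SOME v. \<exists>y z. pair v y z)"
  have w0: "\<exists>y z. pair w0 y z" if "pair v y z" for v y z
    using that unfolding w0_def by (intro someI_ex[of "\<lambda>v. \<exists>y z. pair v y z"]) blast
  have Xcmp: "pair v y z \<or> pair v z y" if "y \<in> Xn" "z \<in> Xn" "y \<noteq> z" "v \<in> N2 y" "v \<in> N2 z" for v y z
    using cmp[of y z] that by (auto simp: pair_def Xn_def)
  have XA: "Xn \<union> Xp \<subseteq> A" by (auto simp: Xn_def Xp_def)
  have "packing E V Xn Xp pure_cyc \<sigma> w0"
  proof (unfold_locales, goal_cases)
    case 1 then show ?case by (rule con)
  next
    case 2 then show ?case using A by (auto simp: Xn_def Xp_def)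
  next
    case 3 then show ?case by (auto simp: Xn_def Xp_def)
  next
    case (4 x)
    then have x: "pure x" "x \<in> A" by (auto simp: Xp_def)
    then have C: "odd_cyc_off x (pure_cyc x)" "card (pure_cyc x - N2 x) \<le> 1" using pure_cyc by auto
    then have "finite (pure_cyc x)" by (simp add: odd_cyc_off_def ind_cyc_def)
    moreover have "\<not> pure_cyc x \<subseteq> N2 x" using nofull[OF x(2)] C by (auto simp: full_def)
    ultimately have "card (pure_cyc x - N2 x) \<noteq> 0" by auto
    then show ?case using C by linarith
  next
    case (5 x y)
    then have "x \<in> A" "y \<in> A" using XA by auto
    then have "Z x \<inter> Z y = {}" using disj[of x y] disj[of y x] cmp[of x y] 5 by blast
    then show ?case by (simp add: Z_def)
  next
    case (6 x y u v)
    then show ?case using path3[of u x v y] apart by blast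
  next
    case (7 x y)
    then have a: "x \<in> A" "y \<in> A" "pure x" "\<not> pure y" by (auto simp: Xn_def Xp_def)
    then have "y \<notin> pure_zone x" using pureL[of y x] 7 ord[of y x] by blast
    then show ?case by (simp add: pure_zone_def)
  next
    case (8 v y z)
    show ?case
    proof (rule ccontr)
      assume "y \<noteq> z"
      then obtain y' z' where p: "pair v y' z'" using Xcmp 8 by blast
      then obtain y'' z'' where "pair w0 y'' z''" using w0 by blast
      then show False using uniq[OF p] 8 by blast
    qed
  next
    case 9
    show ?case
    proof (cases "\<exists>y z. pair w0 y z")
      case True
      then obtain y z where p: "pair w0 y z" by blast
      have "t \<in> {y, z}" if t: "t \<in> Xn" "w0 \<in> N2 t" for t
      proof (cases "t = y")
        case False
        have "y \<in> Xn" "w0 \<in> N2 y" using p by (auto simp: pair_def)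
        then show ?thesis using Xcmp[of t y w0] t False uniq[OF p] by blast
      qed simp
      then have "{y \<in> Xn. w0 \<in> N2 y} \<subseteq> {y, z}" by blast
      then have "card {y \<in> Xn. w0 \<in> N2 y} \<le> card {y, z}" by (intro card_mono) auto
      also have "\<dots> \<le> 2" by (simp add: card_insert_if)
      finally show ?thesis .
    next
      case False
      have "finite {y \<in> Xn. w0 \<in> N2 y}" using finA by (simp add: Xn_def)
      moreover have "a = b" if "a \<in> {y \<in> Xn. w0 \<in> N2 y}" "b \<in> {y \<in> Xn. w0 \<in> N2 y}" for a b
        using Xcmp[of a b w0] that False by blast
      ultimately have "card {y \<in> Xn. w0 \<in> N2 y} \<le> Suc 0" by (subst card_le_Suc0_iff_eq) auto
      then show ?thesis by simp
    qed
  next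
    case 10
    show ?case
    proof (rule inj_onI)
      fix u v assume uv: "u \<in> Xn" "v \<in> Xn" "\<sigma> u = \<sigma> v"
      then have "\<tau> u < T" "\<tau> v < T" using T by (auto simp: Xn_def)
      then have "\<tau> u = \<tau> v" using uv(3) by (auto simp: \<sigma>_def split: if_splits)
      then show "u = v" using inj uv by (auto simp: inj_on_def Xn_def)
    qed
  next
    case (11 f C)
    then have "\<not> card (C - N2 f) \<le> 1" by (auto simp: Xn_def pure_def)
    then show ?case by simp
  next
    case (12 f C a y)
    then have f: "heavy f" "f \<in> A" "y \<in> A" by (auto simp: heavy_def Xn_def)
    have z: "y \<in> heavy_zone f" using heavy_zone_owner 12 by blast
    have "\<not> \<tau> y < \<tau> f"
    proof
      assume "\<tau> y < \<tau> f"
      then show False using adm[OF f(2)] f z 12(1) unfolding admissible_def Xn_def by auto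
    qed
    then have "\<tau> f < \<tau> y" using cmp[of f y] f 12 by blast
    then show ?case using T[OF f(2)] T[OF f(3)] f(1) by (auto simp: \<sigma>_def)
  next
    case (13 x y)
    then have "card {x, y} \<le> card A" using finA by (intro card_mono) (auto simp: Xp_def)
    then show ?case using small 13 by simp
  qed
  then interpret packing E V Xn Xp pure_cyc \<sigma> w0 .
  have "A = Xn \<union> Xp" by (auto simp: Xn_def Xp_def)
  then show ?thesis using run_exists by simp
qed

lemma fcol_no_full:
  assumes con: "conn E V" and nofull: "\<And>v. v \<in> V \<Longrightarrow> \<not> full v"
  shows "\<exists>\<phi>. fcol E V \<phi>"
proof -
  obtain \<kappa> and \<tau> :: "'a \<Rightarrow> nat" and W where cl: "inj_on \<tau> V"
    "\<forall>u\<in>V. \<forall>v\<in>V. pure v \<longrightarrow> \<not> pure u \<longrightarrow> \<tau> u < \<tau> v" "\<forall>u\<in>W. \<forall>v\<in>W. u \<in> ball 3 {v}"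
    "\<forall>v\<in>V. \<kappa> v < (42::nat) \<and> admissible W v {u \<in> V. \<tau> u < \<tau> v \<and> \<kappa> u = \<kappa> v}"
    "36 < card V \<or> inj_on \<kappa> V"
    using exists_classes[OF con] by (elim exE conjE)
  have "\<exists>D. run D \<and> (\<forall>v\<in>{v \<in> V. \<kappa> v = k}. 2 \<le> card (D v))" for k
  proof (rule run_of_class[OF con])
    show "inj_on \<tau> {v \<in> V. \<kappa> v = k}" using cl(1) by (rule inj_on_subset) auto
    show "u \<in> ball 3 {v}" if "u \<in> W" "v \<in> W" for u v using cl(3) that by blast
    show "admissible W v {u \<in> {v \<in> V. \<kappa> v = k}. \<tau> u < \<tau> v}" if "v \<in> {v \<in> V. \<kappa> v = k}" for v
    proof -
      have "{u \<in> {v \<in> V. \<kappa> v = k}. \<tau> u < \<tau> v} = {u \<in> V. \<tau> u < \<tau> v \<and> \<kappa> u = \<kappa> v}" using that by auto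
      moreover have "admissible W v {u \<in> V. \<tau> u < \<tau> v \<and> \<kappa> u = \<kappa> v}" using cl(4) that by blast
      ultimately show ?thesis by (simp only:)
    qed
    show "36 < card V \<or> card {v \<in> V. \<kappa> v = k} \<le> 1"
    proof (cases "inj_on \<kappa> V")
      case True
      then have "card {v \<in> V. \<kappa> v = k} \<le> Suc 0"
        using fin by (subst card_le_Suc0_iff_eq) (auto simp: inj_on_def)
      then show ?thesis by simp
    qed (use cl(5) in blast)
  qed (use cl nofull in auto)
  then have "\<forall>k. \<exists>D. run D \<and> (\<forall>v\<in>{v \<in> V. \<kappa> v = k}. 2 \<le> card (D v))" by (rule allI)
  from choice[OF this] obtain D where "\<forall>k. run (D k) \<and> (\<forall>v\<in>{v \<in> V. \<kappa> v = k}. 2 \<le> card (D k v))" ..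
  then have D: "\<And>k. run (D k)" "\<And>k v. v \<in> V \<Longrightarrow> \<kappa> v = k \<Longrightarrow> 2 \<le> card (D k v)" by simp_all
  have one: "1 \<le> card (D k v)" if "v \<in> V" for k v
  proof -
    have "D k v \<subseteq> {..<3}" "D k v \<noteq> {}" using D(1) that by (auto simp: run_def)
    then show ?thesis using finite_subset[of "D k v" "{..<3}"] by (simp add: Suc_le_eq card_gt_0_iff)
  qed
  show ?thesis
  proof (rule stack_colourings[where m = 42 and n = 3])
    fix v assume v: "v \<in> V"
    then have kv: "\<kappa> v < 42" using cl(4) by blast
    have "(\<Sum>k<42. card (D k v)) = card (D (\<kappa> v) v) + (\<Sum>k\<in>{..<42} - {\<kappa> v}. card (D k v))"
      using kv by (subst sum.remove[of _ "\<kappa> v"]) auto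
    moreover have "(\<Sum>k\<in>{..<42} - {\<kappa> v}. 1) \<le> (\<Sum>k\<in>{..<42} - {\<kappa> v}. card (D k v))"
      using one[OF v] by (intro sum_mono)
    moreover have "(\<Sum>k\<in>{..<42} - {\<kappa> v}. 1::nat) = 41" using kv by simp
    ultimately show "43 \<le> (\<Sum>k<42. card (D k v))" using D(2)[OF v refl] by linarith
  next
    fix k v assume "v \<in> V" then show "D k v \<subseteq> {..<3}" using D(1)[of k] by (simp add: run_def)
  next
    fix k u v assume "E u v" then show "D k u \<inter> D k v = {}" using D(1)[of k] by (simp add: run_def)
  qed simp
qed

end

section \<open>Gluing colourings\<close>

text \<open>\<open>Q\<close> is mapped into the complement of \<open>P\<close> and the other colours
  onto what is left, which makes a permutation of the colours.\<close>

lemma palette_move: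
  assumes "P \<subseteq> {..<n}" "Q \<subseteq> {..<n::nat}" "card P + card Q \<le> n"
  shows "\<exists>f. inj_on f {..<n} \<and> f ` {..<n} \<subseteq> {..<n} \<and> f ` Q \<inter> P = {}"
proof -
  have fin: "finite P" "finite Q" using assms finite_subset by blast+
  have "card Q \<le> card ({..<n} - P)" using assms fin by (simp add: card_Diff_subset)
  then obtain R where R: "R \<subseteq> {..<n} - P" "card R = card Q" "finite R"
    by (metis obtain_subset_with_card_n)
  obtain f where f: "bij_betw f Q R" using finite_same_card_bij[OF fin(2) R(3)] R(2) by auto
  have "R \<subseteq> {..<n}" using R(1) by blast
  then have "card ({..<n} - Q) = card ({..<n} - R)" using assms(2) R fin by (simp add: card_Diff_subset)
  then obtain g where g: "bij_betw g ({..<n} - Q) ({..<n} - R)"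
    using finite_same_card_bij[of "{..<n} - Q" "{..<n} - R"] by auto
  define h where "h i = (if i \<in> Q then f i else g i)" for i
  have "bij_betw h (Q \<union> ({..<n} - Q)) (R \<union> ({..<n} - R))"
    unfolding h_def using f g by (intro bij_betw_disjoint_Un) auto
  moreover have "Q \<union> ({..<n} - Q) = {..<n}" "R \<union> ({..<n} - R) = {..<n}"
    using assms(2) \<open>R \<subseteq> {..<n}\<close> by blast+
  ultimately have "bij_betw h {..<n} {..<n}" by simp
  then have "inj_on h {..<n}" "h ` {..<n} = {..<n}" by (auto simp: bij_betw_def)
  moreover have "h ` Q = f ` Q" by (intro image_cong) (simp_all add: h_def)
  then have "h ` Q \<inter> P = {}" using R(1) bij_betw_imp_surj_on[OF f] by blast
  ultimately show ?thesis by (intro exI[of _ h]) simp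
qed

text \<open>Exactly 43 colours at either end of the joining edge give 43 + 43 \<le> 126, as
  \<open>palette_move\<close> requires. Outside \<open>A\<close> any 43 colours do, which covers the
  case that no edge joins the parts.\<close>

lemma fcol_trim:
  assumes "fcol E A \<phi>"
  shows "\<exists>\<phi>'. fcol E A \<phi>' \<and> card (\<phi>' p) = 43 \<and> \<phi>' p \<subseteq> {..<126}"
proof -
  have "\<exists>P \<subseteq> {..<126}. card P = 43 \<and> (p \<in> A \<longrightarrow> P \<subseteq> \<phi> p)"
  proof (cases "p \<in> A")
    case True
    then have "43 \<le> card (\<phi> p)" "\<phi> p \<subseteq> {..<126}" using assms by (auto simp: fcol_def)
    then show ?thesis using obtain_subset_with_card_n[of 43 "\<phi> p"] by (metis subset_trans)
  next
    case False
    then show ?thesis by (intro exI[of _ "{..<43}"]) auto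
  qed
  then obtain P where P: "P \<subseteq> {..<126}" "card P = 43" "p \<in> A \<longrightarrow> P \<subseteq> \<phi> p" by blast
  have sub: "(\<phi>(p := P)) v \<subseteq> \<phi> v" if "v \<in> A" for v using P(3) that by auto
  have "fcol E A (\<phi>(p := P))"
    unfolding fcol_def
  proof (intro conjI ballI impI)
    fix v assume v: "v \<in> A"
    show "(\<phi>(p := P)) v \<subseteq> {..<126}" using assms sub[OF v] v unfolding fcol_def by blast
    show "43 \<le> card ((\<phi>(p := P)) v)" using assms P(2) v by (simp add: fcol_def)
  next
    fix u v assume uv: "u \<in> A" "v \<in> A" "E u v"
    then have "\<phi> u \<inter> \<phi> v = {}" using assms by (simp add: fcol_def)
    then show "(\<phi>(p := P)) u \<inter> (\<phi>(p := P)) v = {}" using sub[OF uv(1)] sub[OF uv(2)] by blast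
  qed
  then show ?thesis using P by (intro exI[of _ "\<phi>(p := P)"]) simp
qed

lemma fcol_glue:
  assumes "A \<inter> B = {}" and \<phi>: "fcol E A \<phi>" and \<psi>: "fcol E B \<psi>" and sym: "\<And>u v. E u v \<Longrightarrow> E v u"
    and one: "\<And>u v u' v'. u \<in> A \<Longrightarrow> v \<in> B \<Longrightarrow> E u v \<Longrightarrow> u' \<in> A \<Longrightarrow> v' \<in> B \<Longrightarrow> E u' v' \<Longrightarrow> u = u' \<and> v = v'"
  shows "\<exists>\<theta>. fcol E (A \<union> B) \<theta>"
proof -
  have "\<exists>p q. \<forall>u\<in>A. \<forall>v\<in>B. E u v \<longrightarrow> u = p \<and> v = q"
    using one by (cases "\<exists>p\<in>A. \<exists>q\<in>B. E p q") blast+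
  then obtain p q where pq: "\<And>u v. u \<in> A \<Longrightarrow> v \<in> B \<Longrightarrow> E u v \<Longrightarrow> u = p \<and> v = q" by blast
  obtain \<phi>' where a: "fcol E A \<phi>'" "card (\<phi>' p) = 43" "\<phi>' p \<subseteq> {..<126}" using fcol_trim[OF \<phi>] by blast
  obtain \<psi>' where b: "fcol E B \<psi>'" "card (\<psi>' q) = 43" "\<psi>' q \<subseteq> {..<126}" using fcol_trim[OF \<psi>] by blast
  obtain f where f: "inj_on f {..<126}" "f ` {..<126} \<subseteq> {..<126}" "f ` \<psi>' q \<inter> \<phi>' p = {}"
    using palette_move[of "\<phi>' p" 126 "\<psi>' q"] a b by auto
  define \<theta> where "\<theta> v = (if v \<in> A then \<phi>' v else f ` \<psi>' v)" for v
  have A: "\<theta> v = \<phi>' v" if "v \<in> A" for v using that by (simp add: \<theta>_def)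
  have B: "\<theta> v = f ` \<psi>' v" if "v \<in> B" for v using that assms(1) by (auto simp: \<theta>_def)
  have \<psi>sub: "\<psi>' v \<subseteq> {..<126}" if "v \<in> B" for v using b(1) that by (simp add: fcol_def)
  have "\<theta> v \<subseteq> {..<126} \<and> 43 \<le> card (\<theta> v)" if "v \<in> A \<union> B" for v
  proof (cases "v \<in> A")
    case True then show ?thesis using a(1) A by (simp add: fcol_def)
  next
    case False
    then have v: "v \<in> B" using that by blast
    have "card (f ` \<psi>' v) = card (\<psi>' v)" using inj_on_subset[OF f(1) \<psi>sub[OF v]] by (rule card_image)
    moreover have "f ` \<psi>' v \<subseteq> {..<126}" using f(2) \<psi>sub[OF v] by blast
    ultimately show ?thesis using b(1) v B[OF v] by (simp add: fcol_def)
  qed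
  moreover have "\<theta> u \<inter> \<theta> v = {}" if uv: "u \<in> A \<union> B" "v \<in> A \<union> B" "E u v" for u v
  proof -
    have cross: "\<theta> u \<inter> \<theta> v = {}" if "u \<in> A" "v \<in> B" "E u v" for u v
      using pq[OF that] f(3) A[OF that(1)] B[OF that(2)] by auto
    consider "u \<in> A" "v \<in> A" | "u \<in> B" "v \<in> B" | "u \<in> A" "v \<in> B" | "v \<in> A" "u \<in> B" using uv by blast
    then show ?thesis
    proof cases
      case 1 then show ?thesis using a(1) A uv(3) by (simp add: fcol_def)
    next
      case 2
      then have "\<psi>' u \<inter> \<psi>' v = {}" using b(1) uv(3) by (simp add: fcol_def)
      then have "f ` \<psi>' u \<inter> f ` \<psi>' v = {}"
        using inj_on_image_Int[OF f(1) \<psi>sub[OF 2(1)] \<psi>sub[OF 2(2)]] by simp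
      then show ?thesis using B 2 by simp
    next
      case 3 then show ?thesis using cross uv(3) by blast
    next
      case 4 then show ?thesis using cross sym[OF uv(3)] by blast
    qed
  qed
  ultimately show ?thesis unfolding fcol_def by blast
qed

context subcubic
begin

lemma restrict: "A \<subseteq> V \<Longrightarrow> subcubic (\<lambda>u v. E u v \<and> u \<in> A \<and> v \<in> A) A"
proof (unfold_locales, goal_cases)
  case (5 v)
  have "card (nbs (\<lambda>u v. E u v \<and> u \<in> A \<and> v \<in> A) A v) \<le> card (nbs E V v)"
    using 5 fin by (intro card_mono) (auto simp: nbs_def)
  then show ?case using deg3[of v] by simp
next
  case 3 then show ?case using fin by (rule finite_subset)
next
  case (6 u v w) then show ?case using tri by blast
qed (use sym irr in simp_all)

section \<open>Five-cycles in a second neighbourhood and the graph on nine vertices\<close>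

lemma five_cycle:
  assumes cyc: "ind_cyc E C" and five: "card C = 5" and c0: "c0 \<in> C"
  obtains c1 c2 c3 c4 where "C = {c0, c1, c2, c3, c4}" "distinct [c0, c1, c2, c3, c4]"
    "nbs E C c0 = {c1, c4}" "nbs E C c1 = {c0, c2}" "nbs E C c2 = {c1, c3}"
    "nbs E C c3 = {c4, c2}" "nbs E C c4 = {c0, c3}"
proof -
  let ?R = "nbs E C"
  have con: "conn E C" and two: "\<And>v. v \<in> C \<Longrightarrow> card (?R v) = 2" using cyc by (auto simp: ind_cyc_def)
  have R: "u \<in> ?R v \<longleftrightarrow> u \<in> C \<and> E v u" for u v by (auto simp: nbs_def)
  have other: "\<exists>b. ?R v = {a, b} \<and> a \<noteq> b \<and> b \<in> C \<and> E v b" if v: "v \<in> C" "a \<in> C" "E v a" for v a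
  proof -
    have "a \<in> ?R v" using R v by blast
    then obtain b where "?R v = {a, b}" "a \<noteq> b" using two[OF v(1)] by (metis card_2_iff doubleton_eq_iff insertE singletonD)
    then show ?thesis using R[of b v] by auto
  qed
  obtain c1 c4 where e0: "?R c0 = {c1, c4}" "c1 \<noteq> c4" using two[OF c0] by (meson card_2_iff)
  then have c14: "c1 \<in> C" "c4 \<in> C" "E c0 c1" "E c0 c4" using R[of c1 c0] R[of c4 c0] by auto
  obtain c2 where c2: "?R c1 = {c0, c2}" "c0 \<noteq> c2" "c2 \<in> C" "E c1 c2"
    using other[of c1 c0] c14 c0 sym by blast
  obtain c3 where c3: "?R c4 = {c0, c3}" "c0 \<noteq> c3" "c3 \<in> C" "E c4 c3"
    using other[of c4 c0] c14 c0 sym by blast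
  have ne: "c0 \<noteq> c1" "c0 \<noteq> c4" "c1 \<noteq> c2" "c4 \<noteq> c3" using c14 c2 c3 irr by blast+
  have "c2 \<noteq> c4" using tri[OF c14(3) c2(4)] sym[OF c14(4)] by blast
  have "c3 \<noteq> c1" using tri[OF c14(4) c3(4)] sym[OF c14(3)] by blast
  \<comment> \<open>Otherwise c0, c1, c2, c4 would form a closed cycle of length four.\<close>
  have "c2 \<noteq> c3"
  proof
    assume eq: "c2 = c3"
    have "{c1, c4} \<subseteq> ?R c2" using R c14 c2 c3 eq sym by blast
    moreover have "finite (?R c2)" using two[OF c2(3)] by (intro card_ge_0_finite) simp
    ultimately have R2: "?R c2 = {c1, c4}" using two[OF c2(3)] e0(2) by (intro card_subset_eq[symmetric]) auto
    let ?T = "{c0, c1, c2, c4}"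
    have "card ?T \<le> 4" by (simp add: card_insert_if)
    then have "?T \<noteq> C" using five by auto
    moreover have "?T \<subseteq> C" using c0 c14 c2 by blast
    ultimately obtain v u where vu: "v \<in> ?T" "u \<in> C - ?T" "E v u"
      using con unfolding conn_def by (metis insert_not_empty)
    then have "u \<in> ?R v" using R by blast
    then show False using vu e0 c2(1) c3(1) R2 eq by auto
  qed
  have dist: "distinct [c0, c1, c2, c3, c4]"
    using ne c2 c3 e0 \<open>c2 \<noteq> c4\<close> \<open>c3 \<noteq> c1\<close> \<open>c2 \<noteq> c3\<close> by auto
  have finC: "finite C" using five by (intro card_ge_0_finite) simp
  have "set [c0, c1, c2, c3, c4] = C"
    using c0 c14 c2 c3 five finC distinct_card[OF dist] by (intro card_subset_eq) auto
  then have C: "C = {c0, c1, c2, c3, c4}" by simp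
  obtain b where b: "?R c2 = {c1, b}" "c1 \<noteq> b" "b \<in> C" "E c2 b" using other[of c2 c1] c14 c2 sym by blast
  have "c2 \<noteq> b" using b(4) irr by blast
  have "b \<noteq> c0" using R[of c2 c0] e0 b sym dist c2 by auto
  have "b \<noteq> c4" using R[of c2 c4] c3 b sym dist c2 by auto
  have "b = c3" using b C \<open>b \<noteq> c0\<close> \<open>b \<noteq> c4\<close> \<open>c2 \<noteq> b\<close> by auto
  obtain d where d: "?R c3 = {c4, d}" "c4 \<noteq> d" "d \<in> C" "E c3 d" using other[of c3 c4] c14 c3 sym by blast
  have "c2 \<in> ?R c3" using R b \<open>b = c3\<close> sym c2 by blast
  then have "d = c2" using d \<open>c2 \<noteq> c4\<close> by auto
  show ?thesis using that[OF C dist e0(1) c2(1)] b d c3(1) \<open>b = c3\<close> \<open>d = c2\<close> by blast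
qed

lemma full_cycle_card:
  assumes "odd_cyc_off x C" "C \<subseteq> N2 x" shows "card C = 5"
proof -
  have "5 \<le> card C" "odd (card C)" using assms odd_cyc_card by (auto simp: odd_cyc_off_def)
  moreover have "card C \<le> 6" using card_mono[OF fin_N2 assms(2)] card_N2[of x] by simp
  moreover have "card C \<noteq> 6" using \<open>odd (card C)\<close> by auto
  ultimately show ?thesis by linarith
qed

text \<open>The five vertices of the cycle use up five of the at most six edges leaving the star of \<open>x\<close>.\<close>

lemma full_boundary:
  assumes C: "odd_cyc_off x C" "C \<subseteq> N2 x"
  defines "Z \<equiv> insert x (N x) \<union> C"
  assumes out: "u \<in> Z" "v \<notin> Z" "E u v" "u' \<in> Z" "v' \<notin> Z" "E u' v'"
  shows "u = u' \<and> v = v'"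
proof -
  define S where "S = (SIGMA u:N x. N u - {x})"
  define I where "I = {p \<in> S. snd p \<in> C}"
  define O' where "O' = {p \<in> S. snd p \<notin> C}"
  have finS: "finite S" by (simp add: S_def)
  have "card S = (\<Sum>u\<in>N x. card (N u - {x}))" by (simp add: S_def)
  also have "\<dots> \<le> (\<Sum>u\<in>N x. 2)" using card_N_minus sym by (intro sum_mono) (auto simp: in_N)
  also have "\<dots> \<le> 6" using card_N[of x] by simp
  finally have "card S \<le> 6" .
  moreover have "C \<subseteq> snd ` I"
  proof
    fix c assume c: "c \<in> C"
    then obtain w where "E x w" "E w c" "c \<noteq> x" using C(2) in_N2 by blast
    then have "(w, c) \<in> I" using c by (simp add: I_def S_def in_N)
    then show "c \<in> snd ` I" by force
  qed
  then have "card C \<le> card (snd ` I)" using finS by (intro card_mono) (auto simp: I_def)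
  then have "5 \<le> card I"
    using full_cycle_card[OF C] card_image_le[of I snd] finS by (simp add: I_def)
  moreover have "card S = card I + card O'"
    using finS by (subst card_Un_disjoint[symmetric]) (auto simp: I_def O'_def intro: arg_cong[of _ _ card])
  ultimately have "card O' \<le> Suc 0" by linarith
  moreover have "finite O'" using finS by (simp add: O'_def)
  ultimately have O1: "p = p'" if "p \<in> O'" "p' \<in> O'" for p p'
    using that card_le_Suc0_iff_eq[of O'] by blast
  have "(u, v) \<in> O'" if "u \<in> Z" "v \<notin> Z" "E u v" for u v
  proof -
    have "u \<noteq> x" using that by (auto simp: Z_def in_N)
    moreover have "u \<notin> C"
    proof
      assume "u \<in> C"
      then have "N u \<subseteq> C \<union> N x" using cyc_N2_nbs[OF C(1)] C(2) by blast
      then show False using that by (auto simp: Z_def in_N)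
    qed
    ultimately show ?thesis using that by (auto simp: O'_def S_def Z_def in_N)
  qed
  then have "(u, v) = (u', v')" using O1 out by blast
  then show ?thesis by simp
qed

text \<open>Each cycle vertex has one neighbour in \<open>N x\<close>, and adjacent cycle vertices
  have different ones by triangle-freeness. At most three neighbours of \<open>x\<close> share five
  cycle vertices, at most two each, and this determines the graph.\<close>

lemma fcol_full:
  assumes C: "odd_cyc_off x C" "C \<subseteq> N2 x" and V: "V = insert x (N x) \<union> C"
  shows "\<exists>\<phi>. fcol E V \<phi>"
proof -
  have cyc: "ind_cyc E C" "C \<subseteq> V" and off: "x \<notin> C" "C \<inter> N x = {}" and finC: "finite C"
    using C(1) by (auto simp: odd_cyc_off_def ind_cyc_def)
  have five: "card C = 5" by (rule full_cycle_card[OF C])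
  have "\<forall>c\<in>C. \<exists>u. u \<in> N x \<and> E u c" using C(2) by (auto simp: in_N2 in_N)
  then obtain g where g: "\<And>c. c \<in> C \<Longrightarrow> g c \<in> N x" "\<And>c. c \<in> C \<Longrightarrow> E (g c) c" by metis
  have Nc: "N c = nbs E C c \<union> {g c}" if c: "c \<in> C" for c
  proof -
    have gc: "g c \<in> N c - C" using g[OF c] off sym by (auto simp: in_N)
    moreover have "card (N c - C) \<le> Suc 0" using cyc_outer[OF cyc c] by simp
    moreover have "finite (N c - C)" by simp
    ultimately have "N c - C = {g c}" using card_le_Suc0_iff_eq[of "N c - C"] by blast
    moreover have "N c \<inter> C = nbs E C c" by (auto simp: nbs_def in_N)
    ultimately show ?thesis by blast
  qed
  have adj: "g c \<noteq> g d" if "c \<in> C" "d \<in> nbs E C c" for c d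
  proof
    assume eq: "g c = g d"
    have d: "d \<in> C" "E c d" using that(2) by (auto simp: nbs_def)
    have "E d (g c)" unfolding eq by (rule sym[OF g(2)[OF d(1)]])
    then show False using tri[OF d(2)] g(2)[OF that(1)] by blast
  qed
  \<comment> \<open>Five is odd, so some neighbour of x is adjacent to exactly one cycle vertex; the
    labelling of the cycle starts there.\<close>
  have "\<exists>c0\<in>C. \<forall>c\<in>C. g c = g c0 \<longrightarrow> c = c0"
  proof (rule ccontr)
    assume no: "\<not> ?thesis"
    have ev: "even (card {c \<in> C. g c = u})" for u
    proof -
      let ?G = "{c \<in> C. g c = u}"
      have "?G \<subseteq> N u - {x}"
      proof
        fix c assume "c \<in> ?G"
        then have c: "c \<in> C" "g c = u" by simp_all
        then have "c \<noteq> x" using off(1) by blast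
        then show "c \<in> N u - {x}" using g(2)[OF c(1)] c(2) by (simp add: in_N)
      qed
      then have "card ?G \<le> card (N u - {x})" by (intro card_mono) auto
      moreover have "card (N u - {x}) \<le> 2" if ne: "?G \<noteq> {}"
      proof -
        obtain c where "c \<in> C" "u = g c" using ne by blast
        then have "E x u" using g(1) in_N by blast
        then show ?thesis by (rule card_N_minus[OF sym])
      qed
      moreover have "card ?G \<noteq> 1"
      proof
        assume "card ?G = 1"
        then obtain c0 where G: "?G = {c0}" by (rule card_1_singletonE)
        then have c0: "c0 \<in> C" "g c0 = u" by blast+
        have "c = c0" if "c \<in> C" "g c = g c0" for c
        proof -
          have "c \<in> ?G" using that c0 by simp
          then show ?thesis unfolding G by simp
        qed
        then show False using no c0(1) by meson
      qed
      moreover have "card ?G = 0" if "?G = {}" unfolding that by simp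
      ultimately have "card ?G = 0 \<or> card ?G = 2" by linarith
      then show ?thesis by auto
    qed
    have "card C = card (\<Union>u\<in>N x. {c \<in> C. g c = u})" using g(1) by (intro arg_cong[of _ _ card]) auto
    also have "\<dots> = (\<Sum>u\<in>N x. card {c \<in> C. g c = u})" using finC by (intro card_UN_disjoint) auto
    finally have "even (card C)" using ev by (simp add: dvd_sum)
    then show False using five by simp
  qed
  then obtain c0 where c0: "c0 \<in> C" and uniq: "\<And>c. c \<in> C \<Longrightarrow> g c = g c0 \<Longrightarrow> c = c0" by blast
  obtain c1 c2 c3 c4 where cs: "C = {c0, c1, c2, c3, c4}" "distinct [c0, c1, c2, c3, c4]"
    "nbs E C c0 = {c1, c4}" "nbs E C c1 = {c0, c2}" "nbs E C c2 = {c1, c3}"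
    "nbs E C c3 = {c4, c2}" "nbs E C c4 = {c0, c3}"
    using five_cycle[OF cyc(1) five c0] by blast
  have inC: "c1 \<in> C" "c2 \<in> C" "c3 \<in> C" "c4 \<in> C" using cs(1) by auto
  define u1 u2 u3 where "u1 = g c1" and "u2 = g c2" and "u3 = g c0"
  have u13: "u1 \<noteq> u3" "u2 \<noteq> u3" "g c3 \<noteq> u3" "g c4 \<noteq> u3"
    using uniq inC cs(2) unfolding u1_def u2_def u3_def by auto
  have u12: "u1 \<noteq> u2" "g c3 \<noteq> u2" "g c3 \<noteq> g c4"
    using adj[OF inC(1), of c2] adj[OF inC(2), of c3] adj[OF inC(3), of c4] cs unfolding u1_def u2_def by auto
  have "{u1, u2, u3} \<subseteq> N x" using g(1) inC c0 by (auto simp: u1_def u2_def u3_def)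
  moreover have "card {u1, u2, u3} = 3" using u13 u12 by simp
  ultimately have Nx: "N x = {u1, u2, u3}" using card_N[of x] by (metis card_seteq fin_N)
  \<comment> \<open>The path c1, c2, c3, c4 has to alternate between the two remaining neighbours of
    x.\<close>
  have g3: "g c3 = u1" using g(1)[OF inC(3)] Nx u13 u12 by auto
  have g4: "g c4 = u2" using g(1)[OF inC(4)] Nx u13 u12 g3 by auto
  have VV: "V = {x, u1, u2, u3, c0, c1, c2, c3, c4}" using V Nx cs(1) by auto
  have "x \<notin> N x" using irr by (simp add: in_N)
  then have dist: "distinct [x, u1, u2, u3, c0, c1, c2, c3, c4]"
    using cs(1,2) off u13 u12 Nx by auto
  \<comment> \<open>a colouring of the only possible graph on nine vertices by triples from eight colours\<close>
  define D where "D v = (if v = x then {1, 5, 7} else if v = u1 then {0, 2, 6} else if v = u2 then {2, 3, 4}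
    else if v = u3 then {3, 4, 6} else if v = c0 then {0, 1, 2} else if v = c1 then {3, 4, 5}
    else if v = c2 then {0, 6, 7} else if v = c3 then {1, 3, 4} else {5, 6, 7::nat})" for v
  have Dv: "D x = {1, 5, 7}" "D u1 = {0, 2, 6}" "D u2 = {2, 3, 4}" "D u3 = {3, 4, 6}" "D c0 = {0, 1, 2}"
    "D c1 = {3, 4, 5}" "D c2 = {0, 6, 7}" "D c3 = {1, 3, 4}" "D c4 = {5, 6, 7}"
    using dist by (auto simp: D_def)
  have nb: "N x = {u1, u2, u3}" "N c0 = {c1, c4, u3}" "N c1 = {c0, c2, u1}" "N c2 = {c1, c3, u2}"
    "N c3 = {c4, c2, u1}" "N c4 = {c0, c3, u2}"
    using Nx Nc c0 inC cs g3 g4 unfolding u1_def u2_def u3_def by auto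
  have base: "D u \<inter> D v = {}" if "u \<in> {x, c0, c1, c2, c3, c4}" "v \<in> N u" for u v
    using that by (auto simp: nb Dv)
  have proper: "D u \<inter> D v = {}" if "E u v" for u v
  proof (cases "u \<in> N x \<and> v \<in> N x")
    case True
    then show ?thesis using tri[of x u v] that sym by (auto simp: in_N)
  next
    case False
    moreover have "u \<in> V" "v \<in> V" using E_V that by blast+
    ultimately consider "u \<in> {x, c0, c1, c2, c3, c4}" | "v \<in> {x, c0, c1, c2, c3, c4}"
      using V cs(1) by blast
    then show ?thesis using base[of u v] base[of v u] that sym[OF that] by cases (auto simp: in_N)
  qed
  \<comment> \<open>Fifteen copies use 15 * 8 = 120 colours and give 15 * 3 = 45 to each
    vertex.\<close>
  show ?thesis
  proof (rule stack_colourings[where m = 15 and n = 8 and D = "\<lambda>_. D"])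
    fix v show "D v \<subseteq> {..<8}" by (auto simp: D_def)
    have "card (D v) = 3" by (simp add: D_def)
    then show "43 \<le> (\<Sum>k<15::nat. card (D v))" by simp
  qed (use proper in auto)
qed

end

text \<open>\<open>E\<close> varies in the induction: an induced subgraph is \<open>subcubic\<close>
  only for the relation cut down to its vertices, whereas \<open>fcol\<close> does not look outside
  them, so colourings pass back to \<open>E\<close>.\<close>

theorem fcol_exists: "subcubic E V \<Longrightarrow> \<exists>\<phi>. fcol E V \<phi>"
proof (induction "card V" arbitrary: E V rule: less_induct)
  case less
  interpret subcubic E V by (rule less.prems)
  have smaller: "\<exists>\<phi>. fcol E A \<phi>" if A: "A \<subset> V" for A
  proof -
    have "card A < card V" using fin A by (rule psubset_card_mono)
    then have "\<exists>\<phi>. fcol (\<lambda>u v. E u v \<and> u \<in> A \<and> v \<in> A) A \<phi>" using restrict[of A] A by (intro less.hyps) auto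
    then show ?thesis by (simp add: fcol_def cong: ball_cong)
  qed
  have split: "\<exists>\<phi>. fcol E V \<phi>" if Z: "Z \<subset> V" "Z \<noteq> {}"
    and one: "\<And>u v u' v'. u \<in> Z \<Longrightarrow> v \<in> V - Z \<Longrightarrow> E u v \<Longrightarrow> u' \<in> Z \<Longrightarrow> v' \<in> V - Z \<Longrightarrow> E u' v' \<Longrightarrow> u = u' \<and> v = v'" for Z
  proof -
    obtain \<phi> where \<phi>: "fcol E Z \<phi>" using smaller Z by blast
    have "V - Z \<subset> V" using Z by blast
    then obtain \<psi> where \<psi>: "fcol E (V - Z) \<psi>" using smaller by blast
    have "\<exists>\<theta>. fcol E (Z \<union> (V - Z)) \<theta>" using \<phi> \<psi> sym one by (intro fcol_glue) blast+
    moreover have "Z \<union> (V - Z) = V" using Z by blast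
    ultimately show ?thesis by simp
  qed
  show ?case
  proof (cases "conn E V")
    case False
    then obtain T where "T \<subseteq> V" "T \<noteq> {}" "T \<noteq> V" "\<And>u v. u \<in> T \<Longrightarrow> v \<in> V - T \<Longrightarrow> \<not> E u v"
      unfolding conn_def by blast
    then show ?thesis using split[of T] by blast
  next
    case con: True
    show ?thesis
    proof (cases "\<exists>x\<in>V. full x")
      case False then show ?thesis using fcol_no_full[OF con] by blast
    next
      case True
      then obtain x C where x: "x \<in> V" and C: "odd_cyc_off x C" "C \<subseteq> N2 x" by (auto simp: full_def)
      let ?Z = "insert x (N x) \<union> C"
      have ZV: "?Z \<subseteq> V" using x E_V C(1) by (auto simp: in_N odd_cyc_off_def)
      show ?thesis
      proof (cases "V = ?Z")
        case True then show ?thesis by (rule fcol_full[OF C])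
      next
        case False
        show ?thesis
        proof (rule split)
          show "?Z \<subset> V" using False ZV by blast
          fix u v u' v' assume "u \<in> ?Z" "v \<in> V - ?Z" "E u v" "u' \<in> ?Z" "v' \<in> V - ?Z" "E u' v'"
          then show "u = u' \<and> v = v'" by (intro full_boundary[OF C]) blast+
        qed simp
      qed
    qed
  qed
qed

section \<open>Back to fractional colourings\<close>

lemma fractional_coloring_of_fcol:
  fixes G :: "'a pair_pre_digraph"
  assumes "pair_graph G" and \<phi>: "fcol (\<lambda>u v. (u, v) \<in> parcs G) (pverts G) \<phi>"
  shows "\<exists>f. fractional_coloring G (126 / 43) f"
proof -
  interpret pair_graph G by fact
  define I where "I = independent_sets G"
  define A where "A i = {v \<in> pverts G. i \<in> \<phi> v}" for i
  define m where "m S = card {i \<in> {..<126}. A i = S}" for S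
  \<comment> \<open>An independent set may be the class of more than 43 colours. The cap keeps the
    weights in [0,1], and a set whose weight is capped covers each of its vertices alone.\<close>
  define f where "f S = min 1 (real (m S) / 43)" for S
  have finI: "finite I" unfolding I_def using pair_finite_verts by (rule finite_independent_sets)
  have AI: "A i \<in> I" for i
  proof -
    have "(u, v) \<notin> parcs G" if "u \<in> A i" "v \<in> A i" for u v
      using \<phi> that unfolding fcol_def A_def by blast
    then show ?thesis by (auto simp: I_def independent_sets_def A_def)
  qed
  have msum: "(\<Sum>S\<in>J. m S) = card {i \<in> {..<126}. A i \<in> J}" if "J \<subseteq> I" for J
  proof -
    have "(\<Sum>S\<in>J. m S) = card (\<Union>S\<in>J. {i \<in> {..<126}. A i = S})"
      unfolding m_def using finI that finite_subset by (intro card_UN_disjoint[symmetric]) auto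
    also have "(\<Union>S\<in>J. {i \<in> {..<126}. A i = S}) = {i \<in> {..<126}. A i \<in> J}" by auto
    finally show ?thesis .
  qed
  have f01: "0 \<le> f S" "f S \<le> 1" "f S \<le> real (m S) / 43" for S by (auto simp: f_def)
  have "(\<Sum>S\<in>I. f S) \<le> (\<Sum>S\<in>I. real (m S) / 43)" using f01 by (intro sum_mono)
  also have "\<dots> = real (\<Sum>S\<in>I. m S) / 43" by (simp add: sum_divide_distrib)
  also have "(\<Sum>S\<in>I. m S) \<le> card {..<126::nat}" unfolding msum[OF subset_refl] by (intro card_mono) auto
  then have "real (\<Sum>S\<in>I. m S) / 43 \<le> 126 / 43" by (intro divide_right_mono) (simp_all flip: of_nat_sum)
  finally have total: "(\<Sum>S\<in>I. f S) \<le> 126 / 43" .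
  have "1 \<le> (\<Sum>S\<in>{S \<in> I. v \<in> S}. f S)" if v: "v \<in> pverts G" for v
  proof (cases "\<exists>S\<in>{S \<in> I. v \<in> S}. 43 \<le> m S")
    case True
    then obtain S where S: "S \<in> {S \<in> I. v \<in> S}" "43 \<le> m S" by blast
    have "1 = f S" using S(2) by (simp add: f_def)
    also have "\<dots> \<le> (\<Sum>S\<in>{S \<in> I. v \<in> S}. f S)" using S(1) f01 finI by (intro member_le_sum) auto
    finally show ?thesis .
  next
    case False
    have "{i \<in> {..<126}. A i \<in> {S \<in> I. v \<in> S}} = \<phi> v"
      using \<phi> v AI unfolding fcol_def by (auto simp: A_def)
    then have "43 \<le> (\<Sum>S\<in>{S \<in> I. v \<in> S}. m S)" using msum[of "{S \<in> I. v \<in> S}"] \<phi> v by (simp add: fcol_def)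
    then have "1 \<le> real (\<Sum>S\<in>{S \<in> I. v \<in> S}. m S) / 43" by (simp del: of_nat_sum)
    also have "\<dots> = (\<Sum>S\<in>{S \<in> I. v \<in> S}. real (m S) / 43)" by (simp add: sum_divide_distrib)
    also have "\<dots> = (\<Sum>S\<in>{S \<in> I. v \<in> S}. f S)" using False by (intro sum.cong refl) (auto simp: f_def)
    finally show ?thesis .
  qed
  then show ?thesis
    using total f01 by (intro exI[of _ f]) (auto simp: fractional_coloring_def I_def[symmetric])
qed

theorem theorem1:
  fixes G :: "'a pair_pre_digraph"
  assumes "pair_graph G"
    and "triangle_free G"
    and "\<forall>v\<in>pverts G. out_degree (with_proj G) v \<le> 3"
  shows "fractional_chromatic_number G \<le> 3 - 3 / 43"
proof -
  interpret pair_graph G by fact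
  let ?E = "\<lambda>u v. (u, v) \<in> parcs G"
  have wf: "u \<in> pverts G \<and> v \<in> pverts G" if "?E u v" for u v
    using that in_arcsD1 in_arcsD2 by blast
  have "subcubic ?E (pverts G)"
  proof (unfold_locales, goal_cases)
    case (1 u v) then show ?case using arcs_symmetric by blast
  next
    case (2 v) then show ?case using pair_no_loops[of "(v, v)"] by auto
  next
    case 3 show ?case by (rule pair_finite_verts)
  next
    case (4 u v) then show ?case by (rule wf)
  next
    case (5 v)
    show ?case
    proof (cases "v \<in> pverts G")
      case True
      have "card (nbs ?E (pverts G) v) = card (Pair v ` nbs ?E (pverts G) v)"
        by (intro card_image[symmetric] inj_onI) simp
      also have "\<dots> \<le> card (out_arcs (with_proj G) v)"
        by (intro card_mono) (auto simp: nbs_def out_arcs_def)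
      also have "\<dots> \<le> 3" using bspec[OF assms(3) True] by (simp add: out_degree_def)
      finally show ?thesis .
    next
      case False
      then have "nbs ?E (pverts G) v = {}" using wf by (auto simp: nbs_def)
      then show ?thesis by simp
    qed
  next
    case (6 u v w) then show ?case using assms(2) unfolding triangle_free_def by blast
  qed
  then obtain \<phi> where "fcol ?E (pverts G) \<phi>" using fcol_exists by blast
  then obtain f where "fractional_coloring G (126 / 43) f"
    using fractional_coloring_of_fcol[OF assms(1)] by blast
  then have "fractional_chromatic_number G \<le> 126 / 43"
    by (rule fractional_chromatic_number_least(2)[OF assms(1)])
  then show ?thesis by simp
qed

end
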